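(* Let $(X,d_X)$ and $(\Theta,d_\Theta)$ be compact metric spaces and let $K\ge0$. For every $N\ge 2$ let $\Theta_N=\{\theta_1^N,\dots,\theta_N^N\}\subset\Theta$ be a finite set of types and let $J^N:\Theta_N\times X\times X^{N-1}\to\mathbb{R}$ be a function that is symmetric in its last $N-1$ variables and such that, for every $N$, all $\theta,\theta'\in\Theta_N$, all $x,y\in X$ and all $z=(z_1,\dots,z_{N-1})$, $w=(w_1,\dots,w_{N-1})$ in $X^{N-1}$, $$|J^N(\theta,x,z)-J^N(\theta',y,w)|\le K\,d_\Theta(\theta,\theta')+K\,d_X(x,y)+K\,\mathcal{W}_1\Big(\tfrac1{N-1}\sum_{k=1}^{N-1}\delta_{z_k},\tfrac1{N-1}\sum_{k=1}^{N-1}\delta_{w_k}\Big).$$ For $\theta\in\Theta_N$, $\pi\in\mathcal{P}(X)$ and $\rho=(\rho_1,\dots,\rho_{N-1})\in\mathcal{P}(X)^{N-1}$ let $$\overline{J}^N(\theta,\pi,\rho):=\int_{X^N}J^N(\theta,x,z)\,\pi(dx)\otimes\bigotimes_{k=1}^{N-1}\rho_k(dz_k),$$ and let $\overline{F}^N:\Theta\times\mathcal{P}(X)\times\mathcal{P}(\mathcal{P}(X))\to\mathbb{R}$ be the extension of $\overline{J}^N$ given by $$\overline{F}^N(\theta,\pi,Q)=\inf_{(\rho,\theta')\in\mathcal{P}(X)^{N-1}\times\Theta_N}\Big\{\overline{J}^N(\theta',\pi,\rho)+K\,d_\Theta(\theta',\theta)+K\,\mathcal{W}_1\Big(Q,\tfrac1{N-1}\sum_{k=1}^{N-1}\delta_{\rho_k}\Big)\Big\}.$$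 For every $N$ let $(\pi_1^N,\dots,\pi_N^N)\in\mathcal{P}(X)^N$ be a Nash equilibrium of the $N$-person game in which every player has strategy space $\mathcal{P}(X)$ and player $i$ has cost $(\pi_i,\pi_{-i})\mapsto\overline{J}^N(\theta_i^N,\pi_i,\pi_{-i})$ (that is, a Nash equilibrium in mixed strategies of the game in which every player has strategy space $X$ and player $i$ has cost $J^N(\theta_i^N,x_i,x_{-i})$). Set $$\mu^N:=\frac1N\sum_{i=1}^N\delta_{\theta_i^N}\in\mathcal{P}(\Theta),\qquad \nu^N:=\frac1N\sum_{i=1}^N\delta_{\pi_i^N}\in\mathcal{P}(\mathcal{P}(X)),\qquad \gamma^N:=\frac1N\sum_{i=1}^N\delta_{(\theta_i^N,\pi_i^N)}\in\mathcal{P}(\Theta\times\mathcal{P}(X)).$$ Assume that, along some subsequence of $N\to\infty$, $\mu^N\to\mu$, $\nu^N\to\nu$ and $\gamma^N\to\gamma$ weakly-$*$, and $\overline{F}^N\to\overline{F}$ in $\mathcal{C}(\Theta\times\mathcal{P}(X)\times\mathcal{P}(\mathcal{P}(X)))$. Then $\gamma$ is a Cournot-Nash equilibrium for $\overline{F}$ and $\mu$, with strategy space $\mathcal{P}(X)$.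
   Context: For a compact metric space $(Y,d_Y)$, $\mathcal{P}(Y)$ is the set of Borel probability measures on $Y$ with the weak-$*$ topology, which is metrized by the 1-Wasserstein distance $\mathcal{W}_1(\alpha,\beta)=\inf_{\gamma\in\Pi(\alpha,\beta)}\int_{Y\times Y}d_Y(x,y)\,\gamma(dx,dy)$, where $\Pi(\alpha,\beta)$ is the set of probability measures on $Y\times Y$ with marginals $\alpha$ and $\beta$. In particular $(\mathcal{P}(X),\mathcal{W}_1)$ is itself a compact metric space, and $\mathcal{W}_1$ on $\mathcal{P}(\mathcal{P}(X))$ is the 1-Wasserstein distance built on the metric space $(\mathcal{P}(X),\mathcal{W}_1)$. $\mathcal{C}(\cdot)$ denotes the space of real-valued continuous functions on a compact space, with uniform convergence. A Nash equilibrium of an $N$-person game in which player $i$ has strategy space $X_i$ and cost $J_i$ is a profile $(\overline{x}_1,\dots,\overline{x}_N)$ such that $J_i(\overline{x}_i,\overline{x}_{-i})\le J_i(x_i,\overline{x}_{-i})$ for every $i$ and every $x_i\in X_i$ (players minimise costs), where $x_{-i}=(x_j)_{j\ne i}$. Given a compact metric space $Y$ (strategy space), $G\in\mathcal{C}(\Theta\times Y\times\mathcal{P}(Y))$ and $\mu\in\mathcal{P}(\Theta)$, a Cournot-Nash equilibrium for $G$ and $\mu$ (with strategy space $Y$) is a $\gamma\in\mathcal{P}(\Theta\times Y)$ whose first marginal is $\mu$ and such that, denoting by $\nu$ the second marginal of $\gamma$, $$\gamma\big(\{(\theta,y)\in\Theta\times Y: G(\theta,y,\nu)=\min_{y'\in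 Y}G(\theta,y',\nu)\}\big)=1.$$ *)

theory Defs
  imports "HOL-Probability.Probability"
begin

section \<open>Borel probability measures on an abstract topological space\<close>

text \<open>
  Spaces are given by explicit carriers, because the construction
  \<open>Y \<mapsto> \<P>(Y)\<close> is iterated: the library's \<open>borel\<close> needs a
  topological type, which \<open>\<P>(Y)\<close> with the Wasserstein distance is not.
\<close>

definition borel_of :: "'a topology \<Rightarrow> 'a measure" where
  "borel_of T = sigma (topspace T) {U. openin T U}"

definition prob_measures :: "'a topology \<Rightarrow> 'a measure set" where
  "prob_measures T = {\<alpha>. prob_space \<alpha> \<and> sets \<alpha> = sets (borel_of T)}"

text \<open>
  The weak-* topology: the coarsest topology on the Borel probability measures for which
  \<open>\<alpha> \<mapsto> \<integral>f d\<alpha>\<close> is continuous for every real-valued continuous \<open>f\<close>.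
  It is only used over compact \<open>T\<close>, where continuous functions are bounded.
\<close>

definition weak_star :: "'a topology \<Rightarrow> 'a measure topology" where
  "weak_star T = topology_generated_by
     {{\<alpha> \<in> prob_measures T. (\<integral>x. f x \<partial>\<alpha>) \<in> U} | f U.
        continuous_map T euclideanreal f \<and> open U}"

definition empirical_measure :: "'a topology \<Rightarrow> 'i set \<Rightarrow> ('i \<Rightarrow> 'a) \<Rightarrow> 'a measure" where
  "empirical_measure T I x = measure_of (topspace T) (sets (borel_of T))
     (\<lambda>A. (\<Sum>i\<in>I. emeasure (return (borel_of T) (x i)) A) / of_nat (card I))"

section \<open>The 1-Wasserstein distance\<close>

abbreviation mtop :: "'a set \<Rightarrow> ('a \<Rightarrow> 'a \<Rightarrow> real) \<Rightarrow> 'a topology" where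
  "mtop M d \<equiv> Metric_space.mtopology M d"

definition couplings :: "'a topology \<Rightarrow> 'a measure \<Rightarrow> 'a measure \<Rightarrow> ('a \<times> 'a) measure set" where
  "couplings T \<alpha> \<beta> = {\<gamma> \<in> prob_measures (prod_topology T T).
     distr \<gamma> (borel_of T) fst = \<alpha> \<and> distr \<gamma> (borel_of T) snd = \<beta>}"

text \<open>
  The infimum is taken in the extended nonnegative reals; it is finite for
  \<open>\<alpha>, \<beta>\<close> in \<open>\<P>(M)\<close> when \<open>(M, d)\<close> is compact.
\<close>

definition wasserstein1 ::
    "'a set \<Rightarrow> ('a \<Rightarrow> 'a \<Rightarrow> real) \<Rightarrow> 'a measure \<Rightarrow> 'a measure \<Rightarrow> real" where
  "wasserstein1 M d \<alpha> \<beta> = enn2real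
     (INF \<gamma>\<in>couplings (mtop M d) \<alpha> \<beta>. \<integral>\<^sup>+ p. ennreal (d (fst p) (snd p)) \<partial>\<gamma>)"

text \<open>The metric space \<open>(\<P>(M), \<W>\<^sub>1)\<close> over a metric space \<open>(M, d)\<close>:
  its carrier and its metric topology.\<close>

abbreviation probs :: "'a set \<Rightarrow> ('a \<Rightarrow> 'a \<Rightarrow> real) \<Rightarrow> 'a measure set" where
  "probs M d \<equiv> prob_measures (mtop M d)"

abbreviation probs_top :: "'a set \<Rightarrow> ('a \<Rightarrow> 'a \<Rightarrow> real) \<Rightarrow> 'a measure topology" where
  "probs_top M d \<equiv> mtop (probs M d) (wasserstein1 M d)"

section \<open>Games and equilibria\<close>

text \<open>
  Players are \<open>{1..N}\<close>. The profile \<open>x\<^bsub>-i\<^esub>\<close> of the players other than \<open>i\<close> is reindexed,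
  in increasing order, by \<open>{1..<N}\<close>, so that it is an \<open>(N-1)\<close>-tuple.
\<close>

definition others :: "nat \<Rightarrow> nat \<Rightarrow> (nat \<Rightarrow> 'a) \<Rightarrow> nat \<Rightarrow> 'a" where
  "others N i x = (\<lambda>k\<in>{1..<N}. x (if k < i then k else k + 1))"

definition nash_equilibrium ::
    "nat \<Rightarrow> (nat \<Rightarrow> 'a set) \<Rightarrow> (nat \<Rightarrow> 'a \<Rightarrow> (nat \<Rightarrow> 'a) \<Rightarrow> real) \<Rightarrow> (nat \<Rightarrow> 'a) \<Rightarrow> bool" where
  "nash_equilibrium N S J x \<longleftrightarrow>
     (\<forall>i\<in>{1..N}. x i \<in> S i) \<and>
     (\<forall>i\<in>{1..N}. \<forall>y\<in>S i. J i (x i) (others N i x) \<le> J i y (others N i x))"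

definition cournot_nash_equilibrium ::
    "'t topology \<Rightarrow> 'y topology \<Rightarrow> ('t \<times> 'y \<times> 'y measure \<Rightarrow> real) \<Rightarrow> 't measure \<Rightarrow>
     ('t \<times> 'y) measure \<Rightarrow> bool" where
  "cournot_nash_equilibrium TT TY G \<mu> \<gamma> \<longleftrightarrow>
     \<gamma> \<in> prob_measures (prod_topology TT TY) \<and>
     distr \<gamma> (borel_of TT) fst = \<mu> \<and>
     (let \<nu> = distr \<gamma> (borel_of TY) snd in
       emeasure \<gamma> {(\<theta>, y) \<in> topspace TT \<times> topspace TY.
         is_arg_min (\<lambda>y'. G (\<theta>, y', \<nu>)) (\<lambda>y'. y' \<in> topspace TY) y} = 1)"

section \<open>Mixed extension and its Lipschitz extension\<close>

text \<open>\<open>(N-1)\<close>-tuples are extensional functions on \<open>{1..<N}\<close>; \<open>J\<close> below is the cost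
  \<open>J\<^sup>N\<close> for a fixed \<open>N\<close>.\<close>

definition mixed_cost ::
    "nat \<Rightarrow> ('t \<Rightarrow> 'x \<Rightarrow> (nat \<Rightarrow> 'x) \<Rightarrow> real) \<Rightarrow> 't \<Rightarrow> 'x measure \<Rightarrow> (nat \<Rightarrow> 'x measure) \<Rightarrow> real" where
  "mixed_cost N J \<theta> \<pi> \<rho> = (\<integral>p. J \<theta> (fst p) (snd p) \<partial>(\<pi> \<Otimes>\<^sub>M (\<Pi>\<^sub>M k\<in>{1..<N}. \<rho> k)))"

definition extended_cost ::
    "'x set \<Rightarrow> ('x \<Rightarrow> 'x \<Rightarrow> real) \<Rightarrow> ('t \<Rightarrow> 't \<Rightarrow> real) \<Rightarrow> real \<Rightarrow> nat \<Rightarrow> 't set \<Rightarrow>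
     ('t \<Rightarrow> 'x \<Rightarrow> (nat \<Rightarrow> 'x) \<Rightarrow> real) \<Rightarrow> 't \<times> 'x measure \<times> 'x measure measure \<Rightarrow> real" where
  "extended_cost X dX dT K N types J = (\<lambda>(\<theta>, \<pi>, Q).
     INF (\<rho>, \<theta>')\<in>({1..<N} \<rightarrow>\<^sub>E probs X dX) \<times> types.
       mixed_cost N J \<theta>' \<pi> \<rho> + K * dT \<theta>' \<theta>
       + K * wasserstein1 (probs X dX) (wasserstein1 X dX) Q
               (empirical_measure (probs_top X dX) {1..<N} \<rho>))"

section \<open>Basic facts about these notions\<close>

lemma space_borel_of [simp]: "space (borel_of T) = topspace T"
  unfolding borel_of_def by (rule space_measure_of) (use openin_subset in blast)

lemma emeasure_empirical_measure:
  assumes "finite I" "I \<noteq> {}" "A \<in> sets (borel_of T)"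
  shows "emeasure (empirical_measure T I x) A = (\<Sum>i\<in>I. indicator A (x i)) / of_nat (card I)"
proof -
  let ?\<mu> = "\<lambda>A. (\<Sum>i\<in>I. emeasure (return (borel_of T) (x i)) A) / of_nat (card I)"
  have "countably_additive (sets (borel_of T)) ?\<mu>"
  proof (rule countably_additiveI)
    fix B :: "nat \<Rightarrow> _"
    assume B: "range B \<subseteq> sets (borel_of T)" "disjoint_family B" "\<Union> (range B) \<in> sets (borel_of T)"
    have "(\<Sum>n. ?\<mu> (B n)) = (\<Sum>n. \<Sum>i\<in>I. emeasure (return (borel_of T) (x i)) (B n)) / of_nat (card I)"
      by (simp add: divide_ennreal_def)
    also have "(\<Sum>n. \<Sum>i\<in>I. emeasure (return (borel_of T) (x i)) (B n))
        = (\<Sum>i\<in>I. \<Sum>n. emeasure (return (borel_of T) (x i)) (B n))"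
      by (rule suminf_sum) simp
    also have "\<dots> = (\<Sum>i\<in>I. emeasure (return (borel_of T) (x i)) (\<Union> (range B)))"
      by (intro sum.cong refl suminf_emeasure) (use B in auto)
    finally show "(\<Sum>n. ?\<mu> (B n)) = ?\<mu> (\<Union> (range B))" .
  qed
  then have "emeasure (empirical_measure T I x) A = ?\<mu> A"
    unfolding empirical_measure_def
    using sets.sigma_algebra_axioms[of "borel_of T"] assms(3)
    by (intro emeasure_measure_of_sigma) (auto simp: positive_def)
  then show ?thesis
    using assms(3) by (simp add: emeasure_return)
qed

lemma topspace_weak_star [simp]: "topspace (weak_star T) = prob_measures T"
proof -
  have "continuous_map T euclideanreal (\<lambda>_. 0)" by simp
  then show ?thesis
    unfolding weak_star_def topology_generated_by_topspace by blast
qed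

lemma limitin_weak_star:
  "limitin (weak_star T) \<alpha>s \<alpha> F \<longleftrightarrow>
     \<alpha> \<in> prob_measures T \<and> (\<forall>\<^sub>F n in F. \<alpha>s n \<in> prob_measures T) \<and>
     (\<forall>f. continuous_map T euclideanreal f \<longrightarrow>
        ((\<lambda>n. \<integral>x. f x \<partial>\<alpha>s n) \<longlongrightarrow> (\<integral>x. f x \<partial>\<alpha>)) F)"
    (is "?L \<longleftrightarrow> ?R")
proof
  assume L: ?L
  have op: "openin (weak_star T) {\<alpha> \<in> prob_measures T. (\<integral>x. f x \<partial>\<alpha>) \<in> U}"
    if "continuous_map T euclideanreal f" "open U" for f U
    unfolding weak_star_def by (rule topology_generated_by_Basis) (use that in blast)
  have "\<alpha> \<in> prob_measures T"
    using limitin_topspace[OF L] by simp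
  moreover have "\<forall>\<^sub>F n in F. \<alpha>s n \<in> prob_measures T"
    using L openin_topspace[of "weak_star T"] unfolding limitin_def by simp
  moreover have "((\<lambda>n. \<integral>x. f x \<partial>\<alpha>s n) \<longlongrightarrow> (\<integral>x. f x \<partial>\<alpha>)) F"
    if f: "continuous_map T euclideanreal f" for f
  proof (rule topological_tendstoI)
    fix U :: "real set" assume "open U" "(\<integral>x. f x \<partial>\<alpha>) \<in> U"
    then have "\<forall>\<^sub>F n in F. \<alpha>s n \<in> {\<alpha> \<in> prob_measures T. (\<integral>x. f x \<partial>\<alpha>) \<in> U}"
      using L op[OF f, of U] \<open>\<alpha> \<in> prob_measures T\<close> unfolding limitin_def by blast
    then show "\<forall>\<^sub>F n in F. (\<integral>x. f x \<partial>\<alpha>s n) \<in> U"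
      by (rule eventually_mono) simp
  qed
  ultimately show ?R by blast
next
  assume R: ?R
  have "\<forall>\<^sub>F n in F. \<alpha>s n \<in> W" if "openin (weak_star T) W" "\<alpha> \<in> W" for W
  proof -
    have "generate_topology_on {{\<alpha> \<in> prob_measures T. (\<integral>x. f x \<partial>\<alpha>) \<in> U} | f U.
        continuous_map T euclideanreal f \<and> open U} W"
      using that(1) unfolding weak_star_def by (simp add: openin_topology_generated_by_iff)
    then show ?thesis using that(2)
    proof induction
      case (Int a b)
      then show ?case by (auto elim: eventually_elim2)
    next
      case (UN K)
      then obtain k where "k \<in> K" "\<alpha> \<in> k" by blast
      with UN have "\<forall>\<^sub>F n in F. \<alpha>s n \<in> k" by blast
      then show ?case by (rule eventually_mono) (use \<open>k \<in> K\<close> in blast)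
    next
      case (Basis s)
      then obtain f U where s: "s = {\<alpha> \<in> prob_measures T. (\<integral>x. f x \<partial>\<alpha>) \<in> U}"
        and fU: "continuous_map T euclideanreal f" "open U" by blast
      have "\<forall>\<^sub>F n in F. (\<integral>x. f x \<partial>\<alpha>s n) \<in> U"
        using R fU Basis s by (auto intro: topological_tendstoD)
      with R show ?case unfolding s by (auto elim: eventually_elim2)
    qed simp
  qed
  with R show ?L unfolding limitin_def by simp
qed

end

theory Submission
  imports Defs
begin

text \<open>
  The mixed cost of a player depends on the opponents' strategies \<open>\<rho>\<^sub>1, \<dots>, \<rho>\<^bsub>N-1\<^esub>\<close> in a symmetric way,
  and exchanging them one coordinate at a time shows that it varies by at most
  \<open>K/(N-1) \<Sum>\<^sub>k \<W>\<^sub>1(\<rho>\<^sub>k, \<rho>'\<^sub>k)\<close>. By duality for the assignment problem the best such sum over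
  all relabellings is, up to an error of order \<open>1/N\<close>, at most the Wasserstein distance in
  \<open>\<P>(\<P>(X))\<close> between \<open>\<nu>\<^sup>N\<close> and the empirical measure of \<open>\<rho>'\<close>. Hence the extended cost at
  \<open>\<nu>\<^sup>N\<close> agrees with player \<open>i\<close>'s mixed cost against the equilibrium up to \<open>O(1/N)\<close>, and the Nash
  property says that \<open>\<pi>\<^sub>i\<^sup>N\<close> almost minimises \<open>F\<^sup>N(\<theta>\<^sub>i\<^sup>N, \<cdot>, \<nu>\<^sup>N)\<close>.
  For a fixed competitor \<open>y\<close>, integrating the truncated excess \<open>F(\<theta>, \<pi>, \<nu>) - F(\<theta>, y, \<nu>)\<close> against
  \<open>\<gamma>\<^sup>N\<close> and passing to the limit gives \<open>F(\<theta>, \<pi>, \<nu>) \<le> F(\<theta>, y, \<nu>)\<close> for \<open>\<gamma>\<close>-almost all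
  \<open>(\<theta>, \<pi>)\<close>; countably many \<open>y\<close> suffice. Compactness of \<open>\<P>(X)\<close> is replaced by the weaker fact that
  finitely many measures approximate every element of \<open>\<P>(X)\<close> uniformly on \<open>K\<close>-Lipschitz functions;
  the functions \<open>F\<^sup>N\<close> and \<open>F\<close> are continuous in \<open>\<pi>\<close> with respect to that notion of closeness.
\<close>

section \<open>Borel sets and empirical measures\<close>

text \<open>The lower bound on the extended cost needs a lower bound on the Wasserstein distance
  between empirical measures with N and N-1 atoms, whose couplings are not mixtures of permutations.
  So player i is left out, the square assignment problem between the N-1 remaining strategies and
  \<rho> is solved, and its dual solution is extended to a 1-Lipschitz function on \<P>(X). Testing
  a coupling with that function bounds its cost from below, and no analysis of extreme couplings
  enters. Leaving out one player moves mass 1/N over a distance of at most the bound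
  \<open>B\<close> of the metric, which is the source of every error term
  \<open>K * B / real N\<close>. A second constraint shapes the layout: compactness is at hand for X
  and \<Theta> only, while for \<P>(X) just the metric axioms and the same bound \<open>B\<close>
  are established. What rests on a fine finite partition (product couplings, gluing, Borel sets of
  products) is therefore proved over a compact base, and what is used on both levels is proved from
  boundedness alone. Finally, \<open>K\<close> does not depend on N, so all extended costs share one
  modulus of continuity and the limit inherits it.\<close>

lemma openin_sets_borel_of: "openin T U \<Longrightarrow> U \<in> sets (borel_of T)"
  unfolding borel_of_def using openin_subset by (subst sets_measure_of) (auto intro!: sigma_sets.Basic)

lemma closedin_sets_borel_of:
  assumes "closedin T C" shows "C \<in> sets (borel_of T)"
proof -
  have "space (borel_of T) - (topspace T - C) \<in> sets (borel_of T)"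
    using assms by (intro sets.compl_sets openin_sets_borel_of) (simp add: closedin_def)
  then show ?thesis
    using closedin_subset[OF assms] by (simp add: double_diff)
qed

lemma continuous_map_measurable:
  assumes "continuous_map S T f" shows "f \<in> measurable (borel_of S) (borel_of T)"
  unfolding borel_of_def[of T]
proof (rule measurable_measure_of)
  show "{U. openin T U} \<subseteq> Pow (topspace T)" using openin_subset by blast
  show "f \<in> space (borel_of S) \<rightarrow> topspace T" using assms by (auto simp: continuous_map_def)
  fix U assume "U \<in> {U. openin T U}"
  then have "openin S {x \<in> topspace S. f x \<in> U}" using assms by (simp add: continuous_map_def)
  then show "f -` U \<inter> space (borel_of S) \<in> sets (borel_of S)"
    by (auto dest!: openin_sets_borel_of simp: vimage_def Int_def conj_commute)
qed

lemma continuous_map_borel_measurable: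
  fixes f :: "'a \<Rightarrow> real"
  assumes "continuous_map S euclideanreal f" shows "f \<in> borel_measurable (borel_of S)"
  using continuous_map_measurable[OF assms] by (simp add: borel_of_def borel_def)

lemma prob_measuresD:
  assumes "\<alpha> \<in> prob_measures T"
  shows "prob_space \<alpha>" "sets \<alpha> = sets (borel_of T)" "space \<alpha> = topspace T"
  using assms sets_eq_imp_space_eq[of \<alpha> "borel_of T"] by (auto simp: prob_measures_def)

lemma prob_measures_topspace_nonempty: "\<alpha> \<in> prob_measures T \<Longrightarrow> topspace T \<noteq> {}"
  using prob_measuresD prob_space.not_empty by metis

lemma distr_in_prob_measures:
  assumes "\<alpha> \<in> prob_measures S" "f \<in> measurable (borel_of S) (borel_of T)"
  shows "distr \<alpha> (borel_of T) f \<in> prob_measures T"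
proof -
  have "f \<in> measurable \<alpha> (borel_of T)"
    using assms(2) by (simp cong: measurable_cong_sets add: prob_measuresD[OF assms(1)])
  then show ?thesis
    using prob_measuresD(1)[OF assms(1)] by (simp add: prob_measures_def prob_space.prob_space_distr)
qed

text \<open>As a push-forward of a counting measure, the empirical measure gets its images and
  integrals from the general rules for \<open>distr\<close>.\<close>

lemma empirical_measure_eq_distr:
  assumes "finite I" "I \<noteq> {}" "\<And>i. i \<in> I \<Longrightarrow> x i \<in> topspace T"
  shows "empirical_measure T I x = distr (uniform_count_measure I) (borel_of T) x"
proof (rule measure_eqI)
  show S: "sets (empirical_measure T I x) = sets (distr (uniform_count_measure I) (borel_of T) x)"
    unfolding empirical_measure_def using sets.sets_into_space[of _ "borel_of T"] sets.sigma_sets_eq[of "borel_of T"]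
    by (subst sets_measure_of) auto
  fix A assume "A \<in> sets (empirical_measure T I x)"
  then have A: "A \<in> sets (borel_of T)" using S by simp
  have m: "x \<in> measurable (uniform_count_measure I) (borel_of T)"
    using assms by (auto simp: measurable_def space_uniform_count_measure sets_uniform_count_measure)
  have "emeasure (distr (uniform_count_measure I) (borel_of T) x) A = card (x -` A \<inter> I) / card I"
    using A m assms by (simp add: emeasure_distr space_uniform_count_measure emeasure_uniform_count_measure)
  also have "\<dots> = ennreal (card (x -` A \<inter> I)) / ennreal (card I)"
    using assms by (simp add: divide_ennreal card_gt_0_iff)
  also have "(\<Sum>i\<in>I. indicator A (x i)) = ennreal (card (x -` A \<inter> I))"
  proof -
    have "(\<Sum>i\<in>I. indicator A (x i) :: ennreal) = (\<Sum>i\<in>x -` A \<inter> I. 1)"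
      using assms by (intro sum.mono_neutral_cong_right) (auto simp: indicator_def)
    then show ?thesis by (simp add: ennreal_of_nat_eq_real_of_nat)
  qed
  then have "ennreal (card (x -` A \<inter> I)) / ennreal (card I) = emeasure (empirical_measure T I x) A"
    using assms A by (simp add: emeasure_empirical_measure ennreal_of_nat_eq_real_of_nat)
  finally show "emeasure (empirical_measure T I x) A
      = emeasure (distr (uniform_count_measure I) (borel_of T) x) A" by simp
qed

context
  fixes T :: "'a topology" and I :: "'i set" and x :: "'i \<Rightarrow> 'a"
  assumes I: "finite I" "I \<noteq> {}" and x: "\<And>i. i \<in> I \<Longrightarrow> x i \<in> topspace T"
begin

lemma measurable_uniform_count_measure: "x \<in> measurable (uniform_count_measure I) (borel_of T)"
  using x by (auto simp: measurable_def space_uniform_count_measure sets_uniform_count_measure)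

lemma empirical_measure_in_prob_measures: "empirical_measure T I x \<in> prob_measures T"
  using I x prob_space.prob_space_distr[OF prob_space_uniform_count_measure measurable_uniform_count_measure]
  by (simp add: prob_measures_def empirical_measure_eq_distr)

lemma distr_empirical_measure:
  assumes "f \<in> measurable (borel_of T) (borel_of S)"
  shows "distr (empirical_measure T I x) (borel_of S) f = empirical_measure S I (\<lambda>i. f (x i))"
proof -
  have "f y \<in> topspace S" if "y \<in> topspace T" for y
    using measurable_space[OF assms] that by simp
  then show ?thesis
    using I x assms measurable_uniform_count_measure
    by (simp add: empirical_measure_eq_distr distr_distr comp_def)
qed

lemma integral_empirical_measure:
  fixes f :: "'a \<Rightarrow> real"
  assumes "f \<in> borel_measurable (borel_of T)"
  shows "(\<integral>y. f y \<partial>empirical_measure T I x) = (\<Sum>i\<in>I. f (x i)) / card I"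
  using I x assms measurable_uniform_count_measure
  by (simp add: empirical_measure_eq_distr integral_distr uniform_count_measure_def
      lebesgue_integral_point_measure_finite sum_divide_distrib)

end

text \<open>Every atom is repeated m times and \<open>card K = m * card I\<close>, so m cancels.
  This rewrites two empirical measures with different numbers of atoms over one common index set,
  where they can be coupled index by index.\<close>

lemma empirical_measure_fibres:
  assumes "finite K" "finite I" "I \<noteq> {}" "m > 0" "g ` K \<subseteq> I"
    and fib: "\<And>i. i \<in> I \<Longrightarrow> card {k \<in> K. g k = i} = m"
    and x: "\<And>i. i \<in> I \<Longrightarrow> x i \<in> topspace T"
  shows "empirical_measure T K (\<lambda>k. x (g k)) = empirical_measure T I x"
proof (rule measure_eqI)
  have s: "(\<Sum>k\<in>K. h (g k)) = m * (\<Sum>i\<in>I. h i)" for h :: "_ \<Rightarrow> nat"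
  proof -
    have "(\<Sum>k\<in>K. h (g k)) = (\<Sum>i\<in>I. \<Sum>k\<in>{k \<in> K. g k = i}. h (g k))"
      by (rule sum.group[symmetric]) (use assms in auto)
    also have "\<dots> = (\<Sum>i\<in>I. m * h i)"
      by (intro sum.cong refl) (simp add: fib)
    finally show ?thesis by (simp add: sum_distrib_left)
  qed
  have cK: "card K = m * card I" using s[of "\<lambda>_. 1"] by simp
  then have "K \<noteq> {}" using assms by auto
  have P: "empirical_measure T K (\<lambda>k. x (g k)) \<in> prob_measures T" "empirical_measure T I x \<in> prob_measures T"
    using assms \<open>K \<noteq> {}\<close> by (auto intro!: empirical_measure_in_prob_measures)
  then show "sets (empirical_measure T K (\<lambda>k. x (g k))) = sets (empirical_measure T I x)"
    by (simp add: prob_measures_def)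
  fix A assume "A \<in> sets (empirical_measure T K (\<lambda>k. x (g k)))"
  then have A: "A \<in> sets (borel_of T)" using P by (simp add: prob_measures_def)
  have "(\<Sum>k\<in>K. indicator A (x (g k)) :: ennreal) = of_nat (\<Sum>k\<in>K. indicator A (x (g k)))"
    by (auto simp: indicator_def intro!: sum.cong)
  also have "\<dots> = ennreal (real m * real (\<Sum>i\<in>I. indicator A (x i)))"
    unfolding s[of "\<lambda>i. indicator A (x i)"] by (simp only: ennreal_of_nat_eq_real_of_nat of_nat_mult)
  finally have 1: "(\<Sum>k\<in>K. indicator A (x (g k)) :: ennreal) = ennreal (real m * real (\<Sum>i\<in>I. indicator A (x i)))" .
  have "(\<Sum>i\<in>I. indicator A (x i) :: ennreal) = of_nat (\<Sum>i\<in>I. indicator A (x i))"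
    by (auto simp: indicator_def intro!: sum.cong)
  then have 2: "(\<Sum>i\<in>I. indicator A (x i) :: ennreal) = ennreal (real (\<Sum>i\<in>I. indicator A (x i)))"
    by (simp only: ennreal_of_nat_eq_real_of_nat)
  have "emeasure (empirical_measure T K (\<lambda>k. x (g k))) A
      = ennreal (real m * real (\<Sum>i\<in>I. indicator A (x i))) / ennreal (real (card K))"
    unfolding emeasure_empirical_measure[OF assms(1) \<open>K \<noteq> {}\<close> A] 1 ennreal_of_nat_eq_real_of_nat ..
  also have "\<dots> = ennreal (real (\<Sum>i\<in>I. indicator A (x i))) / ennreal (real (card I))"
    using assms by (simp add: divide_ennreal cK card_gt_0_iff sum_nonneg del: of_nat_sum)
  also have "\<dots> = emeasure (empirical_measure T I x) A"
    unfolding emeasure_empirical_measure[OF assms(2,3) A] 2 ennreal_of_nat_eq_real_of_nat ..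
  finally show "emeasure (empirical_measure T K (\<lambda>k. x (g k))) A = emeasure (empirical_measure T I x) A" .
qed

section \<open>Couplings and Lipschitz functions\<close>

lemma couplingsD:
  assumes "\<gamma> \<in> couplings T \<alpha> \<beta>"
  shows "\<gamma> \<in> prob_measures (prod_topology T T)"
    "distr \<gamma> (borel_of T) fst = \<alpha>" "distr \<gamma> (borel_of T) snd = \<beta>"
    "fst \<in> measurable \<gamma> (borel_of T)" "snd \<in> measurable \<gamma> (borel_of T)"
proof -
  show g: "\<gamma> \<in> prob_measures (prod_topology T T)"
    "distr \<gamma> (borel_of T) fst = \<alpha>" "distr \<gamma> (borel_of T) snd = \<beta>"
    using assms by (auto simp: couplings_def)
  show "fst \<in> measurable \<gamma> (borel_of T)" "snd \<in> measurable \<gamma> (borel_of T)"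
    using continuous_map_measurable[OF continuous_map_fst, of T T]
      continuous_map_measurable[OF continuous_map_snd, of T T] prob_measuresD(2)[OF g(1)]
    by (simp_all cong: measurable_cong_sets)
qed

lemma couplings_prob_measures:
  assumes "\<gamma> \<in> couplings T \<alpha> \<beta>" shows "\<alpha> \<in> prob_measures T" "\<beta> \<in> prob_measures T"
  using distr_in_prob_measures[OF couplingsD(1)[OF assms]] couplingsD(2,3)[OF assms]
    continuous_map_measurable[OF continuous_map_fst, of T T]
    continuous_map_measurable[OF continuous_map_snd, of T T]
  by auto

lemma empirical_measure_coupling:
  assumes "finite I" "I \<noteq> {}" "\<And>i. i \<in> I \<Longrightarrow> x i \<in> topspace T" "\<And>i. i \<in> I \<Longrightarrow> y i \<in> topspace T"
  shows "empirical_measure (prod_topology T T) I (\<lambda>i. (x i, y i))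
    \<in> couplings T (empirical_measure T I x) (empirical_measure T I y)"
  using assms empirical_measure_in_prob_measures[of I "\<lambda>i. (x i, y i)" "prod_topology T T"]
    distr_empirical_measure[of I "\<lambda>i. (x i, y i)" "prod_topology T T" fst T]
    distr_empirical_measure[of I "\<lambda>i. (x i, y i)" "prod_topology T T" snd T]
    continuous_map_measurable[OF continuous_map_fst, of T T]
    continuous_map_measurable[OF continuous_map_snd, of T T]
  by (simp add: couplings_def)

text \<open>The product coupling, written as an empirical measure over pairs of indices. It serves
  \<P>(X), where \<open>couplings_nonempty\<close>, stated for compact spaces, does not
  apply.\<close>

lemma couplings_empirical_measure_nonempty:
  assumes "finite I" "I \<noteq> {}" "finite I'" "I' \<noteq> {}"
    "\<And>i. i \<in> I \<Longrightarrow> x i \<in> topspace T" "\<And>i. i \<in> I' \<Longrightarrow> y i \<in> topspace T"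
  shows "couplings T (empirical_measure T I x) (empirical_measure T I' y) \<noteq> {}"
proof -
  have "{k \<in> I \<times> I'. fst k = i} = {i} \<times> I'" if "i \<in> I" for i using that by auto
  then have "empirical_measure T (I \<times> I') (\<lambda>p. x (fst p)) = empirical_measure T I x"
    using assms by (intro empirical_measure_fibres[of _ _ "card I'"]) (auto simp: card_gt_0_iff card_cartesian_product)
  moreover have "{k \<in> I \<times> I'. snd k = i} = I \<times> {i}" if "i \<in> I'" for i using that by auto
  then have "empirical_measure T (I \<times> I') (\<lambda>p. y (snd p)) = empirical_measure T I' y"
    using assms by (intro empirical_measure_fibres[of _ _ "card I"]) (auto simp: card_gt_0_iff card_cartesian_product)
  ultimately show ?thesis
    using empirical_measure_coupling[of "I \<times> I'" "\<lambda>p. x (fst p)" T "\<lambda>p. y (snd p)"] assms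
    by auto
qed

section \<open>Continuity of Lipschitz functions and of the distance\<close>

context Metric_space
begin

lemma lipschitz_continuous_map:
  assumes L: "\<And>x y. x \<in> M \<Longrightarrow> y \<in> M \<Longrightarrow> \<bar>f x - f y\<bar> \<le> L * d x y"
  shows "continuous_map mtopology euclideanreal f"
  unfolding continuous_map_def openin_mtopology topspace_mtopology
proof (intro conjI allI impI)
  show "f \<in> M \<rightarrow> topspace euclideanreal" by simp
  fix U :: "real set" and x
  assume U: "openin euclideanreal U" and x: "x \<in> {x \<in> M. f x \<in> U}"
  then obtain e where e: "e > 0" "ball (f x) e \<subseteq> U"
    by (auto simp: open_contains_ball)
  \<comment> \<open>The sign of \<open>L\<close> is open; the denominator is positive in any
    case.\<close>
  define r where "r = e / (\<bar>L\<bar> + 1)"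
  have "r > 0" using e by (simp add: r_def)
  moreover have "f y \<in> U" if "y \<in> mball x r" for y
  proof -
    have y: "x \<in> M" "y \<in> M" "d x y < r" using that by auto
    have "\<bar>f x - f y\<bar> \<le> (\<bar>L\<bar> + 1) * d x y"
      using L[OF y(1,2)] mult_right_mono[of L "\<bar>L\<bar> + 1" "d x y", OF _ nonneg] by linarith
    also have "\<dots> < (\<bar>L\<bar> + 1) * r" by (rule mult_strict_left_mono) (use y in auto)
    also have "\<dots> = e" by (simp add: r_def)
    finally show ?thesis using e(2) by (auto simp: dist_real_def)
  qed
  ultimately show "\<exists>r>0. mball x r \<subseteq> {x \<in> M. f x \<in> U}" by (auto intro!: exI[of _ r])
qed auto

lemma continuous_map_distance:
  "continuous_map (prod_topology mtopology mtopology) euclideanreal (\<lambda>p. d (fst p) (snd p))"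
  unfolding continuous_map_def
proof (intro conjI allI impI)
  fix U :: "real set" assume U: "openin euclideanreal U"
  let ?W = "{p \<in> topspace (prod_topology mtopology mtopology). d (fst p) (snd p) \<in> U}"
  show "openin (prod_topology mtopology mtopology) ?W"
    unfolding openin_prod_topology_alt
  proof (intro allI impI)
    fix x y assume xy: "(x, y) \<in> ?W"
    then obtain e where e: "e > 0" "ball (d x y) e \<subseteq> U"
      using U by (auto simp: open_contains_ball)
    have "d x' y' \<in> U" if "x' \<in> mball x (e/2)" "y' \<in> mball y (e/2)" for x' y'
    proof -
      have "\<bar>d x y - d x' y'\<bar> \<le> d x x' + d y y'"
        using that triangle[of x x' y] triangle[of x' y' y] triangle[of x' x y'] triangle[of x y y']
          commute[of x x'] commute[of y y'] by auto
      then show ?thesis using that e(2) by (auto simp: dist_real_def)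
    qed
    then show "\<exists>V V'. openin mtopology V \<and> openin mtopology V' \<and> x \<in> V \<and> y \<in> V' \<and> V \<times> V' \<subseteq> ?W"
      using xy e by (intro exI[of _ "mball x (e/2)"] exI[of _ "mball y (e/2)"]) auto
  qed
qed auto

lemma measurable_distance:
  "(\<lambda>p. d (fst p) (snd p)) \<in> borel_measurable (borel_of (prod_topology mtopology mtopology))"
  by (rule continuous_map_borel_measurable[OF continuous_map_distance])

lemma coupling_in_space_iff:
  "\<gamma> \<in> couplings mtopology \<alpha> \<beta> \<Longrightarrow> p \<in> space \<gamma> \<longleftrightarrow> fst p \<in> M \<and> snd p \<in> M"
  by (cases p) (simp add: prob_measuresD(3)[OF couplingsD(1)])

lemma coupling_borel_measurable:
  assumes "\<gamma> \<in> couplings mtopology \<alpha> \<beta>"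
  shows "(\<lambda>p. d (fst p) (snd p)) \<in> borel_measurable \<gamma>"
  using measurable_distance prob_measuresD(2)[OF couplingsD(1)[OF assms]]
  by (simp cong: measurable_cong_sets)

end

locale bounded_metric = Metric_space +
  fixes B :: real
  assumes bounded: "\<And>x y. x \<in> M \<Longrightarrow> y \<in> M \<Longrightarrow> d x y \<le> B"
begin

lemma coupling_integrable:
  assumes "\<gamma> \<in> couplings mtopology \<alpha> \<beta>"
  shows "integrable \<gamma> (\<lambda>p. d (fst p) (snd p))"
proof -
  interpret prob_space \<gamma> using prob_measuresD(1)[OF couplingsD(1)[OF assms]] .
  show ?thesis
    using coupling_borel_measurable[OF assms] coupling_in_space_iff[OF assms] bounded
    by (intro integrable_const_bound[of _ B] AE_I2) auto
qed

lemma coupling_nn_integral: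
  assumes "\<gamma> \<in> couplings mtopology \<alpha> \<beta>"
  shows "(\<integral>\<^sup>+p. ennreal (d (fst p) (snd p)) \<partial>\<gamma>) = ennreal (\<integral>p. d (fst p) (snd p) \<partial>\<gamma>)"
  by (rule nn_integral_eq_integral[OF coupling_integrable[OF assms]]) simp

lemma wasserstein1_nonneg: "wasserstein1 M d \<alpha> \<beta> \<ge> 0"
  by (simp add: wasserstein1_def)

lemma wasserstein1_le:
  assumes "\<gamma> \<in> couplings mtopology \<alpha> \<beta>"
  shows "wasserstein1 M d \<alpha> \<beta> \<le> (\<integral>p. d (fst p) (snd p) \<partial>\<gamma>)"
proof -
  have "(INF \<gamma>\<in>couplings mtopology \<alpha> \<beta>. \<integral>\<^sup>+ p. ennreal (d (fst p) (snd p)) \<partial>\<gamma>)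
      \<le> ennreal (\<integral>p. d (fst p) (snd p) \<partial>\<gamma>)"
    using INF_lower[OF assms, of "\<lambda>\<gamma>. \<integral>\<^sup>+ p. ennreal (d (fst p) (snd p)) \<partial>\<gamma>"]
      coupling_nn_integral[OF assms] by simp
  then show ?thesis
    unfolding wasserstein1_def by (rule enn2real_leI[rotated]) simp
qed

text \<open>Without couplings the infimum would be infinite and \<open>enn2real\<close> would send
  it to 0. With one coupling the infimum is finite and equals \<open>wasserstein1\<close>, hence
  near-minimisers exist; they stand in for optimal couplings throughout.\<close>

lemma wasserstein1_approx:
  assumes "couplings mtopology \<alpha> \<beta> \<noteq> {}" "e > 0"
  shows "\<exists>\<gamma>\<in>couplings mtopology \<alpha> \<beta>. (\<integral>p. d (fst p) (snd p) \<partial>\<gamma>) < wasserstein1 M d \<alpha> \<beta> + e"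
proof -
  let ?I = "INF \<gamma>\<in>couplings mtopology \<alpha> \<beta>. \<integral>\<^sup>+ p. ennreal (d (fst p) (snd p)) \<partial>\<gamma>"
  obtain \<gamma> where g: "\<gamma> \<in> couplings mtopology \<alpha> \<beta>" using assms by blast
  have "?I \<le> ennreal (\<integral>p. d (fst p) (snd p) \<partial>\<gamma>)"
    using INF_lower[OF g, of "\<lambda>\<gamma>. \<integral>\<^sup>+ p. ennreal (d (fst p) (snd p)) \<partial>\<gamma>"]
      coupling_nn_integral[OF g] by simp
  then have "?I < top" by (rule le_less_trans) simp
  then have I: "?I = ennreal (wasserstein1 M d \<alpha> \<beta>)" by (simp add: wasserstein1_def)
  also have "\<dots> < ennreal (wasserstein1 M d \<alpha> \<beta> + e)"
    using assms(2) wasserstein1_nonneg[of \<alpha> \<beta>] by (intro ennreal_lessI) auto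
  finally obtain \<gamma>' where g': "\<gamma>' \<in> couplings mtopology \<alpha> \<beta>"
      "(\<integral>\<^sup>+ p. ennreal (d (fst p) (snd p)) \<partial>\<gamma>') < ennreal (wasserstein1 M d \<alpha> \<beta> + e)"
    by (auto simp: INF_less_iff)
  then show ?thesis
    using assms(2) wasserstein1_nonneg[of \<alpha> \<beta>]
    by (intro bexI[of _ \<gamma>']) (auto simp: coupling_nn_integral ennreal_less_iff simp del: ennreal_plus)
qed

lemma wasserstein1_le_bound:
  assumes "couplings mtopology \<alpha> \<beta> \<noteq> {}" shows "wasserstein1 M d \<alpha> \<beta> \<le> B"
proof -
  obtain \<gamma> where g: "\<gamma> \<in> couplings mtopology \<alpha> \<beta>" using assms by blast
  interpret prob_space \<gamma> using prob_measuresD(1)[OF couplingsD(1)[OF g]] .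
  have "(\<integral>p. d (fst p) (snd p) \<partial>\<gamma>) \<le> (\<integral>p. B \<partial>\<gamma>)"
    using coupling_integrable[OF g] coupling_in_space_iff[OF g] bounded by (intro integral_mono) auto
  then show ?thesis using wasserstein1_le[OF g] prob_space by simp
qed

lemma lipschitz_bounded_measurable:
  assumes L: "\<And>x y. x \<in> M \<Longrightarrow> y \<in> M \<Longrightarrow> \<bar>f x - f y\<bar> \<le> L * d x y" "L \<ge> 0"
    and \<alpha>: "\<alpha> \<in> prob_measures mtopology"
  shows "f \<in> borel_measurable \<alpha>" "integrable \<alpha> f"
proof -
  interpret prob_space \<alpha> using prob_measuresD(1)[OF \<alpha>] .
  show m: "f \<in> borel_measurable \<alpha>"
    using continuous_map_borel_measurable[OF lipschitz_continuous_map[OF L(1)]] prob_measuresD(2)[OF \<alpha>]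
    by (simp cong: measurable_cong_sets)
  obtain x0 where x0: "x0 \<in> M" using prob_measures_topspace_nonempty[OF \<alpha>] by auto
  have "\<bar>f x\<bar> \<le> \<bar>f x0\<bar> + L * B" if "x \<in> M" for x
    using L(1)[OF that x0] mult_left_mono[OF bounded[OF that x0] L(2)] by linarith
  then show "integrable \<alpha> f"
    using m prob_measuresD(3)[OF \<alpha>] by (intro integrable_const_bound[of _ "\<bar>f x0\<bar> + L * B"] AE_I2) auto
qed

lemma coupling_integral_diff:
  assumes g: "\<gamma> \<in> couplings mtopology \<alpha> \<beta>"
    and L: "\<And>x y. x \<in> M \<Longrightarrow> y \<in> M \<Longrightarrow> \<bar>f x - f y\<bar> \<le> L * d x y" "L \<ge> 0"
  shows "\<bar>(\<integral>x. f x \<partial>\<alpha>) - (\<integral>x. f x \<partial>\<beta>)\<bar> \<le> L * (\<integral>p. d (fst p) (snd p) \<partial>\<gamma>)"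
proof -
  note g' = couplingsD[OF g] couplings_prob_measures[OF g]
  have i: "integrable \<gamma> (\<lambda>p. f (fst p))" "integrable \<gamma> (\<lambda>p. f (snd p))"
    using lipschitz_bounded_measurable[OF L g'(6)] lipschitz_bounded_measurable[OF L g'(7)] g'(2-5)
    by (metis integrable_distr)+
  have m: "f \<in> borel_measurable (borel_of mtopology)"
    by (rule continuous_map_borel_measurable[OF lipschitz_continuous_map[OF L(1)]])
  have "(\<integral>x. f x \<partial>\<alpha>) = (\<integral>p. f (fst p) \<partial>\<gamma>)" "(\<integral>x. f x \<partial>\<beta>) = (\<integral>p. f (snd p) \<partial>\<gamma>)"
    using integral_distr[OF g'(4) m] integral_distr[OF g'(5) m] g'(2,3) by auto
  then have "\<bar>(\<integral>x. f x \<partial>\<alpha>) - (\<integral>x. f x \<partial>\<beta>)\<bar> = \<bar>\<integral>p. f (fst p) - f (snd p) \<partial>\<gamma>\<bar>"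
    using i by simp
  also have "\<dots> \<le> (\<integral>p. \<bar>f (fst p) - f (snd p)\<bar> \<partial>\<gamma>)" by (rule integral_abs_bound)
  also have "\<dots> \<le> (\<integral>p. L * d (fst p) (snd p) \<partial>\<gamma>)"
    using i coupling_integrable[OF g] L coupling_in_space_iff[OF g] by (intro integral_mono) auto
  finally show ?thesis by simp
qed

text \<open>The easy half of Kantorovich-Rubinstein duality: the bound holds for each coupling by
  integrating the Lipschitz estimate, then for the infimum.\<close>

lemma lipschitz_integral_le_wasserstein1:
  assumes "couplings mtopology \<alpha> \<beta> \<noteq> {}"
    and L: "\<And>x y. x \<in> M \<Longrightarrow> y \<in> M \<Longrightarrow> \<bar>f x - f y\<bar> \<le> L * d x y" "L \<ge> 0"
  shows "\<bar>(\<integral>x. f x \<partial>\<alpha>) - (\<integral>x. f x \<partial>\<beta>)\<bar> \<le> L * wasserstein1 M d \<alpha> \<beta>"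
proof (rule field_le_epsilon)
  fix e :: real assume e: "e > 0"
  \<comment> \<open>Since \<open>L\<close> may be 0, the slack is divided by
    \<open>L + 1\<close>.\<close>
  obtain \<gamma> where g: "\<gamma> \<in> couplings mtopology \<alpha> \<beta>"
      "(\<integral>p. d (fst p) (snd p) \<partial>\<gamma>) < wasserstein1 M d \<alpha> \<beta> + e / (L + 1)"
    using wasserstein1_approx[OF assms(1), of "e / (L + 1)"] e L(2) by auto
  have "\<bar>(\<integral>x. f x \<partial>\<alpha>) - (\<integral>x. f x \<partial>\<beta>)\<bar> \<le> L * (wasserstein1 M d \<alpha> \<beta> + e / (L + 1))"
    using coupling_integral_diff[OF g(1) L] mult_left_mono[OF less_imp_le[OF g(2)] L(2)] by linarith
  also have "\<dots> \<le> L * wasserstein1 M d \<alpha> \<beta> + e"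
    using L(2) e by (simp add: field_simps)
  finally show "\<bar>(\<integral>x. f x \<partial>\<alpha>) - (\<integral>x. f x \<partial>\<beta>)\<bar> \<le> L * wasserstein1 M d \<alpha> \<beta> + e" .
qed

lemma wasserstein1_empirical_measure_le:
  assumes "finite I" "I \<noteq> {}" "\<And>i. i \<in> I \<Longrightarrow> x i \<in> M" "\<And>i. i \<in> I \<Longrightarrow> y i \<in> M"
  shows "wasserstein1 M d (empirical_measure mtopology I x) (empirical_measure mtopology I y)
    \<le> (\<Sum>i\<in>I. d (x i) (y i)) / card I"
  using wasserstein1_le[OF empirical_measure_coupling[of I x mtopology y]] assms measurable_distance
  by (simp add: integral_empirical_measure)

end

section \<open>Compact metric spaces\<close>

locale compact_metric = Metric_space +
  assumes compact: "compact_space mtopology"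
begin

lemma bounded_metric_ex: "\<exists>B. bounded_metric M d B"
proof -
  have "mbounded M"
    using compact compact_space_eq_mcomplete_mtotally_bounded mtotally_bounded_imp_mbounded by blast
  then show ?thesis
    using Metric_space_axioms by (auto simp: mbounded_alt bounded_metric_def bounded_metric_axioms_def)
qed

text \<open>Enumerate a finite net and send x to the first centre whose ball contains it; taking the
  first makes every fibre a finite union of differences of balls, hence Borel. These finitely valued
  maps supply measurability on products, the cells used for gluing, and the discretisation of
  measures.\<close>

lemma simple_approximation:
  assumes e: "e > 0"
  shows "\<exists>s C. finite C \<and> C \<subseteq> M \<and> s \<in> measurable (borel_of mtopology) (count_space C)
    \<and> (\<forall>x\<in>M. d x (s x) < e)"
proof -
  obtain C where C: "finite C" "C \<subseteq> M" "M \<subseteq> (\<Union>x\<in>C. mball x e)"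
    using compact e by (auto simp: compact_space_eq_mcomplete_mtotally_bounded mtotally_bounded_def)
  obtain c and n :: nat where c: "C = c ` {i. i < n}"
    using finite_imp_nat_seg_image_inj_on[OF C(1)] by metis
  define s where "s x = c (LEAST i. x \<in> mball (c i) e)" for x
  have ex: "\<exists>i<n. x \<in> mball (c i) e" if "x \<in> M" for x
    using C(3) c that by (fastforce simp: subset_iff)
  have L: "(LEAST i. x \<in> mball (c i) e) < n" "x \<in> mball (c (LEAST i. x \<in> mball (c i) e)) e" if x: "x \<in> M" for x
  proof -
    obtain i where i: "i < n" "x \<in> mball (c i) e" using ex[OF x] by auto
    show "(LEAST i. x \<in> mball (c i) e) < n"
      using Least_le[of "\<lambda>i. x \<in> mball (c i) e", OF i(2)] i(1) by linarith
    show "x \<in> mball (c (LEAST i. x \<in> mball (c i) e)) e"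
      using LeastI[of "\<lambda>i. x \<in> mball (c i) e", OF i(2)] .
  qed
  have sC: "s x \<in> C" "d x (s x) < e" if "x \<in> M" for x
    using L[OF that] c commute unfolding s_def by auto
  have "s -` {a} \<inter> M = (\<Union>i\<in>{i. i < n \<and> c i = a}. mball (c i) e - (\<Union>j\<in>{..<i}. mball (c j) e))"
    (is "?L = ?R") for a
  proof (intro set_eqI iffI)
    fix x assume x: "x \<in> ?L"
    let ?i = "LEAST i. x \<in> mball (c i) e"
    have "?i \<in> {i. i < n \<and> c i = a}" using x L(1) by (auto simp: s_def)
    moreover have "x \<in> mball (c ?i) e - (\<Union>j\<in>{..<?i}. mball (c j) e)"
      using x L(2) not_less_Least[of _ "\<lambda>i. x \<in> mball (c i) e"] by blast
    ultimately show "x \<in> ?R" by blast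
  next
    fix x assume "x \<in> ?R"
    then obtain i where i: "i < n" "c i = a" "x \<in> mball (c i) e" "\<And>j. j < i \<Longrightarrow> x \<notin> mball (c j) e"
      by blast
    then have "(LEAST i. x \<in> mball (c i) e) = i"
      by (intro Least_equality) (auto simp: not_less[symmetric])
    then show "x \<in> ?L" using i by (auto simp: s_def)
  qed
  then have "s -` {a} \<inter> M \<in> sets (borel_of mtopology)" for a
    by (simp only: ) (intro sets.finite_UN sets.Diff openin_sets_borel_of openin_mball; simp)
  then have "s \<in> measurable (borel_of mtopology) (count_space C)"
    using sC C(1) by (subst measurable_count_space_eq2) auto
  then show ?thesis using C sC by blast
qed

lemma simple_approximation_sequence:
  obtains s :: "nat \<Rightarrow> 'a \<Rightarrow> 'a" and C :: "nat \<Rightarrow> 'a set" where "\<And>m. finite (C m)" "\<And>m. C m \<subseteq> M"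
    "\<And>m. s m \<in> measurable (borel_of mtopology) (count_space (C m))"
    "\<And>m x. x \<in> M \<Longrightarrow> d x (s m x) < inverse (Suc m)"
proof -
  have "\<forall>m. \<exists>s C. finite C \<and> C \<subseteq> M \<and> s \<in> measurable (borel_of mtopology) (count_space C)
    \<and> (\<forall>x\<in>M. d x (s x) < inverse (Suc m))"
    by (intro allI simple_approximation) simp
  then show thesis using that by metis
qed

text \<open>The inclusion with content expresses an open W as a countable union of measurable sets
  \<open>V m\<close>: a pair lies in \<open>V m\<close> when the balls of radius 1/(m+1) about its
  two discretised coordinates have their product inside W.\<close>

lemma sets_borel_of_prod_topology:
  "sets (borel_of (prod_topology mtopology mtopology)) = sets (borel_of mtopology \<Otimes>\<^sub>M borel_of mtopology)"
    (is "?L = ?R")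
proof
  have *: "id \<in> measurable (borel_of (prod_topology mtopology mtopology)) (borel_of mtopology \<Otimes>\<^sub>M borel_of mtopology)"
    using continuous_map_measurable[OF continuous_map_fst, of mtopology mtopology]
      continuous_map_measurable[OF continuous_map_snd, of mtopology mtopology]
    by (intro measurable_pair) (auto simp: comp_def)
  note id = measurable_sets[OF *]
  show "?R \<subseteq> ?L"
  proof
    fix W assume W: "W \<in> ?R"
    then have "W \<subseteq> M \<times> M" using sets.sets_into_space[OF W] by (simp add: space_pair_measure)
    then show "W \<in> ?L" using id[OF W] by (simp add: Int_absorb2)
  qed
next
  have open_in: "W \<in> ?R" if W: "openin (prod_topology mtopology mtopology) W" for W
  proof -
    obtain s :: "nat \<Rightarrow> 'a \<Rightarrow> 'a" and C :: "nat \<Rightarrow> 'a set" where s: "\<And>m. finite (C m)" "\<And>m. C m \<subseteq> M"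
      "\<And>m. s m \<in> measurable (borel_of mtopology) (count_space (C m))"
      "\<And>m x. x \<in> M \<Longrightarrow> d x (s m x) < inverse (Suc m)"
      using simple_approximation_sequence by metis
    have WM: "W \<subseteq> M \<times> M" using openin_subset[OF W] by simp
    define A where "A m = {q \<in> C m \<times> C m. mball (fst q) (inverse (Suc m)) \<times> mball (snd q) (inverse (Suc m)) \<subseteq> W}" for m
    define V where "V m = (\<lambda>p. (s m (fst p), s m (snd p))) -` A m \<inter> space (borel_of mtopology \<Otimes>\<^sub>M borel_of mtopology)" for m
    have "V m \<in> ?R" for m
    proof -
      have "(\<lambda>p. (s m (fst p), s m (snd p))) \<in> measurable (borel_of mtopology \<Otimes>\<^sub>M borel_of mtopology)
          (count_space (C m) \<Otimes>\<^sub>M count_space (C m))"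
        using s(3)[of m] by measurable
      moreover have "A m \<in> sets (count_space (C m) \<Otimes>\<^sub>M count_space (C m))"
        unfolding pair_measure_countable[OF countable_finite[OF s(1)] countable_finite[OF s(1)]]
        by (auto simp: A_def)
      ultimately show ?thesis unfolding V_def by (rule measurable_sets)
    qed
    moreover have "W = (\<Union>m. V m)"
    proof (intro set_eqI iffI)
      fix p assume p: "p \<in> W"
      obtain x y where xy: "p = (x, y)" "x \<in> M" "y \<in> M" using p WM by (cases p) auto
      obtain U U' where U: "openin mtopology U" "openin mtopology U'" "x \<in> U" "y \<in> U'" "U \<times> U' \<subseteq> W"
        using W p unfolding xy openin_prod_topology_alt by meson
      obtain r r' where r: "r > 0" "mball x r \<subseteq> U" "r' > 0" "mball y r' \<subseteq> U'"
        using U unfolding openin_mtopology by meson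
      \<comment> \<open>A ball of radius 1/(m+1) about a centre that is 1/(m+1)-close to z lies in
        the ball of radius 2/(m+1) about z, whence the factor 1/2.\<close>
      obtain m where m: "inverse (Suc m) < min r r' / 2"
        using reals_Archimedean[of "min r r' / 2"] r by auto
      have sub: "mball (s m z) (inverse (Suc m)) \<subseteq> mball z (min r r')" if "z \<in> M" for z
      proof
        fix w assume "w \<in> mball (s m z) (inverse (Suc m))"
        then have "s m z \<in> M" "w \<in> M" "d (s m z) w < inverse (Suc m)" by auto
        then show "w \<in> mball z (min r r')"
          using triangle[of z "s m z" w] s(4)[OF that, of m] m that by auto
      qed
      have "mball (s m x) (inverse (Suc m)) \<times> mball (s m y) (inverse (Suc m)) \<subseteq> W"
      proof -
        have "mball x (min r r') \<subseteq> U" "mball y (min r r') \<subseteq> U'"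
          using r mball_subset_concentric[of "min r r'" r x] mball_subset_concentric[of "min r r'" r' y] by auto
        then show ?thesis using sub[OF xy(2)] sub[OF xy(3)] U(5) by (meson Sigma_mono subset_trans)
      qed
      moreover have "s m x \<in> C m" "s m y \<in> C m"
        using measurable_space[OF s(3), of _ m] xy by auto
      ultimately have "p \<in> V m" using xy by (auto simp: V_def A_def space_pair_measure)
      then show "p \<in> (\<Union>m. V m)" by blast
    next
      fix p assume "p \<in> (\<Union>m. V m)"
      then obtain m where "p \<in> V m" by blast
      then have p: "fst p \<in> M" "snd p \<in> M" "s m (fst p) \<in> M" "s m (snd p) \<in> M"
        "mball (s m (fst p)) (inverse (Suc m)) \<times> mball (s m (snd p)) (inverse (Suc m)) \<subseteq> W"
        using s(2)[of m] by (auto simp: V_def A_def space_pair_measure)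
      have "(fst p, snd p) \<in> mball (s m (fst p)) (inverse (Suc m)) \<times> mball (s m (snd p)) (inverse (Suc m))"
        using p s(4)[of "fst p" m] s(4)[of "snd p" m] commute[of "fst p"] commute[of "snd p"]
        by (intro SigmaI) (simp_all add: in_mball)
      then show "p \<in> W" using p(5) by auto
    qed
    ultimately show ?thesis by auto
  qed
  have "sigma_sets (M \<times> M) {W. openin (prod_topology mtopology mtopology) W} \<subseteq> ?R"
    using sets.sigma_sets_subset[of "{W. openin (prod_topology mtopology mtopology) W}"
        "borel_of mtopology \<Otimes>\<^sub>M borel_of mtopology"] open_in
    by (auto simp: space_pair_measure)
  then show "?L \<subseteq> ?R"
    unfolding borel_of_def[of "prod_topology _ _"] using openin_subset[of "prod_topology mtopology mtopology"]
    by (subst sets_measure_of) auto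
qed

lemma couplings_nonempty:
  assumes "\<alpha> \<in> prob_measures mtopology" "\<beta> \<in> prob_measures mtopology"
  shows "couplings mtopology \<alpha> \<beta> \<noteq> {}"
proof -
  interpret a: prob_space \<alpha> using prob_measuresD(1)[OF assms(1)] .
  interpret b: prob_space \<beta> using prob_measuresD(1)[OF assms(2)] .
  interpret ab: pair_prob_space \<alpha> \<beta> ..
  note sts = prob_measuresD(2)[OF assms(1)] prob_measuresD(2)[OF assms(2)]
  have "sets (\<alpha> \<Otimes>\<^sub>M \<beta>) = sets (borel_of (prod_topology mtopology mtopology))"
    unfolding sets_borel_of_prod_topology by (rule sets_pair_measure_cong) (use sts in auto)
  moreover have "distr (\<alpha> \<Otimes>\<^sub>M \<beta>) (borel_of mtopology) fst = \<alpha>"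
    using b.distr_pair_fst[of \<alpha>] sts(1) by (simp cong: distr_cong)
  moreover have "distr (\<alpha> \<Otimes>\<^sub>M \<beta>) (borel_of mtopology) snd = \<beta>"
  proof (rule measure_eqI)
    fix A assume "A \<in> sets (distr (\<alpha> \<Otimes>\<^sub>M \<beta>) (borel_of mtopology) snd)"
    then have A: "A \<in> sets \<beta>" using sts by simp
    have *: "snd -` A \<inter> space (\<alpha> \<Otimes>\<^sub>M \<beta>) = space \<alpha> \<times> A"
      using sets.sets_into_space[OF A] by (auto simp: space_pair_measure)
    have m: "snd \<in> measurable (\<alpha> \<Otimes>\<^sub>M \<beta>) (borel_of mtopology)"
      using measurable_snd[of \<alpha> \<beta>] sts by (simp cong: measurable_cong_sets)
    have "emeasure (distr (\<alpha> \<Otimes>\<^sub>M \<beta>) (borel_of mtopology) snd) A = emeasure (\<alpha> \<Otimes>\<^sub>M \<beta>) (space \<alpha> \<times> A)"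
      using A m sts by (simp add: emeasure_distr *)
    also have "\<dots> = emeasure \<beta> A"
      using b.emeasure_pair_measure_Times[OF sets.top[of \<alpha>] A] a.emeasure_space_1 by simp
    finally show "emeasure (distr (\<alpha> \<Otimes>\<^sub>M \<beta>) (borel_of mtopology) snd) A = emeasure \<beta> A" .
  qed (use sts in simp)
  ultimately have "\<alpha> \<Otimes>\<^sub>M \<beta> \<in> couplings mtopology \<alpha> \<beta>"
    by (simp add: couplings_def prob_measures_def ab.prob_space_axioms)
  then show ?thesis by blast
qed

text \<open>The Lipschitz functions \<open>f n\<close>, cut off from the distance \<delta> to a
  closed set C, converge pointwise to the indicator of C, so both measures agree on closed sets, an
  intersection-stable generator. This yields definiteness of the Wasserstein distance and uniqueness
  of weak limits.\<close>

lemma prob_measures_eqI: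
  assumes \<alpha>: "\<alpha> \<in> prob_measures mtopology" and \<beta>: "\<beta> \<in> prob_measures mtopology"
    and eq: "\<And>f L. L \<ge> 0 \<Longrightarrow> (\<And>x y. x \<in> M \<Longrightarrow> y \<in> M \<Longrightarrow> \<bar>f x - f y\<bar> \<le> L * d x y) \<Longrightarrow>
       (\<integral>x. f x \<partial>\<alpha>) = (\<integral>x. f x \<partial>\<beta>)"
  shows "\<alpha> = \<beta>"
proof -
  interpret a: prob_space \<alpha> using prob_measuresD(1)[OF \<alpha>] .
  interpret b: prob_space \<beta> using prob_measuresD(1)[OF \<beta>] .
  have closed_eq: "emeasure \<alpha> C = emeasure \<beta> C" if C: "closedin mtopology C" for C
  proof (cases "C = {}")
    case False
    have CM: "C \<subseteq> M" using closedin_subset[OF C] by simp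
    define \<delta> where "\<delta> x = (INF c\<in>C. d x c)" for x
    have bdd: "bdd_below (d x ` C)" for x by (rule bdd_belowI[of _ 0]) auto
    have \<delta>0: "\<delta> x \<ge> 0" for x unfolding \<delta>_def by (rule cINF_greatest) (use False in auto)
    have tri: "\<delta> x \<le> d x y + \<delta> y" if "x \<in> M" "y \<in> M" for x y
    proof -
      have "\<delta> x - d x y \<le> \<delta> y" unfolding \<delta>_def[of y]
      proof (rule cINF_greatest[OF False])
        fix c assume c: "c \<in> C"
        have "\<delta> x \<le> d x c" unfolding \<delta>_def by (rule cINF_lower[OF bdd c])
        also have "\<dots> \<le> d x y + d y c" using c CM that by (intro triangle) auto
        finally show "\<delta> x - d x y \<le> d y c" by simp
      qed
      then show ?thesis by simp
    qed
    have pos: "\<delta> x > 0" if x: "x \<in> M" "x \<notin> C" for x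
    proof -
      have "openin mtopology (M - C)" using C by (simp add: closedin_def)
      then obtain r where r: "r > 0" "mball x r \<subseteq> M - C" using x by (auto simp: openin_mtopology)
      have "r \<le> \<delta> x" unfolding \<delta>_def
      proof (rule cINF_greatest[OF False])
        fix c assume c: "c \<in> C"
        then have "c \<notin> mball x r" using r by blast
        then show "r \<le> d x c" using c CM x by auto
      qed
      then show ?thesis using r by simp
    qed
    have zero: "\<delta> x = 0" if "x \<in> C" for x
      using cINF_lower[OF bdd that, of x] \<delta>0[of x] that CM by (auto simp: \<delta>_def)
    define f where "f n x = max 0 (1 - real n * \<delta> x)" for n x
    have lip: "\<bar>f n x - f n y\<bar> \<le> real n * d x y" if "x \<in> M" "y \<in> M" for n x y
    proof -
      have "\<bar>\<delta> x - \<delta> y\<bar> \<le> d x y" using tri[OF that] tri[OF that(2,1)] commute[of x y] by auto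
      then have "real n * \<bar>\<delta> x - \<delta> y\<bar> \<le> real n * d x y" by (rule mult_left_mono) simp
      moreover have "\<bar>f n x - f n y\<bar> \<le> \<bar>real n * \<delta> x - real n * \<delta> y\<bar>" by (auto simp: f_def)
      moreover have "real n * \<bar>\<delta> x - \<delta> y\<bar> = \<bar>real n * \<delta> x - real n * \<delta> y\<bar>"
        by (simp add: abs_mult flip: right_diff_distrib)
      ultimately show ?thesis by linarith
    qed
    have lim: "(\<lambda>n. f n x) \<longlonglongrightarrow> indicator C x" if x: "x \<in> M" for x
    proof (cases "x \<in> C")
      case True then show ?thesis by (simp add: f_def zero)
    next
      case False
      obtain n0 where n0: "1 < real n0 * \<delta> x"
        using ex_less_of_nat_mult[OF pos[OF x False], of 1] by auto
      have "f n x = 0" if "n \<ge> n0" for n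
        using n0 mult_right_mono[of "real n0" "real n" "\<delta> x"] \<delta>0[of x] that by (simp add: f_def)
      then have "eventually (\<lambda>n. f n x = 0) sequentially" by (auto simp: eventually_sequentially)
      then show ?thesis using False by (simp add: tendsto_eventually)
    qed
    have conv: "(\<lambda>n. \<integral>x. f n x \<partial>\<rho>) \<longlonglongrightarrow> measure \<rho> C" if \<rho>: "\<rho> \<in> prob_measures mtopology" for \<rho>
    proof -
      interpret p: prob_space \<rho> using prob_measuresD(1)[OF \<rho>] .
      note sp = prob_measuresD(2,3)[OF \<rho>]
      have "(\<lambda>n. \<integral>x. f n x \<partial>\<rho>) \<longlonglongrightarrow> (\<integral>x. indicator C x \<partial>\<rho>)"
      proof (rule integral_dominated_convergence[where w="\<lambda>_. 1"])
        show "indicator C \<in> borel_measurable \<rho>"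
          using closedin_sets_borel_of[OF C] sp by (intro borel_measurable_indicator) auto
        show "f n \<in> borel_measurable \<rho>" for n
          using continuous_map_borel_measurable[OF lipschitz_continuous_map[OF lip]] sp(1)
          by (simp cong: measurable_cong_sets)
        show "AE x in \<rho>. (\<lambda>n. f n x) \<longlonglongrightarrow> indicator C x" using lim sp by (intro AE_I2) auto
        show "AE x in \<rho>. norm (f n x) \<le> 1" for n
          using \<delta>0 by (intro AE_I2) (auto simp: f_def)
      qed auto
      then show ?thesis using CM sp by (simp add: Int_absorb2)
    qed
    have "(\<lambda>n. \<integral>x. f n x \<partial>\<alpha>) = (\<lambda>n. \<integral>x. f n x \<partial>\<beta>)"
      by (rule ext, rule eq[OF _ lip]) auto
    then have "measure \<alpha> C = measure \<beta> C"
      using conv[OF \<alpha>] conv[OF \<beta>] LIMSEQ_unique by metis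
    then show ?thesis by (simp add: a.emeasure_eq_measure b.emeasure_eq_measure)
  qed simp
  have gen: "sets (borel_of mtopology) = sigma_sets M {C. closedin mtopology C}"
  proof
    have "sets (borel_of mtopology) = sigma_sets M {U. openin mtopology U}"
      unfolding borel_of_def using openin_subset[of mtopology] by (subst sets_measure_of) auto
    also have "\<dots> \<subseteq> sigma_sets M {C. closedin mtopology C}"
    proof (rule sigma_sets_mono, safe)
      fix U assume U: "openin mtopology U"
      then have "M - (M - U) \<in> sigma_sets M {C. closedin mtopology C}"
        by (intro sigma_sets.Compl sigma_sets.Basic) (auto intro: openin_closedin_eq[THEN iffD1])
      then show "U \<in> sigma_sets M {C. closedin mtopology C}"
        using openin_subset[OF U] by (simp add: double_diff)
    qed
    finally show "sets (borel_of mtopology) \<subseteq> sigma_sets M {C. closedin mtopology C}" .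
    show "sigma_sets M {C. closedin mtopology C} \<subseteq> sets (borel_of mtopology)"
      using sets.sigma_sets_subset[of "{C. closedin mtopology C}" "borel_of mtopology"]
        closedin_sets_borel_of by auto
  qed
  show ?thesis
  proof (rule measure_eqI_generator_eq[where E="{C. closedin mtopology C}" and \<Omega>=M and A="\<lambda>_. M"])
    show "Int_stable {C. closedin mtopology C}" by (auto simp: Int_stable_def)
    show "{C. closedin mtopology C} \<subseteq> Pow M" using closedin_subset[of mtopology] by auto
    show "sets \<alpha> = sigma_sets M {C. closedin mtopology C}" "sets \<beta> = sigma_sets M {C. closedin mtopology C}"
      using prob_measuresD(2)[OF \<alpha>] prob_measuresD(2)[OF \<beta>] gen by auto
  qed (use closed_eq in auto)
qed

end

section \<open>Gluing of couplings and the metric axioms for the Wasserstein distance\<close>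

context compact_metric
begin

text \<open>Approximate gluing: the two couplings are made independent conditionally on the cell of a fine
  partition containing the middle point, which avoids disintegration.\<close>

lemma couplings_glue:
  assumes g1: "\<gamma>1 \<in> couplings mtopology \<alpha> \<beta>" and g2: "\<gamma>2 \<in> couplings mtopology \<beta> \<delta>" and e: "e > 0"
  obtains \<gamma> where "\<gamma> \<in> couplings mtopology \<alpha> \<delta>"
    "(\<integral>\<^sup>+p. ennreal (d (fst p) (snd p)) \<partial>\<gamma>) \<le>
      (\<integral>\<^sup>+p. ennreal (d (fst p) (snd p)) \<partial>\<gamma>1) + (\<integral>\<^sup>+p. ennreal (d (fst p) (snd p)) \<partial>\<gamma>2) + ennreal (2 * e)"
proof -
  let ?B = "borel_of mtopology"
  interpret g1: prob_space \<gamma>1 using prob_measuresD(1)[OF couplingsD(1)[OF g1]] .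
  interpret g2: prob_space \<gamma>2 using prob_measuresD(1)[OF couplingsD(1)[OF g2]] .
  interpret g: pair_prob_space \<gamma>1 \<gamma>2 ..
  have \<beta>: "\<beta> \<in> prob_measures mtopology" using couplings_prob_measures[OF g1] by simp
  interpret b: prob_space \<beta> using prob_measuresD(1)[OF \<beta>] .
  obtain s C where C: "finite C" "C \<subseteq> M" and s: "s \<in> measurable ?B (count_space C)"
    and ds: "\<And>x. x \<in> M \<Longrightarrow> d x (s x) < e"
    using simple_approximation[OF e] by blast
  have [measurable]: "s \<in> measurable ?B (count_space C)" by (rule s)
  have sC: "s x \<in> C" if "x \<in> M" for x using measurable_space[OF s] that by simp
  have cell: "s -` {c} \<inter> M \<in> sets ?B" if "c \<in> C" for c
    using measurable_sets[OF s, of "{c}"] that by simp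
  define b where "b c = emeasure \<beta> (s -` {c} \<inter> M)" for c
  have m1 [measurable]: "fst \<in> measurable \<gamma>1 ?B" "snd \<in> measurable \<gamma>1 ?B" using couplingsD[OF g1] by auto
  have m2 [measurable]: "fst \<in> measurable \<gamma>2 ?B" "snd \<in> measurable \<gamma>2 ?B" using couplingsD[OF g2] by auto
  have sp: "space \<gamma>1 = M \<times> M" "space \<gamma>2 = M \<times> M"
    using prob_measuresD(3)[OF couplingsD(1)[OF g1]] prob_measuresD(3)[OF couplingsD(1)[OF g2]] by auto
  have b1: "emeasure \<gamma>1 {p \<in> space \<gamma>1. s (snd p) = c} = b c" if "c \<in> C" for c
  proof -
    have "emeasure \<beta> (s -` {c} \<inter> M) = emeasure (distr \<gamma>1 ?B snd) (s -` {c} \<inter> M)"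
      using couplingsD(3)[OF g1] by simp
    also have "\<dots> = emeasure \<gamma>1 (snd -` (s -` {c} \<inter> M) \<inter> space \<gamma>1)"
      using cell[OF that] m1 by (intro emeasure_distr) auto
    also have "snd -` (s -` {c} \<inter> M) \<inter> space \<gamma>1 = {p \<in> space \<gamma>1. s (snd p) = c}"
      using sp by auto
    finally show ?thesis by (simp add: b_def)
  qed
  have b2: "emeasure \<gamma>2 {p \<in> space \<gamma>2. s (fst p) = c} = b c" if "c \<in> C" for c
  proof -
    have "emeasure \<beta> (s -` {c} \<inter> M) = emeasure (distr \<gamma>2 ?B fst) (s -` {c} \<inter> M)"
      using couplingsD(2)[OF g2] by simp
    also have "\<dots> = emeasure \<gamma>2 (fst -` (s -` {c} \<inter> M) \<inter> space \<gamma>2)"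
      using cell[OF that] m2 by (intro emeasure_distr) auto
    also have "fst -` (s -` {c} \<inter> M) \<inter> space \<gamma>2 = {p \<in> space \<gamma>2. s (fst p) = c}"
      using sp by auto
    finally show ?thesis by (simp add: b_def)
  qed
  \<comment> \<open>Cells of \<beta>-measure 0 must be discarded: there \<open>inverse (b c)\<close>
    is infinite and cannot normalise anything.\<close>
  have AE\<beta>: "AE y in \<beta>. b (s y) \<noteq> 0"
  proof -
    have "AE y in \<beta>. \<forall>c\<in>C. s y = c \<longrightarrow> b c \<noteq> 0"
    proof (rule AE_finite_allI[OF C(1)])
      fix c assume c: "c \<in> C"
      show "AE y in \<beta>. s y = c \<longrightarrow> b c \<noteq> 0"
      proof (cases "b c = 0")
        case True
        then have "s -` {c} \<inter> M \<in> null_sets \<beta>"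
          using cell[OF c] prob_measuresD(2)[OF \<beta>] by (auto simp: b_def null_sets_def)
        then have "AE y in \<beta>. y \<notin> s -` {c} \<inter> M" by (rule AE_not_in)
        then show ?thesis
          using AE_space by eventually_elim (use prob_measuresD(3)[OF \<beta>] in auto)
      qed simp
    qed
    then show ?thesis
      using AE_space by eventually_elim (use sC prob_measuresD(3)[OF \<beta>] in auto)
  qed
  have "AE y in distr \<gamma>1 ?B snd. b (s y) \<noteq> 0" unfolding couplingsD(3)[OF g1] by (rule AE\<beta>)
  then have AE1: "AE p in \<gamma>1. b (s (snd p)) \<noteq> 0" by (rule AE_distrD[OF m1(2)])
  have "AE y in distr \<gamma>2 ?B fst. b (s y) \<noteq> 0" unfolding couplingsD(2)[OF g2] by (rule AE\<beta>)
  then have AE2: "AE p in \<gamma>2. b (s (fst p)) \<noteq> 0" by (rule AE_distrD[OF m2(1)])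
  have bb: "inverse (b c) * b c = 1" if "b c \<noteq> 0" for c
    using that b.emeasure_finite[of "s -` {c} \<inter> M"] ennreal_divide_self[of "b c"]
    by (simp add: b_def divide_ennreal_def mult.commute less_top[symmetric])
  \<comment> \<open>The density of the glued law with respect to the product of the two couplings:
    the two middle points must share a cell, and dividing by the mass of that cell makes the
    couplings conditionally independent given the cell.\<close>
  define h :: "('a \<times> 'a) \<times> ('a \<times> 'a) \<Rightarrow> ennreal" where "h w = (if s (snd (fst w)) = s (fst (snd w)) then inverse (b (s (snd (fst w)))) else 0)" for w
  have h [measurable]: "h \<in> borel_measurable (\<gamma>1 \<Otimes>\<^sub>M \<gamma>2)"
  proof -
    have "(\<lambda>w. (s (snd (fst w)), s (fst (snd w)))) \<in> measurable (\<gamma>1 \<Otimes>\<^sub>M \<gamma>2) (count_space C \<Otimes>\<^sub>M count_space C)"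
      by measurable
    then have *: "(\<lambda>w. (s (snd (fst w)), s (fst (snd w)))) \<in> measurable (\<gamma>1 \<Otimes>\<^sub>M \<gamma>2) (count_space (C \<times> C))"
      using pair_measure_countable[of C C] C(1) by (simp add: countable_finite)
    have "(\<lambda>(c, c'). if c = c' then inverse (b c) else 0) \<in> borel_measurable (count_space (C \<times> C))" by simp
    from measurable_compose[OF * this] show ?thesis by (simp add: h_def[abs_def])
  qed
  \<comment> \<open>Integrating \<open>h\<close> over the second pair gives 1 for almost every first
    pair, because the pairs of \<gamma>2 whose middle point lies in a given cell have mass
    \<open>b c\<close>. So the glued law has marginal \<gamma>1, and \<open>I2\<close> gives
    \<gamma>2 by the mirrored computation.\<close>
  have I1: "(\<integral>\<^sup>+w. h w * G (fst w) \<partial>(\<gamma>1 \<Otimes>\<^sub>M \<gamma>2)) = (\<integral>\<^sup>+p. G p \<partial>\<gamma>1)"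
    if G [measurable]: "G \<in> borel_measurable \<gamma>1" for G
  proof -
    have "(\<integral>\<^sup>+w. h w * G (fst w) \<partial>(\<gamma>1 \<Otimes>\<^sub>M \<gamma>2)) = (\<integral>\<^sup>+p. (\<integral>\<^sup>+q. h (p, q) * G p \<partial>\<gamma>2) \<partial>\<gamma>1)"
      by (subst g2.nn_integral_fst[symmetric]) auto
    also have "\<dots> = (\<integral>\<^sup>+p. G p \<partial>\<gamma>1)"
    proof (rule nn_integral_cong_AE)
      have inner: "(\<integral>\<^sup>+q. h (p, q) * G p \<partial>\<gamma>2) = G p" if p: "b (s (snd p)) \<noteq> 0" "p \<in> space \<gamma>1" for p
      proof -
        let ?c = "s (snd p)"
        have c: "?c \<in> C" using p(2) sp sC by auto
        have st: "{q \<in> space \<gamma>2. s (fst q) = ?c} \<in> sets \<gamma>2"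
          using measurable_sets[OF m2(1) cell[OF c]] sp by (auto simp: vimage_def Int_def conj_commute cong: conj_cong elim: back_subst)
        have "(\<integral>\<^sup>+q. h (p, q) * G p \<partial>\<gamma>2)
            = (\<integral>\<^sup>+q. (inverse (b ?c) * G p) * indicator {q \<in> space \<gamma>2. s (fst q) = ?c} q \<partial>\<gamma>2)"
          by (intro nn_integral_cong) (auto simp: h_def indicator_def)
        also have "\<dots> = inverse (b ?c) * G p * b ?c"
          using st b2[OF c] by (simp add: nn_integral_cmult_indicator)
        also have "\<dots> = G p" using bb[OF p(1)] by (simp add: mult_ac)
        finally show ?thesis .
      qed
      show "AE p in \<gamma>1. (\<integral>\<^sup>+q. h (p, q) * G p \<partial>\<gamma>2) = G p"
        using AE1 AE_space by eventually_elim (rule inner)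
    qed
    finally show ?thesis .
  qed
  have I2: "(\<integral>\<^sup>+w. h w * G (snd w) \<partial>(\<gamma>1 \<Otimes>\<^sub>M \<gamma>2)) = (\<integral>\<^sup>+p. G p \<partial>\<gamma>2)"
    if G [measurable]: "G \<in> borel_measurable \<gamma>2" for G
  proof -
    have "(\<integral>\<^sup>+w. h w * G (snd w) \<partial>(\<gamma>1 \<Otimes>\<^sub>M \<gamma>2)) = (\<integral>\<^sup>+q. (\<integral>\<^sup>+p. h (p, q) * G q \<partial>\<gamma>1) \<partial>\<gamma>2)"
      by (subst g.nn_integral_snd[symmetric]) auto
    also have "\<dots> = (\<integral>\<^sup>+q. G q \<partial>\<gamma>2)"
    proof (rule nn_integral_cong_AE)
      have inner: "(\<integral>\<^sup>+p. h (p, q) * G q \<partial>\<gamma>1) = G q" if q: "b (s (fst q)) \<noteq> 0" "q \<in> space \<gamma>2" for q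
      proof -
        let ?c = "s (fst q)"
        have c: "?c \<in> C" using q(2) sp sC by auto
        have st: "{p \<in> space \<gamma>1. s (snd p) = ?c} \<in> sets \<gamma>1"
          using measurable_sets[OF m1(2) cell[OF c]] sp by (auto simp: vimage_def Int_def conj_commute cong: conj_cong elim: back_subst)
        have "(\<integral>\<^sup>+p. h (p, q) * G q \<partial>\<gamma>1)
            = (\<integral>\<^sup>+p. (inverse (b ?c) * G q) * indicator {p \<in> space \<gamma>1. s (snd p) = ?c} p \<partial>\<gamma>1)"
          by (intro nn_integral_cong) (auto simp: h_def indicator_def)
        also have "\<dots> = inverse (b ?c) * G q * b ?c"
          using st b1[OF c] by (simp add: nn_integral_cmult_indicator)
        also have "\<dots> = G q" using bb[OF q(1)] by (simp add: mult_ac)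
        finally show ?thesis .
      qed
      show "AE q in \<gamma>2. (\<integral>\<^sup>+p. h (p, q) * G q \<partial>\<gamma>1) = G q"
        using AE2 AE_space by eventually_elim (rule inner)
    qed
    finally show ?thesis .
  qed
  let ?P = "borel_of (prod_topology mtopology mtopology)"
  define D where "D = density (\<gamma>1 \<Otimes>\<^sub>M \<gamma>2) h"
  define \<gamma> where "\<gamma> = distr D ?P (\<lambda>w. (fst (fst w), snd (snd w)))"
  have "(\<lambda>w. (fst (fst w), snd (snd w))) \<in> measurable (\<gamma>1 \<Otimes>\<^sub>M \<gamma>2) (?B \<Otimes>\<^sub>M ?B)" by measurable
  then have mD: "(\<lambda>w. (fst (fst w), snd (snd w))) \<in> measurable D ?P"
    using sets_borel_of_prod_topology by (simp add: D_def cong: measurable_cong_sets)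
  have P: "fst \<in> measurable ?P ?B" "snd \<in> measurable ?P ?B"
    by (auto intro!: continuous_map_measurable continuous_map_fst continuous_map_snd)
  have nn: "(\<integral>\<^sup>+x. f x \<partial>\<gamma>) = (\<integral>\<^sup>+w. h w * f (fst (fst w), snd (snd w)) \<partial>(\<gamma>1 \<Otimes>\<^sub>M \<gamma>2))"
    if "f \<in> borel_measurable ?P" for f
  proof -
    have "(\<integral>\<^sup>+x. f x \<partial>\<gamma>) = (\<integral>\<^sup>+w. f (fst (fst w), snd (snd w)) \<partial>D)"
      unfolding \<gamma>_def using that by (intro nn_integral_distr mD) simp
    also have "\<dots> = (\<integral>\<^sup>+w. h w * f (fst (fst w), snd (snd w)) \<partial>(\<gamma>1 \<Otimes>\<^sub>M \<gamma>2))"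
      unfolding D_def using measurable_compose[OF mD that] by (intro nn_integral_density h) (simp add: D_def)
    finally show ?thesis .
  qed
  have fst_eq: "distr \<gamma> ?B fst = \<alpha>"
  proof (rule measure_eqI)
    fix A assume "A \<in> sets (distr \<gamma> ?B fst)"
    then have A [measurable]: "A \<in> sets ?B" by simp
    have "emeasure (distr \<gamma> ?B fst) A = (\<integral>\<^sup>+x. indicator A x \<partial>distr \<gamma> ?B fst)"
      using A by simp
    also have "\<dots> = (\<integral>\<^sup>+x. indicator A (fst x) \<partial>\<gamma>)"
      using P by (intro nn_integral_distr) (auto simp: \<gamma>_def)
    also have "\<dots> = (\<integral>\<^sup>+w. h w * indicator A (fst (fst w)) \<partial>(\<gamma>1 \<Otimes>\<^sub>M \<gamma>2))"
      using P by (subst nn) (auto intro!: measurable_compose[OF P(1)])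
    also have "\<dots> = (\<integral>\<^sup>+p. indicator A (fst p) \<partial>\<gamma>1)"
      by (rule I1) (auto intro!: measurable_compose[OF m1(1)])
    also have "\<dots> = (\<integral>\<^sup>+x. indicator A x \<partial>distr \<gamma>1 ?B fst)"
      by (rule nn_integral_distr[symmetric]) (auto intro: m1)
    also have "\<dots> = emeasure \<alpha> A" using couplingsD(2)[OF g1] A couplings_prob_measures(1)[OF g1]
      by (simp add: prob_measures_def)
    finally show "emeasure (distr \<gamma> ?B fst) A = emeasure \<alpha> A" .
  qed (use couplings_prob_measures[OF g1] in \<open>simp add: prob_measures_def\<close>)
  have snd_eq: "distr \<gamma> ?B snd = \<delta>"
  proof (rule measure_eqI)
    fix A assume "A \<in> sets (distr \<gamma> ?B snd)"
    then have A [measurable]: "A \<in> sets ?B" by simp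
    have "emeasure (distr \<gamma> ?B snd) A = (\<integral>\<^sup>+x. indicator A x \<partial>distr \<gamma> ?B snd)"
      using A by simp
    also have "\<dots> = (\<integral>\<^sup>+x. indicator A (snd x) \<partial>\<gamma>)"
      using P by (intro nn_integral_distr) (auto simp: \<gamma>_def)
    also have "\<dots> = (\<integral>\<^sup>+w. h w * indicator A (snd (snd w)) \<partial>(\<gamma>1 \<Otimes>\<^sub>M \<gamma>2))"
      using P by (subst nn) (auto intro!: measurable_compose[OF P(2)])
    also have "\<dots> = (\<integral>\<^sup>+p. indicator A (snd p) \<partial>\<gamma>2)"
      by (rule I2) (auto intro!: measurable_compose[OF m2(2)])
    also have "\<dots> = (\<integral>\<^sup>+x. indicator A x \<partial>distr \<gamma>2 ?B snd)"
      by (rule nn_integral_distr[symmetric]) (auto intro: m2)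
    also have "\<dots> = emeasure \<delta> A" using couplingsD(3)[OF g2] A couplings_prob_measures(2)[OF g2]
      by (simp add: prob_measures_def)
    finally show "emeasure (distr \<gamma> ?B snd) A = emeasure \<delta> A" .
  qed (use couplings_prob_measures[OF g2] in \<open>simp add: prob_measures_def\<close>)
  have "prob_space \<gamma>"
  proof
    have "emeasure (distr \<gamma> ?B fst) M = 1"
      using fst_eq couplings_prob_measures(1)[OF g1] prob_measuresD[of \<alpha> mtopology] prob_space.emeasure_space_1
      by fastforce
    moreover have "emeasure (distr \<gamma> ?B fst) M = emeasure \<gamma> (fst -` M \<inter> space \<gamma>)"
      using P by (intro emeasure_distr) (auto simp: \<gamma>_def openin_sets_borel_of)
    moreover have "fst -` M \<inter> space \<gamma> = space \<gamma>" by (auto simp: \<gamma>_def)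
    ultimately show "emeasure \<gamma> (space \<gamma>) = 1" by simp
  qed
  then have cpl: "\<gamma> \<in> couplings mtopology \<alpha> \<delta>"
    using fst_eq snd_eq by (simp add: couplings_def prob_measures_def) (simp add: \<gamma>_def)
  have meas [measurable]: "(\<lambda>p. ennreal (d (fst p) (snd p))) \<in> borel_measurable ?P"
    "(\<lambda>p. ennreal (d (fst p) (snd p))) \<in> borel_measurable \<gamma>1" "(\<lambda>p. ennreal (d (fst p) (snd p))) \<in> borel_measurable \<gamma>2"
    using measurable_distance coupling_borel_measurable[OF g1] coupling_borel_measurable[OF g2] by auto
  have "(\<integral>\<^sup>+p. ennreal (d (fst p) (snd p)) \<partial>\<gamma>)
      = (\<integral>\<^sup>+w. h w * ennreal (d (fst (fst w)) (snd (snd w))) \<partial>(\<gamma>1 \<Otimes>\<^sub>M \<gamma>2))"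
    by (subst nn) (auto simp: meas)
  also have "\<dots> \<le> (\<integral>\<^sup>+w. h w * ennreal (d (fst (fst w)) (snd (fst w)))
      + h w * ennreal (d (fst (snd w)) (snd (snd w))) + h w * ennreal (2 * e) \<partial>(\<gamma>1 \<Otimes>\<^sub>M \<gamma>2))"
  proof (rule nn_integral_mono)
    fix w assume w: "w \<in> space (\<gamma>1 \<Otimes>\<^sub>M \<gamma>2)"
    obtain x y y' z where xyz: "w = ((x, y), (y', z))" by (metis surj_pair)
    have inM: "x \<in> M" "y \<in> M" "y' \<in> M" "z \<in> M" using w sp by (auto simp: xyz space_pair_measure)
    show "h w * ennreal (d (fst (fst w)) (snd (snd w))) \<le> h w * ennreal (d (fst (fst w)) (snd (fst w)))
      + h w * ennreal (d (fst (snd w)) (snd (snd w))) + h w * ennreal (2 * e)"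
    \<comment> \<open>Either \<open>h\<close> vanishes, or both middle points are within
      \<open>e\<close> of the same centre; the jump between them costs at most \<open>2 * e\<close>,
      the only loss of the approximate gluing.\<close>
    proof (cases "s y = s y'")
      case True
      have "s y \<in> M" using sC[OF inM(2)] C by auto
      then have "d y y' \<le> 2 * e"
        using triangle[of y "s y" y'] ds[OF inM(2)] ds[OF inM(3)] inM True commute[of y' "s y'"] by auto
      then have "d x z \<le> d x y + d y' z + 2 * e"
        using triangle[of x y z] triangle[of y y' z] inM by auto
      then have "ennreal (d x z) \<le> ennreal (d x y) + ennreal (d y' z) + ennreal (2 * e)"
        using e by (simp flip: ennreal_plus)
      then have "h w * ennreal (d x z) \<le> h w * (ennreal (d x y) + ennreal (d y' z) + ennreal (2 * e))"
        by (rule mult_left_mono) simp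
      then show ?thesis by (simp add: xyz distrib_left)
    qed (simp add: h_def xyz)
  qed
  also have "\<dots> = (\<integral>\<^sup>+w. h w * ennreal (d (fst (fst w)) (snd (fst w))) \<partial>(\<gamma>1 \<Otimes>\<^sub>M \<gamma>2))
      + (\<integral>\<^sup>+w. h w * ennreal (d (fst (snd w)) (snd (snd w))) \<partial>(\<gamma>1 \<Otimes>\<^sub>M \<gamma>2))
      + (\<integral>\<^sup>+w. h w * ennreal (2 * e) \<partial>(\<gamma>1 \<Otimes>\<^sub>M \<gamma>2))"
  proof -
    have [measurable]: "(\<lambda>w. ennreal (d (fst (fst w)) (snd (fst w)))) \<in> borel_measurable (\<gamma>1 \<Otimes>\<^sub>M \<gamma>2)"
      "(\<lambda>w. ennreal (d (fst (snd w)) (snd (snd w)))) \<in> borel_measurable (\<gamma>1 \<Otimes>\<^sub>M \<gamma>2)"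
      using measurable_compose[OF measurable_fst meas(2)] measurable_compose[OF measurable_snd meas(3)] by auto
    show ?thesis by (simp add: nn_integral_add)
  qed
  also have "\<dots> = (\<integral>\<^sup>+p. ennreal (d (fst p) (snd p)) \<partial>\<gamma>1) + (\<integral>\<^sup>+p. ennreal (d (fst p) (snd p)) \<partial>\<gamma>2) + ennreal (2 * e)"
    using I1[OF meas(2)] I2[OF meas(3)] I1[of "\<lambda>_. ennreal (2 * e)"] g1.emeasure_space_1 by simp
  finally show thesis using that cpl by blast
qed

lemma Metric_space_wasserstein1: "Metric_space (prob_measures mtopology) (wasserstein1 M d)"
proof -
  let ?P = "borel_of (prod_topology mtopology mtopology)"
  obtain B where "bounded_metric M d B" using bounded_metric_ex by blast
  then interpret bounded_metric M d B .
  have swap: "\<exists>\<gamma>'\<in>couplings mtopology \<beta> \<alpha>. (\<integral>p. d (fst p) (snd p) \<partial>\<gamma>') = (\<integral>p. d (fst p) (snd p) \<partial>\<gamma>)"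
    if g: "\<gamma> \<in> couplings mtopology \<alpha> \<beta>" for \<alpha> \<beta> \<gamma>
  proof -
    have sw: "prod.swap \<in> measurable ?P ?P"
      unfolding prod.swap_def
      by (intro continuous_map_measurable continuous_map_pairedI continuous_map_snd continuous_map_fst)
    have sw': "prod.swap \<in> measurable \<gamma> ?P"
      using sw prob_measuresD(2)[OF couplingsD(1)[OF g]] by (simp cong: measurable_cong_sets)
    have P: "fst \<in> measurable ?P (borel_of mtopology)" "snd \<in> measurable ?P (borel_of mtopology)"
      by (auto intro!: continuous_map_measurable continuous_map_fst continuous_map_snd)
    have "distr \<gamma> ?P prod.swap \<in> couplings mtopology \<beta> \<alpha>"
      using distr_in_prob_measures[OF couplingsD(1)[OF g] sw] couplingsD(2,3)[OF g]
      by (simp add: couplings_def distr_distr[OF P(1) sw'] distr_distr[OF P(2) sw'] comp_def)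
    moreover have "(\<integral>p. d (fst p) (snd p) \<partial>distr \<gamma> ?P prod.swap) = (\<integral>p. d (fst p) (snd p) \<partial>\<gamma>)"
      by (subst integral_distr[OF sw' measurable_distance])
        (intro Bochner_Integration.integral_cong refl, simp, rule commute)
    ultimately show ?thesis by blast
  qed
  have le: "wasserstein1 M d \<beta> \<alpha> \<le> wasserstein1 M d \<alpha> \<beta>" if ne: "couplings mtopology \<alpha> \<beta> \<noteq> {}" for \<alpha> \<beta>
  proof (rule field_le_epsilon)
    fix e :: real assume "e > 0"
    then obtain \<gamma> where g: "\<gamma> \<in> couplings mtopology \<alpha> \<beta>"
        "(\<integral>p. d (fst p) (snd p) \<partial>\<gamma>) < wasserstein1 M d \<alpha> \<beta> + e"
      using wasserstein1_approx[OF ne] by blast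
    then show "wasserstein1 M d \<beta> \<alpha> \<le> wasserstein1 M d \<alpha> \<beta> + e"
      using swap[OF g(1)] wasserstein1_le by fastforce
  qed
  have refl: "wasserstein1 M d \<alpha> \<alpha> = 0" if a: "\<alpha> \<in> prob_measures mtopology" for \<alpha>
  proof -
    have dg: "(\<lambda>x. (x, x)) \<in> measurable (borel_of mtopology) ?P"
      by (intro continuous_map_measurable continuous_map_pairedI) auto
    have dg': "(\<lambda>x. (x, x)) \<in> measurable \<alpha> ?P"
      using dg prob_measuresD(2)[OF a] by (simp cong: measurable_cong_sets)
    have P: "fst \<in> measurable ?P (borel_of mtopology)" "snd \<in> measurable ?P (borel_of mtopology)"
      by (auto intro!: continuous_map_measurable continuous_map_fst continuous_map_snd)
    have *: "distr \<alpha> (borel_of mtopology) (\<lambda>x. x) = \<alpha>"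
      using prob_measuresD(2)[OF a] by (intro distr_id2) simp
    have "distr \<alpha> ?P (\<lambda>x. (x, x)) \<in> couplings mtopology \<alpha> \<alpha>"
      using distr_in_prob_measures[OF a dg] *
      by (simp add: couplings_def distr_distr[OF P(1) dg'] distr_distr[OF P(2) dg'] comp_def)
    then have "wasserstein1 M d \<alpha> \<alpha> \<le> (\<integral>p. d (fst p) (snd p) \<partial>distr \<alpha> ?P (\<lambda>x. (x, x)))"
      by (rule wasserstein1_le)
    also have "\<dots> = (\<integral>x. d x x \<partial>\<alpha>)"
      by (subst integral_distr[OF dg' measurable_distance]) simp
    also have "\<dots> = (\<integral>x. 0 \<partial>\<alpha>)"
      using prob_measuresD(3)[OF a] by (intro Bochner_Integration.integral_cong) auto
    finally show ?thesis using wasserstein1_nonneg[of \<alpha> \<alpha>] by simp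
  qed
  show ?thesis
  proof
    fix \<alpha> \<beta>
    show "0 \<le> wasserstein1 M d \<alpha> \<beta>" by (rule wasserstein1_nonneg)
    show "wasserstein1 M d \<alpha> \<beta> = wasserstein1 M d \<beta> \<alpha>"
    \<comment> \<open>\<open>Metric_space\<close> demands symmetry outside the carrier as well,
      where there may be no coupling at all; swapping shows that this then happens in both
      orders.\<close>
    proof (cases "couplings mtopology \<alpha> \<beta> = {}")
      case True
      moreover from True have "couplings mtopology \<beta> \<alpha> = {}" using swap by blast
      ultimately show ?thesis by (simp add: wasserstein1_def)
    next
      case False
      moreover from False have "couplings mtopology \<beta> \<alpha> \<noteq> {}" using swap by blast
      ultimately show ?thesis by (intro antisym le)
    qed
  next
    fix \<alpha> \<beta> assume ab: "\<alpha> \<in> prob_measures mtopology" "\<beta> \<in> prob_measures mtopology"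
    show "wasserstein1 M d \<alpha> \<beta> = 0 \<longleftrightarrow> \<alpha> = \<beta>"
    proof
      assume 0: "wasserstein1 M d \<alpha> \<beta> = 0"
      show "\<alpha> = \<beta>"
        by (rule prob_measures_eqI[OF ab])
          (use lipschitz_integral_le_wasserstein1[OF couplings_nonempty[OF ab]] 0 in fastforce)
    qed (use refl ab in auto)
    fix \<delta> assume d: "\<delta> \<in> prob_measures mtopology"
    show "wasserstein1 M d \<alpha> \<delta> \<le> wasserstein1 M d \<alpha> \<beta> + wasserstein1 M d \<beta> \<delta>"
    proof (rule field_le_epsilon)
      fix e :: real assume "e > 0"
      obtain \<gamma>1 where g1: "\<gamma>1 \<in> couplings mtopology \<alpha> \<beta>"
          "(\<integral>p. d (fst p) (snd p) \<partial>\<gamma>1) < wasserstein1 M d \<alpha> \<beta> + e/4"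
        using wasserstein1_approx[OF couplings_nonempty[OF ab], of "e/4"] \<open>e > 0\<close> by auto
      obtain \<gamma>2 where g2: "\<gamma>2 \<in> couplings mtopology \<beta> \<delta>"
          "(\<integral>p. d (fst p) (snd p) \<partial>\<gamma>2) < wasserstein1 M d \<beta> \<delta> + e/4"
        using wasserstein1_approx[OF couplings_nonempty[OF ab(2) d], of "e/4"] \<open>e > 0\<close> by auto
      \<comment> \<open>Each near-minimiser exceeds its infimum by less than e/4 and gluing at scale
        e/8 adds e/4, which stays below e.\<close>
      obtain \<gamma> where g: "\<gamma> \<in> couplings mtopology \<alpha> \<delta>"
        "(\<integral>\<^sup>+p. ennreal (d (fst p) (snd p)) \<partial>\<gamma>) \<le>
          (\<integral>\<^sup>+p. ennreal (d (fst p) (snd p)) \<partial>\<gamma>1) + (\<integral>\<^sup>+p. ennreal (d (fst p) (snd p)) \<partial>\<gamma>2) + ennreal (2 * (e/8))"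
        using couplings_glue[OF g1(1) g2(1), of "e/8"] \<open>e > 0\<close> by auto
      have "(\<integral>p. d (fst p) (snd p) \<partial>\<gamma>) \<le> (\<integral>p. d (fst p) (snd p) \<partial>\<gamma>1) + (\<integral>p. d (fst p) (snd p) \<partial>\<gamma>2) + e/4"
        using g(2) \<open>e > 0\<close> unfolding coupling_nn_integral[OF g(1)] coupling_nn_integral[OF g1(1)] coupling_nn_integral[OF g2(1)]
        by (simp add: integral_nonneg_AE flip: ennreal_plus)
      then show "wasserstein1 M d \<alpha> \<delta> \<le> wasserstein1 M d \<alpha> \<beta> + wasserstein1 M d \<beta> \<delta> + e"
        using wasserstein1_le[OF g(1)] g1(2) g2(2) \<open>e > 0\<close> by linarith
    qed
  qed
qed

end

section \<open>Finite nets of measures for Lipschitz test functions\<close>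

context compact_metric
begin

lemma bounded_metric_wasserstein1:
  assumes "bounded_metric M d B"
  shows "bounded_metric (prob_measures mtopology) (wasserstein1 M d) B"
  using Metric_space_wasserstein1 bounded_metric.wasserstein1_le_bound[OF assms couplings_nonempty]
  by (simp add: bounded_metric_def bounded_metric_axioms_def)

text \<open>Cut the space into finitely many small cells and round the mass of each cell to a
  multiple of 1/m. Only finitely many rounded mass vectors \<open>q\<close> occur, and measures with
  equal vectors have close integrals, uniformly over the test functions. The error splits into e/4
  for making f constant on cells, once per measure, and e/2 for the rounding of masses.\<close>

lemma finite_net_lipschitz_integrals:
  assumes L: "L \<ge> 0" and e: "e > 0"
  obtains S where "finite S" "S \<subseteq> prob_measures mtopology"
    "\<And>\<alpha>. \<alpha> \<in> prob_measures mtopology \<Longrightarrow> \<exists>\<sigma>\<in>S. \<forall>f.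
      (\<forall>x\<in>M. \<forall>y\<in>M. \<bar>f x - f y\<bar> \<le> L * d x y) \<longrightarrow> \<bar>(\<integral>x. f x \<partial>\<alpha>) - (\<integral>x. f x \<partial>\<sigma>)\<bar> \<le> e"
proof -
  let ?B = "borel_of mtopology" and ?Pr = "prob_measures mtopology"
  obtain B0 where "bounded_metric M d B0" using bounded_metric_ex by blast
  then interpret bm: bounded_metric M d B0 .
  \<comment> \<open>On an empty \<open>M\<close> the bound \<open>B0\<close> could be negative,
    while monotonicity of products below needs \<open>0 \<le> L * B\<close>.\<close>
  define B where "B = max B0 0"
  have B: "d x y \<le> B" if "x \<in> M" "y \<in> M" for x y using bm.bounded[OF that] by (simp add: B_def)
  define e1 where "e1 = e / (4 * (L + 1))"
  have e1: "e1 > 0" "L * e1 \<le> e / 4" using e L by (auto simp: e1_def field_simps)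
  obtain s C where C: "finite C" "C \<subseteq> M" and s: "s \<in> measurable ?B (count_space C)"
    and ds: "\<And>x. x \<in> M \<Longrightarrow> d x (s x) < e1"
    using simple_approximation[OF e1(1)] by blast
  obtain m :: nat where m: "real m > 0" "card C * (L * B) / real m \<le> e / 2"
  proof -
    obtain m :: nat where "real m > 2 * (card C * (L * B)) / e" using reals_Archimedean2 by blast
    then show thesis using that[of "Suc m"] e by (simp add: field_simps)
  qed
  define A where "A c = s -` {c} \<inter> M" for c
  have A: "A c \<in> sets ?B" if "c \<in> C" for c
    using measurable_sets[OF s, of "{c}"] that by (simp add: A_def)
  have sC: "s x \<in> C" if "x \<in> M" for x using measurable_space[OF s] that by simp
  define q where "q \<alpha> = (\<lambda>c\<in>C. \<lfloor>real m * measure \<alpha> (A c)\<rfloor>)" for \<alpha> :: "'a measure"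
  \<comment> \<open>One representative is chosen for each rounded mass vector that is
    attained.\<close>
  define S where "S = (\<lambda>v. SOME \<alpha>. \<alpha> \<in> ?Pr \<and> q \<alpha> = v) ` (q ` ?Pr)"
  have S: "\<exists>\<sigma>\<in>S. \<sigma> \<in> ?Pr \<and> q \<sigma> = q \<alpha>" if "\<alpha> \<in> ?Pr" for \<alpha>
    using someI[of "\<lambda>\<beta>. \<beta> \<in> ?Pr \<and> q \<beta> = q \<alpha>" \<alpha>] that by (auto simp: S_def)
  have "q ` ?Pr \<subseteq> C \<rightarrow>\<^sub>E {0..int m}"
  proof
    fix v assume "v \<in> q ` ?Pr"
    then obtain \<alpha> where a: "\<alpha> \<in> ?Pr" "v = q \<alpha>" by blast
    interpret prob_space \<alpha> using prob_measuresD(1)[OF a(1)] .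
    have "\<lfloor>real m * measure \<alpha> (A c)\<rfloor> \<le> int m" for c
    proof -
      have "real m * measure \<alpha> (A c) \<le> real m * 1" by (rule mult_left_mono) auto
      then show ?thesis by (simp add: floor_le_iff)
    qed
    then show "v \<in> C \<rightarrow>\<^sub>E {0..int m}" by (auto simp: a(2) q_def)
  qed
  then have "finite (q ` ?Pr)"
    by (rule finite_subset) (simp add: finite_PiE C)
  then have "finite S" by (simp add: S_def)
  moreover have "S \<subseteq> ?Pr"
    unfolding S_def using someI_ex[of "\<lambda>\<beta>. \<beta> \<in> ?Pr \<and> q \<beta> = q _"] by blast
  moreover have "\<bar>(\<integral>x. f x \<partial>\<alpha>) - (\<integral>x. f x \<partial>\<sigma>)\<bar> \<le> e"
    if \<alpha>: "\<alpha> \<in> ?Pr" and \<sigma>: "\<sigma> \<in> ?Pr" and q: "q \<sigma> = q \<alpha>"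
      and f: "\<forall>x\<in>M. \<forall>y\<in>M. \<bar>f x - f y\<bar> \<le> L * d x y" for \<alpha> \<sigma> f
  proof -
    obtain x0 where x0: "x0 \<in> M" using prob_measures_topspace_nonempty[OF \<alpha>] by auto
    \<comment> \<open>The test functions are not uniformly bounded. Subtracting a constant leaves
      the difference of the two integrals unchanged and bounds the function by \<open>L * B\<close>,
      which the choice of \<open>m\<close> anticipates.\<close>
    define g where "g x = f x - f x0" for x
    have g: "\<bar>g x - g y\<bar> \<le> L * d x y" if "x \<in> M" "y \<in> M" for x y using f that by (simp add: g_def)
    have gB: "\<bar>g x\<bar> \<le> L * B" if "x \<in> M" for x
    proof -
      have "\<bar>g x\<bar> \<le> L * d x x0" using f that x0 by (simp add: g_def)
      also have "\<dots> \<le> L * B" by (rule mult_left_mono[OF B[OF that x0] L])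
      finally show ?thesis .
    qed
    have app: "\<bar>(\<integral>x. f x \<partial>\<rho>) - f x0 - (\<Sum>c\<in>C. g c * measure \<rho> (A c))\<bar> \<le> e / 4"
      if \<rho>: "\<rho> \<in> ?Pr" for \<rho>
    proof -
      interpret p: prob_space \<rho> using prob_measuresD(1)[OF \<rho>] .
      note sp = prob_measuresD(2,3)[OF \<rho>]
      have fi: "integrable \<rho> f" by (rule bm.lipschitz_bounded_measurable[OF _ L \<rho>]) (use f in auto)
      then have gi: "integrable \<rho> g" unfolding g_def by simp
      have A': "A c \<in> sets \<rho>" if "c \<in> C" for c using A[OF that] sp by simp
      have si: "integrable \<rho> (\<lambda>x. \<Sum>c\<in>C. g c * indicator (A c) x)"
        by (intro Bochner_Integration.integrable_sum integrable_mult_right integrable_real_indicator)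
          (auto simp: A' p.emeasure_eq_measure)
      have gs: "(\<Sum>c\<in>C. g c * indicator (A c) x) = g (s x)" if "x \<in> M" for x
      proof -
        have "(\<Sum>c\<in>C. g c * indicator (A c) x) = (\<Sum>c\<in>C. if c = s x then g c else 0)"
          using that by (intro sum.cong) (auto simp: A_def)
        then show ?thesis using sC[OF that] C(1) by simp
      qed
      have "(\<integral>x. f x \<partial>\<rho>) - f x0 = (\<integral>x. g x \<partial>\<rho>)"
        unfolding g_def using fi p.prob_space by simp
      moreover have "(\<Sum>c\<in>C. g c * measure \<rho> (A c)) = (\<integral>x. (\<Sum>c\<in>C. g c * indicator (A c) x) \<partial>\<rho>)"
        using A' sets.sets_into_space[OF A']
        by (subst Bochner_Integration.integral_sum) (auto simp: p.emeasure_eq_measure Int_absorb2 intro!: sum.cong)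
      ultimately have "\<bar>(\<integral>x. f x \<partial>\<rho>) - f x0 - (\<Sum>c\<in>C. g c * measure \<rho> (A c))\<bar>
          = \<bar>\<integral>x. g x - (\<Sum>c\<in>C. g c * indicator (A c) x) \<partial>\<rho>\<bar>"
        using gi si by simp
      also have "\<dots> \<le> (\<integral>x. \<bar>g x - (\<Sum>c\<in>C. g c * indicator (A c) x)\<bar> \<partial>\<rho>)" by (rule integral_abs_bound)
      also have "\<dots> \<le> (\<integral>x. e / 4 \<partial>\<rho>)"
      proof (rule integral_mono)
        fix x assume "x \<in> space \<rho>"
        then have x: "x \<in> M" using sp by simp
        then have "\<bar>g x - g (s x)\<bar> \<le> L * d x (s x)" using g sC C by blast
        also have "\<dots> \<le> L * e1" by (rule mult_left_mono) (use ds[OF x] L in auto)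
        finally show "\<bar>g x - (\<Sum>c\<in>C. g c * indicator (A c) x)\<bar> \<le> e / 4" using e1 gs[OF x] by simp
      qed (use gi si in auto)
      finally show ?thesis using p.prob_space by simp
    qed
    have w: "\<bar>measure \<alpha> (A c) - measure \<sigma> (A c)\<bar> \<le> 1 / real m" if c: "c \<in> C" for c
    proof -
      have "\<lfloor>real m * measure \<sigma> (A c)\<rfloor> = \<lfloor>real m * measure \<alpha> (A c)\<rfloor>"
        using fun_cong[OF q, of c] c by (simp add: q_def)
      then have "\<bar>real m * measure \<alpha> (A c) - real m * measure \<sigma> (A c)\<bar> \<le> 1" by linarith
      then have "real m * \<bar>measure \<alpha> (A c) - measure \<sigma> (A c)\<bar> \<le> 1"
        by (simp add: abs_mult flip: right_diff_distrib)
      then show ?thesis using m(1) by (simp add: field_simps)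
    qed
    have "\<bar>(\<Sum>c\<in>C. g c * measure \<alpha> (A c)) - (\<Sum>c\<in>C. g c * measure \<sigma> (A c))\<bar>
        = \<bar>\<Sum>c\<in>C. g c * (measure \<alpha> (A c) - measure \<sigma> (A c))\<bar>"
      by (simp add: sum_subtractf right_diff_distrib)
    also have "\<dots> \<le> (\<Sum>c\<in>C. \<bar>g c * (measure \<alpha> (A c) - measure \<sigma> (A c))\<bar>)" by (rule sum_abs)
    also have "\<dots> \<le> (\<Sum>c\<in>C. (L * B) * (1 / real m))"
      unfolding abs_mult
      by (intro sum_mono mult_mono w gB) (use C L B_def in auto)
    also have "\<dots> \<le> e / 2" using m(2) by simp
    finally show ?thesis using app[OF \<alpha>] app[OF \<sigma>] by linarith
  qed
  ultimately show thesis using that S by metis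
qed

end

section \<open>The assignment problem\<close>

fun path_weight :: "('i \<Rightarrow> 'i \<Rightarrow> real) \<Rightarrow> 'i list \<Rightarrow> real" where
  "path_weight w (x # y # zs) = w x y + path_weight w (y # zs)"
| "path_weight w _ = 0"

lemma path_weight_append: "path_weight w (xs @ y # ys) = path_weight w (xs @ [y]) + path_weight w (y # ys)"
proof (induction xs)
  case (Cons x xs) then show ?case by (cases xs) auto
qed simp

text \<open>The potential is the length of a shortest simple path leaving the vertex.\<close>

lemma potential_exists:
  assumes I: "finite I"
    and cyc: "\<And>k xs. distinct (k # xs) \<Longrightarrow> set (k # xs) \<subseteq> I \<Longrightarrow> path_weight w (k # xs @ [k]) \<ge> 0"
  shows "\<exists>v. \<forall>k\<in>I. \<forall>l\<in>I. v k \<le> w k l + (v l :: real)"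
proof -
  define P where "P k = {xs. set xs \<subseteq> I \<and> distinct xs \<and> xs \<noteq> [] \<and> hd xs = k}" for k
  define v where "v k = Min (path_weight w ` P k)" for k
  have fin: "finite (path_weight w ` P k)" for k
    using finite_subset[OF _ finite_subset_distinct[OF I], of "P k"] by (auto simp: P_def)
  have le: "v k \<le> path_weight w xs" if "xs \<in> P k" for k xs
    unfolding v_def using fin that by (intro Min_le) auto
  have "v k \<le> w k l + v l" if k: "k \<in> I" and l: "l \<in> I" for k l
  proof -
    have "[l] \<in> P l" using l by (simp add: P_def)
    then have "v l \<in> path_weight w ` P l" unfolding v_def by (intro Min_in fin) blast
    then obtain xs where xs: "xs \<in> P l" "v l = path_weight w xs" by blast
    then obtain ys where ys: "xs = l # ys" by (cases xs) (auto simp: P_def)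
    show ?thesis
    proof (cases "k \<in> set xs")
      case False
      then have "k # xs \<in> P k" using xs k by (auto simp: P_def)
      from le[OF this] show ?thesis using xs(2) by (simp add: ys)
    next
      \<comment> \<open>Prepending k to the path would visit k twice. The closed piece
        \<open>k # as @ [k]\<close> has nonnegative weight, so dropping it leaves a simple path from
        k of no greater weight.\<close>
      case True
      then obtain as bs where ab: "xs = as @ k # bs" by (meson split_list)
      have "k # bs \<in> P k" using xs(1) by (auto simp: P_def ab)
      then have "v k \<le> path_weight w (k # bs)" by (rule le)
      moreover have "path_weight w (k # as @ [k]) \<ge> 0"
        using xs(1) by (intro cyc) (auto simp: P_def ab)
      moreover have "path_weight w (k # as @ [k]) = w k l + path_weight w (as @ [k])"
        using ab ys by (cases as) auto
      ultimately show ?thesis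
        using xs(2) path_weight_append[of w as k bs] by (simp add: ab)
    qed
  qed
  then show ?thesis by blast
qed

text \<open>Cyclic permutation along the list. The closing edge, from the last entry back to
  \<open>x\<close>, is excluded from the sum because \<open>path_weight\<close> does not count it.
  In the induction the transposition redirects the last entry from \<open>y\<close> to
  \<open>x\<close>, and sends \<open>x\<close>, which the old permutation fixes, to
  \<open>y\<close>.\<close>

lemma cycle_permutation_exists:
  assumes "distinct (x # xs)"
  shows "\<exists>\<tau>. \<tau> permutes set (x # xs) \<and> \<tau> (last (x # xs)) = x \<and>
    (\<Sum>i\<in>set (x # xs) - {last (x # xs)}. w i (\<tau> i)) = path_weight w (x # xs)"
  using assms
proof (induction xs arbitrary: x)
  case Nil
  then show ?case by (intro exI[of _ id]) (auto simp: permutes_id)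
next
  case (Cons y zs)
  then obtain \<tau>' where t: "\<tau>' permutes set (y # zs)" "\<tau>' (last (y # zs)) = y"
    "(\<Sum>i\<in>set (y # zs) - {last (y # zs)}. w i (\<tau>' i)) = path_weight w (y # zs)"
    by auto
  define \<tau> where "\<tau> = Transposition.transpose x y \<circ> \<tau>'"
  have x: "x \<notin> set (y # zs)" using Cons.prems by simp
  have "\<tau> permutes set (x # y # zs)"
    unfolding \<tau>_def
    by (intro permutes_compose permutes_swap_id permutes_subset[OF t(1)]) auto
  moreover have tx: "\<tau>' x = x" using permutes_not_in[OF t(1) x] .
  have "\<tau> (last (x # y # zs)) = x" using t(2) by (simp add: \<tau>_def)
  moreover have "(\<Sum>i\<in>set (x # y # zs) - {last (x # y # zs)}. w i (\<tau> i)) = path_weight w (x # y # zs)"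
  proof -
    let ?S = "set (y # zs) - {last (y # zs)}"
    have e: "last (x # y # zs) = last (y # zs)" by simp
    have "x \<noteq> last (y # zs)" using x last_in_set[of "y # zs"] by blast
    then have "set (x # y # zs) - {last (x # y # zs)} = insert x ?S"
      unfolding e list.set(2)[of x] by blast
    moreover have "\<tau> i = \<tau>' i" if i: "i \<in> ?S" for i
    proof -
      have "\<tau>' i \<noteq> y"
        using i t(2) permutes_inj[OF t(1)] by (metis DiffE injD insertI1)
      moreover have "\<tau>' i \<noteq> x"
        using i permutes_in_image[OF t(1), of i] x by auto
      ultimately show ?thesis by (simp add: \<tau>_def)
    qed
    moreover have "x \<notin> ?S" using x by simp
    ultimately show ?thesis
      using t(3) tx by (simp add: \<tau>_def)
  qed
  ultimately show ?case by blast
qed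

text \<open>\<open>\<sigma>\<close> is an assignment of least total cost; \<open>u\<close> is a dual solution certifying this.\<close>

lemma optimal_assignment:
  fixes c :: "'i \<Rightarrow> 'i \<Rightarrow> real"
  assumes I: "finite I"
  obtains \<sigma> u where "\<sigma> permutes I" "\<And>k l. k \<in> I \<Longrightarrow> l \<in> I \<Longrightarrow> c k (\<sigma> k) + u (\<sigma> k) \<le> c k l + u l"
proof -
  obtain \<sigma> where \<sigma>: "\<sigma> permutes I"
    and min: "\<And>\<tau>. \<tau> permutes I \<Longrightarrow> (\<Sum>i\<in>I. c i (\<sigma> i)) \<le> (\<Sum>i\<in>I. c i (\<tau> i))"
  proof -
    have "{\<tau>. \<tau> permutes I} \<noteq> {}" using permutes_id by blast
    then show thesis
      using ex_is_arg_min_if_finite[OF finite_permutations[OF I], of "\<lambda>\<tau>. \<Sum>i\<in>I. c i (\<tau> i)"] that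
      by (auto simp: is_arg_min_def not_less)
  qed
  \<comment> \<open>The change in cost when k takes over the target of l. A cycle of negative weight
    would give a permutation cheaper than \<sigma>, so minimality of \<sigma> is exactly the
    condition that \<open>potential_exists\<close> asks for.\<close>
  define w where "w k l = c k (\<sigma> l) - c k (\<sigma> k)" for k l
  have "path_weight w (k # xs @ [k]) \<ge> 0" if d: "distinct (k # xs)" "set (k # xs) \<subseteq> I" for k xs
  proof -
    let ?S = "set (k # xs)" and ?l = "last (k # xs)"
    obtain \<tau> where t: "\<tau> permutes ?S" "\<tau> ?l = k" "(\<Sum>i\<in>?S - {?l}. w i (\<tau> i)) = path_weight w (k # xs)"
      using cycle_permutation_exists[OF d(1), of w] by blast
    have "k # xs = butlast (k # xs) @ [?l]" by simp
    then have "path_weight w (k # xs @ [k]) = path_weight w (butlast (k # xs) @ ?l # [k])"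
      by (metis append_Cons append_Nil append_assoc)
    also have "\<dots> = path_weight w (k # xs) + w ?l k"
      by (subst path_weight_append) simp
    also have "\<dots> = (\<Sum>i\<in>?S. w i (\<tau> i))"
      using t(2,3) sum.remove[of ?S ?l "\<lambda>i. w i (\<tau> i)"] last_in_set[of "k # xs"]
      by (simp del: last.simps)
    also have "\<dots> = (\<Sum>i\<in>I. w i (\<tau> i))"
      using d(2) I permutes_not_in[OF t(1)] by (intro sum.mono_neutral_left) (auto simp: w_def)
    also have "\<dots> = (\<Sum>i\<in>I. c i ((\<sigma> \<circ> \<tau>) i)) - (\<Sum>i\<in>I. c i (\<sigma> i))"
      by (simp add: w_def sum_subtractf)
    also have "\<dots> \<ge> 0"
      using min[OF permutes_compose[OF permutes_subset[OF t(1) d(2)] \<sigma>]] by simp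
    finally show ?thesis .
  qed
  from potential_exists[OF I this] obtain v where v: "\<And>k l. k \<in> I \<Longrightarrow> l \<in> I \<Longrightarrow> v k \<le> w k l + v l"
    by blast
  show thesis
  \<comment> \<open>The potential is indexed by sources; composing with the inverse of \<sigma>
    indexes it by targets, as the dual variable requires.\<close>
  proof (rule that[OF \<sigma>, of "v \<circ> inv \<sigma>"])
    fix k l assume kl: "k \<in> I" "l \<in> I"
    have "inv \<sigma> l \<in> I" using permutes_in_image[OF permutes_inv[OF \<sigma>]] kl by simp
    from v[OF kl(1) this] show "c k (\<sigma> k) + (v \<circ> inv \<sigma>) (\<sigma> k) \<le> c k l + (v \<circ> inv \<sigma>) l"
      using permutes_inverses[OF \<sigma>] by (simp add: w_def)
  qed
qed

section \<open>Mixed costs\<close>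

context compact_metric
begin

text \<open>Discretising every coordinate makes \<open>g\<close> factor through a finite discrete
  space, where any function is measurable, and the Lipschitz bound makes these functions converge
  pointwise to \<open>g\<close>. The result is for the product sigma-algebra directly, the one over
  which mixed costs are integrated.\<close>

lemma lipschitz_borel_measurable_pair_PiM:
  fixes g :: "'a \<Rightarrow> ('i \<Rightarrow> 'a) \<Rightarrow> real"
  assumes I: "finite I"
    and lip: "\<And>x y z w. x \<in> M \<Longrightarrow> y \<in> M \<Longrightarrow> z \<in> I \<rightarrow>\<^sub>E M \<Longrightarrow> w \<in> I \<rightarrow>\<^sub>E M \<Longrightarrow>
      \<bar>g x z - g y w\<bar> \<le> L * d x y + L' * (\<Sum>i\<in>I. d (z i) (w i))"
    and L: "L \<ge> 0" "L' \<ge> 0"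
  shows "(\<lambda>p. g (fst p) (snd p)) \<in> borel_measurable
    (borel_of mtopology \<Otimes>\<^sub>M (\<Pi>\<^sub>M i\<in>I. borel_of mtopology))"
proof -
  let ?B = "borel_of mtopology" and ?N = "borel_of mtopology \<Otimes>\<^sub>M (\<Pi>\<^sub>M i\<in>I. borel_of mtopology)"
  obtain s :: "nat \<Rightarrow> 'a \<Rightarrow> 'a" and C :: "nat \<Rightarrow> 'a set" where C: "\<And>m. finite (C m)" "\<And>m. C m \<subseteq> M"
    and s: "\<And>m. s m \<in> measurable ?B (count_space (C m))" and ds: "\<And>m x. x \<in> M \<Longrightarrow> d x (s m x) < inverse (Suc m)"
    using simple_approximation_sequence by metis
  define h where "h m p = g (s m (fst p)) (\<lambda>i\<in>I. s m (snd p i))" for m and p :: "'a \<times> ('i \<Rightarrow> 'a)"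
  have sp: "space ?N = M \<times> (I \<rightarrow>\<^sub>E M)" by (simp add: space_pair_measure space_PiM)
  show ?thesis
  proof (rule borel_measurable_LIMSEQ_real[of ?N h])
    fix m
    have [measurable]: "s m \<in> measurable ?B (count_space (C m))" by (rule s)
    have 1: "(\<lambda>p. s m (fst p)) \<in> measurable ?N (count_space (C m))" by measurable
    have 2: "(\<lambda>p. \<lambda>i\<in>I. s m (snd p i)) \<in> measurable ?N (\<Pi>\<^sub>M i\<in>I. count_space (C m))"
      by measurable
    have fin: "finite (I \<rightarrow>\<^sub>E C m)" by (simp add: finite_PiE I C)
    have "(\<lambda>p. (s m (fst p), \<lambda>i\<in>I. s m (snd p i))) \<in> measurable ?N (count_space (C m \<times> (I \<rightarrow>\<^sub>E C m)))"
      using measurable_Pair[OF 1 2] pair_measure_countable[of "C m" "I \<rightarrow>\<^sub>E C m"]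
      by (simp add: count_space_PiM_finite I countable_finite C fin)
    from measurable_compose[OF this, of "\<lambda>q. g (fst q) (snd q)" borel]
    show "h m \<in> borel_measurable ?N" by (simp add: h_def[abs_def])
  next
    fix p assume "p \<in> space ?N"
    then obtain x z where p: "p = (x, z)" and x: "x \<in> M" and z: "z \<in> I \<rightarrow>\<^sub>E M" by (auto simp: sp)
    have sM: "s m y \<in> M" if "y \<in> M" for m y using measurable_space[OF s, of y m] that C(2)[of m] by auto
    have "\<bar>h m p - g x z\<bar> \<le> (L + L' * card I) * inverse (Suc m)" for m
    proof -
      have "(\<lambda>i\<in>I. s m (z i)) \<in> I \<rightarrow>\<^sub>E M" using z sM by auto
      from lip[OF x sM[OF x] z this, of m]
      have "\<bar>h m p - g x z\<bar> \<le> L * d x (s m x) + L' * (\<Sum>i\<in>I. d (z i) (s m (z i)))"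
        by (simp add: h_def p abs_minus_commute cong: sum.cong)
      also have "\<dots> \<le> L * inverse (Suc m) + L' * (\<Sum>i\<in>I. inverse (Suc m))"
        by (intro add_mono mult_left_mono sum_mono less_imp_le ds x L) (use z in auto)
      finally show ?thesis by (simp add: algebra_simps)
    qed
    then have "(\<lambda>m. h m p - g x z) \<longlonglongrightarrow> 0"
      by (intro metric_tendsto_imp_tendsto[OF tendsto_mult_right_zero[OF LIMSEQ_inverse_real_of_nat]] always_eventually)
        (auto simp: dist_real_def intro: order_trans[OF _ abs_ge_self])
    then show "(\<lambda>m. h m p) \<longlonglongrightarrow> g (fst p) (snd p)"
      unfolding p fst_conv snd_conv by (rule LIM_zero_cancel)
  qed
qed

lemma PiM_measurable_cong:
  assumes "\<And>i. i \<in> I \<Longrightarrow> \<rho> i \<in> prob_measures mtopology"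
  shows "sets (PiM I \<rho>) = sets (\<Pi>\<^sub>M i\<in>I. borel_of mtopology)" "space (PiM I \<rho>) = I \<rightarrow>\<^sub>E M"
proof -
  show "sets (PiM I \<rho>) = sets (\<Pi>\<^sub>M i\<in>I. borel_of mtopology)"
    using prob_measuresD(2)[OF assms] by (intro sets_PiM_cong) auto
  show "space (PiM I \<rho>) = I \<rightarrow>\<^sub>E M"
    using prob_measuresD(3)[OF assms] by (auto simp: space_PiM intro!: PiE_cong)
qed

lemma lipschitz_integrable_PiM:
  assumes I: "finite I" and \<rho>: "\<And>i. i \<in> I \<Longrightarrow> \<rho> i \<in> prob_measures mtopology"
    and m: "H \<in> borel_measurable (\<Pi>\<^sub>M i\<in>I. borel_of mtopology)"
    and lip: "\<And>z w. z \<in> I \<rightarrow>\<^sub>E M \<Longrightarrow> w \<in> I \<rightarrow>\<^sub>E M \<Longrightarrow> \<bar>H z - H w\<bar> \<le> L * (\<Sum>i\<in>I. d (z i) (w i))"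
    and L: "L \<ge> 0"
  shows "integrable (PiM I \<rho>) (H :: _ \<Rightarrow> real)"
proof -
  obtain B where "bounded_metric M d B" using bounded_metric_ex by blast
  then interpret bm: bounded_metric M d B .
  interpret prob_space "PiM I \<rho>" using prob_measuresD(1)[OF \<rho>] by (intro prob_space_PiM) auto
  have sts: "sets (PiM I \<rho>) = sets (\<Pi>\<^sub>M i\<in>I. borel_of mtopology)" and sp: "space (PiM I \<rho>) = I \<rightarrow>\<^sub>E M"
    by (rule PiM_measurable_cong, rule \<rho>, assumption)+
  obtain z0 where z0: "z0 \<in> I \<rightarrow>\<^sub>E M"
    using not_empty unfolding sp by blast
  show ?thesis
  proof (rule integrable_const_bound[of _ "\<bar>H z0\<bar> + L * (\<Sum>i\<in>I. B)"])
    show "H \<in> borel_measurable (PiM I \<rho>)" using m sts by (simp cong: measurable_cong_sets)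
    show "AE z in PiM I \<rho>. norm (H z) \<le> \<bar>H z0\<bar> + L * (\<Sum>i\<in>I. B)"
    proof (rule AE_I2)
      fix z assume "z \<in> space (PiM I \<rho>)"
      then have z: "z \<in> I \<rightarrow>\<^sub>E M" using sp by simp
      have "(\<Sum>i\<in>I. d (z i) (z0 i)) \<le> (\<Sum>i\<in>I. B)"
        by (intro sum_mono bm.bounded) (use z z0 in auto)
      then have "L * (\<Sum>i\<in>I. d (z i) (z0 i)) \<le> L * (\<Sum>i\<in>I. B)" using L by (rule mult_left_mono)
      then show "norm (H z) \<le> \<bar>H z0\<bar> + L * (\<Sum>i\<in>I. B)" using lip[OF z z0] by simp
    qed
  qed
qed

text \<open>Coordinates are exchanged one at a time. With the others frozen, \<open>H\<close> is
  \<open>L\<close>-Lipschitz in the remaining coordinate, so each exchange costs \<open>L\<close>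
  times one Wasserstein distance and the costs add up.\<close>

lemma PiM_integral_lipschitz:
  assumes I: "finite I" and \<rho>: "\<And>i. \<rho> i \<in> prob_measures mtopology" "\<And>i. \<rho>' i \<in> prob_measures mtopology"
    and m: "H \<in> borel_measurable (\<Pi>\<^sub>M i\<in>I. borel_of mtopology)"
    and lip: "\<And>z w. z \<in> I \<rightarrow>\<^sub>E M \<Longrightarrow> w \<in> I \<rightarrow>\<^sub>E M \<Longrightarrow> \<bar>H z - H w\<bar> \<le> L * (\<Sum>i\<in>I. d (z i) (w i))"
    and L: "L \<ge> 0"
  shows "\<bar>(\<integral>z. H z \<partial>PiM I \<rho>) - (\<integral>z. H z \<partial>PiM I \<rho>')\<bar> \<le> L * (\<Sum>i\<in>I. wasserstein1 M d (\<rho> i) (\<rho>' i))"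
  using I m lip
proof (induction I arbitrary: H)
  case empty
  have "PiM {} \<rho> = PiM {} \<rho>'" by (rule PiM_cong) auto
  then show ?case by simp
next
  case (insert i F)
  let ?B = "borel_of mtopology"
  obtain B where "bounded_metric M d B" using bounded_metric_ex by blast
  then interpret bm: bounded_metric M d B .
  have pr: "prob_space (\<rho> i)" "prob_space (\<rho>' i)" for i using prob_measuresD(1)[OF \<rho>(1)] prob_measuresD(1)[OF \<rho>(2)] by auto
  \<comment> \<open>Integrating out coordinate i keeps the Lipschitz constant \<open>L\<close> in
    the other coordinates, so the induction hypothesis applies to \<open>H1 \<rho>\<close>.\<close>
  define H1 where "H1 \<rho> z = (\<integral>y. H (z(i := y)) \<partial>\<rho> i)" for \<rho> :: "'b \<Rightarrow> 'a measure" and z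
  have up: "z(i := y) \<in> insert i F \<rightarrow>\<^sub>E M" if "z \<in> F \<rightarrow>\<^sub>E M" "y \<in> M" for z y using that by (intro PiE_fun_upd)
  have lipy: "\<bar>H (z(i := y)) - H (z(i := y'))\<bar> \<le> L * d y y'" if "z \<in> F \<rightarrow>\<^sub>E M" "y \<in> M" "y' \<in> M" for z y y'
  proof -
    have "(\<Sum>j\<in>F. d ((z(i := y)) j) ((z(i := y')) j)) = (\<Sum>j\<in>F. 0)"
    proof (rule sum.cong)
      fix j assume j: "j \<in> F"
      then have "z j \<in> M" "j \<noteq> i" using that(1) insert.hyps(2) by auto
      then show "d ((z(i := y)) j) ((z(i := y')) j) = 0" by simp
    qed simp
    then have s: "(\<Sum>j\<in>insert i F. d ((z(i := y)) j) ((z(i := y')) j)) = d y y'"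
      unfolding sum.insert[OF insert.hyps] by simp
    show ?thesis
      using insert.prems(2)[OF up[OF that(1,2)] up[OF that(1,3)]] unfolding s .
  qed
  have lipz: "\<bar>H (z(i := y)) - H (w(i := y))\<bar> \<le> L * (\<Sum>j\<in>F. d (z j) (w j))"
    if "z \<in> F \<rightarrow>\<^sub>E M" "w \<in> F \<rightarrow>\<^sub>E M" "y \<in> M" for z w y
  proof -
    have "(\<Sum>j\<in>F. d ((z(i := y)) j) ((w(i := y)) j)) = (\<Sum>j\<in>F. d (z j) (w j))"
      using insert.hyps(2) by (intro sum.cong) auto
    then have s: "(\<Sum>j\<in>insert i F. d ((z(i := y)) j) ((w(i := y)) j)) = (\<Sum>j\<in>F. d (z j) (w j))"
      unfolding sum.insert[OF insert.hyps] using that by simp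
    show ?thesis
      using insert.prems(2)[OF up[OF that(1,3)] up[OF that(2,3)]] unfolding s .
  qed
  have main: "(\<integral>z. H z \<partial>PiM (insert i F) \<rho>) = (\<integral>z. H1 \<rho> z \<partial>PiM F \<rho>)"
    "H1 \<rho> \<in> borel_measurable (\<Pi>\<^sub>M i\<in>F. ?B)"
    "\<And>z w. z \<in> F \<rightarrow>\<^sub>E M \<Longrightarrow> w \<in> F \<rightarrow>\<^sub>E M \<Longrightarrow> \<bar>H1 \<rho> z - H1 \<rho> w\<bar> \<le> L * (\<Sum>i\<in>F. d (z i) (w i))"
    if \<rho>: "\<And>i. \<rho> i \<in> prob_measures mtopology" for \<rho>
  proof -
    interpret i: prob_space "\<rho> i" using prob_measuresD(1)[OF \<rho>] .
    interpret P: product_prob_space \<rho> using prob_measuresD(1)[OF \<rho>] by (intro product_prob_spaceI)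
    have int: "integrable (PiM (insert i F) \<rho>) H"
      by (rule lipschitz_integrable_PiM[OF _ \<rho> insert.prems L]) (use insert.hyps in auto)
    show "(\<integral>z. H z \<partial>PiM (insert i F) \<rho>) = (\<integral>z. H1 \<rho> z \<partial>PiM F \<rho>)"
      unfolding H1_def by (rule P.product_integral_insert[OF insert.hyps int])
    have "(\<lambda>(z, y). H (z(i := y))) \<in> borel_measurable (PiM F (\<lambda>_. ?B) \<Otimes>\<^sub>M ?B)"
      using measurable_compose[OF measurable_add_dim[of i F "\<lambda>_. ?B"] insert.prems(1)]
      by (simp add: case_prod_unfold del: fun_upd_apply)
    moreover have "sets (PiM F (\<lambda>_. ?B) \<Otimes>\<^sub>M \<rho> i) = sets (PiM F (\<lambda>_. ?B) \<Otimes>\<^sub>M ?B)"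
      using prob_measuresD(2)[OF \<rho>] by (intro sets_pair_measure_cong) auto
    ultimately have "(\<lambda>(z, y). H (z(i := y))) \<in> borel_measurable (PiM F (\<lambda>_. ?B) \<Otimes>\<^sub>M \<rho> i)"
      by (simp cong: measurable_cong_sets)
    from i.borel_measurable_lebesgue_integral[OF this]
    show "H1 \<rho> \<in> borel_measurable (\<Pi>\<^sub>M i\<in>F. ?B)" by (simp add: H1_def[abs_def])
    fix z w assume z: "z \<in> F \<rightarrow>\<^sub>E M" and w: "w \<in> F \<rightarrow>\<^sub>E M"
    have iz: "integrable (\<rho> i) (\<lambda>y. H (z(i := y)))" if "z \<in> F \<rightarrow>\<^sub>E M" for z
      by (rule bm.lipschitz_bounded_measurable(2)[OF lipy[OF that] L \<rho>])
    have "\<bar>H1 \<rho> z - H1 \<rho> w\<bar> = \<bar>\<integral>y. H (z(i := y)) - H (w(i := y)) \<partial>\<rho> i\<bar>"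
      unfolding H1_def using iz[OF z] iz[OF w] by simp
    also have "\<dots> \<le> (\<integral>y. \<bar>H (z(i := y)) - H (w(i := y))\<bar> \<partial>\<rho> i)" by (rule integral_abs_bound)
    also have "\<dots> \<le> (\<integral>y. L * (\<Sum>i\<in>F. d (z i) (w i)) \<partial>\<rho> i)"
      using iz[OF z] iz[OF w] lipz[OF z w] prob_measuresD(3)[OF \<rho>] by (intro integral_mono) auto
    finally show "\<bar>H1 \<rho> z - H1 \<rho> w\<bar> \<le> L * (\<Sum>i\<in>F. d (z i) (w i))" using i.prob_space by simp
  qed
  \<comment> \<open>The intermediate term between the two integrals is \<open>H1 \<rho>\<close>
    integrated against \<open>PiM F \<rho>'\<close>: here the coordinates in \<open>F\<close> are
    exchanged, and in \<open>2\<close> coordinate i.\<close>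
  have 1: "\<bar>(\<integral>z. H1 \<rho> z \<partial>PiM F \<rho>) - (\<integral>z. H1 \<rho> z \<partial>PiM F \<rho>')\<bar> \<le> L * (\<Sum>i\<in>F. wasserstein1 M d (\<rho> i) (\<rho>' i))"
    by (rule insert.IH[OF main(2,3)[OF \<rho>(1)]])
  have int: "integrable (PiM F \<rho>') (H1 \<tau>)" if \<tau>: "\<And>i. \<tau> i \<in> prob_measures mtopology" for \<tau>
    by (rule lipschitz_integrable_PiM[OF insert.hyps(1) \<rho>(2) main(2,3)[OF \<tau>] L])
  interpret PF: prob_space "PiM F \<rho>'" using pr by (intro prob_space_PiM) auto
  have "\<bar>(\<integral>z. H1 \<rho> z \<partial>PiM F \<rho>') - (\<integral>z. H1 \<rho>' z \<partial>PiM F \<rho>')\<bar> = \<bar>\<integral>z. H1 \<rho> z - H1 \<rho>' z \<partial>PiM F \<rho>'\<bar>"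
    using int[OF \<rho>(1)] int[OF \<rho>(2)] by simp
  also have "\<dots> \<le> (\<integral>z. \<bar>H1 \<rho> z - H1 \<rho>' z\<bar> \<partial>PiM F \<rho>')" by (rule integral_abs_bound)
  also have "\<dots> \<le> (\<integral>z. L * wasserstein1 M d (\<rho> i) (\<rho>' i) \<partial>PiM F \<rho>')"
  proof (rule integral_mono)
    fix z assume "z \<in> space (PiM F \<rho>')"
    then have z: "z \<in> F \<rightarrow>\<^sub>E M" using PiM_measurable_cong(2)[of F \<rho>', OF \<rho>(2)] by simp
    show "\<bar>H1 \<rho> z - H1 \<rho>' z\<bar> \<le> L * wasserstein1 M d (\<rho> i) (\<rho>' i)"
      unfolding H1_def
      by (rule bm.lipschitz_integral_le_wasserstein1[OF couplings_nonempty[OF \<rho>] lipy[OF z] L])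
  qed (use int[OF \<rho>(1)] int[OF \<rho>(2)] in auto)
  finally have 2: "\<bar>(\<integral>z. H1 \<rho> z \<partial>PiM F \<rho>') - (\<integral>z. H1 \<rho>' z \<partial>PiM F \<rho>')\<bar> \<le> L * wasserstein1 M d (\<rho> i) (\<rho>' i)"
    using PF.prob_space by simp
  show ?case
    using 1 2 insert.hyps unfolding main(1)[OF \<rho>(1)] main(1)[OF \<rho>(2)] by (simp add: distrib_left)
qed

end

text \<open>One game with N fixed. The bound \<open>B\<close> is a parameter rather than obtained
  inside, so that the error terms of different N carry the same constant.\<close>

locale mean_field_game = compact_metric M d + type: Metric_space \<Theta> dT
  for M :: "'x set" and d and \<Theta> :: "'t set" and dT +
  fixes K B :: real and N :: nat and types :: "'t set" and J :: "'t \<Rightarrow> 'x \<Rightarrow> (nat \<Rightarrow> 'x) \<Rightarrow> real"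
  assumes bounded: "bounded_metric M d B"
    and K: "K \<ge> 0" and N: "N \<ge> 2"
    and types: "finite types" "types \<noteq> {}" "types \<subseteq> \<Theta>"
    and symmetric: "\<And>t x z \<sigma>. t \<in> types \<Longrightarrow> x \<in> M \<Longrightarrow> z \<in> {1..<N} \<rightarrow>\<^sub>E M \<Longrightarrow>
      \<sigma> permutes {1..<N} \<Longrightarrow> J t x (z \<circ> \<sigma>) = J t x z"
    and lipschitz: "\<And>t t' x y z w. t \<in> types \<Longrightarrow> t' \<in> types \<Longrightarrow> x \<in> M \<Longrightarrow> y \<in> M \<Longrightarrow>
      z \<in> {1..<N} \<rightarrow>\<^sub>E M \<Longrightarrow> w \<in> {1..<N} \<rightarrow>\<^sub>E M \<Longrightarrow>
      \<bar>J t x z - J t' y w\<bar> \<le> K * dT t t' + K * d x y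
        + K * wasserstein1 M d (empirical_measure mtopology {1..<N} z) (empirical_measure mtopology {1..<N} w)"
begin

sublocale bm: bounded_metric M d B by (rule bounded)

sublocale PM: bounded_metric "prob_measures mtopology" "wasserstein1 M d" B
  by (rule bounded_metric_wasserstein1[OF bounded])

lemma players: "finite {1..<N}" "{1..<N} \<noteq> {}" "card {1..<N} = N - 1" "real N - 1 > 0" "real (N - 1) = real N - 1"
  using N by auto

text \<open>Pairing equal indices is a coupling of the two empirical measures. It turns the
  Wasserstein term into a coordinatewise Lipschitz bound with constant
  \<open>K / (real N - 1)\<close>, so that sums over opponents become averages, comparable to
  transport costs.\<close>

lemma lipschitz_sum:
  assumes "t \<in> types" "t' \<in> types" "x \<in> M" "y \<in> M" "z \<in> {1..<N} \<rightarrow>\<^sub>E M" "w \<in> {1..<N} \<rightarrow>\<^sub>E M"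
  shows "\<bar>J t x z - J t' y w\<bar> \<le> K * dT t t' + K * d x y + K / (real N - 1) * (\<Sum>k\<in>{1..<N}. d (z k) (w k))"
proof -
  have "wasserstein1 M d (empirical_measure mtopology {1..<N} z) (empirical_measure mtopology {1..<N} w)
      \<le> (\<Sum>k\<in>{1..<N}. d (z k) (w k)) / real (N - 1)"
    unfolding players(3)[symmetric] using players(1,2) assms(5,6)
    by (intro bm.wasserstein1_empirical_measure_le) (auto simp: PiE_iff)
  from mult_left_mono[OF this K] show ?thesis
    using lipschitz[OF assms] by (simp add: players(5) del: One_nat_def)
qed

lemma cost_measurable:
  assumes "t \<in> types"
  shows "(\<lambda>p. J t (fst p) (snd p)) \<in> borel_measurable
    (borel_of mtopology \<Otimes>\<^sub>M (\<Pi>\<^sub>M k\<in>{1..<N}. borel_of mtopology))"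
proof (rule lipschitz_borel_measurable_pair_PiM)
  fix x y z w assume "x \<in> M" "y \<in> M" "z \<in> {1..<N} \<rightarrow>\<^sub>E M" "w \<in> {1..<N} \<rightarrow>\<^sub>E M"
  then show "\<bar>J t x z - J t y w\<bar> \<le> K * d x y + K / (real N - 1) * (\<Sum>k\<in>{1..<N}. d (z k) (w k))"
    using lipschitz_sum[OF assms assms, of x y z w] assms types by (simp add: subset_iff)
qed (use K players in auto)

context
  fixes \<rho> :: "nat \<Rightarrow> 'x measure"
  assumes \<rho>: "\<And>k. k \<in> {1..<N} \<Longrightarrow> \<rho> k \<in> prob_measures mtopology"
begin

lemma prob_space_others: "prob_space (\<Pi>\<^sub>M k\<in>{1..<N}. \<rho> k)"
  by (rule prob_space_PiM) (rule prob_measuresD(1)[OF \<rho>])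

lemma inner_measurable:
  assumes "t \<in> types" "x \<in> M"
  shows "J t x \<in> borel_measurable (\<Pi>\<^sub>M k\<in>{1..<N}. borel_of mtopology)"
  using measurable_compose[OF measurable_Pair1' cost_measurable[OF assms(1)], of x] assms(2) by simp

lemma inner_lipschitz:
  assumes t: "t \<in> types" and x: "x \<in> M" and "z \<in> {1..<N} \<rightarrow>\<^sub>E M" "w \<in> {1..<N} \<rightarrow>\<^sub>E M"
  shows "\<bar>J t x z - J t x w\<bar> \<le> K / (real N - 1) * (\<Sum>k\<in>{1..<N}. d (z k) (w k))"
  using lipschitz_sum[OF t t x x assms(3,4)] t x types by (simp add: subset_iff)

lemma inner_integrable:
  assumes "t \<in> types" "x \<in> M"
  shows "integrable (\<Pi>\<^sub>M k\<in>{1..<N}. \<rho> k) (J t x)"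
  by (rule lipschitz_integrable_PiM[OF _ \<rho> inner_measurable[OF assms] inner_lipschitz[OF assms]])
    (use K players in auto)

lemma inner_integral_lipschitz:
  assumes "t \<in> types" "t' \<in> types" "x \<in> M" "y \<in> M"
  shows "\<bar>(\<integral>z. J t x z \<partial>\<Pi>\<^sub>M k\<in>{1..<N}. \<rho> k) - (\<integral>z. J t' y z \<partial>\<Pi>\<^sub>M k\<in>{1..<N}. \<rho> k)\<bar>
    \<le> K * dT t t' + K * d x y"
proof -
  interpret prob_space "\<Pi>\<^sub>M k\<in>{1..<N}. \<rho> k" by (rule prob_space_others)
  have sp: "space (\<Pi>\<^sub>M k\<in>{1..<N}. \<rho> k) = {1..<N} \<rightarrow>\<^sub>E M"
    by (rule PiM_measurable_cong) (rule \<rho>)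
  have "\<bar>J t x z - J t' y z\<bar> \<le> K * dT t t' + K * d x y" if z: "z \<in> {1..<N} \<rightarrow>\<^sub>E M" for z
  proof -
    have "(\<Sum>k\<in>{1..<N}. d (z k) (z k)) = (\<Sum>k\<in>{1..<N}. 0)" using z by (intro sum.cong) (auto simp: PiE_iff)
    then show ?thesis using lipschitz_sum[OF assms z z] by simp
  qed
  note bound = this and ints = inner_integrable[OF assms(1,3)] inner_integrable[OF assms(2,4)]
  have "\<bar>(\<integral>z. J t x z \<partial>\<Pi>\<^sub>M k\<in>{1..<N}. \<rho> k) - (\<integral>z. J t' y z \<partial>\<Pi>\<^sub>M k\<in>{1..<N}. \<rho> k)\<bar>
      = \<bar>\<integral>z. J t x z - J t' y z \<partial>\<Pi>\<^sub>M k\<in>{1..<N}. \<rho> k\<bar>"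
    by (simp only: Bochner_Integration.integral_diff[OF ints])
  also have "\<dots> \<le> (\<integral>z. \<bar>J t x z - J t' y z\<bar> \<partial>\<Pi>\<^sub>M k\<in>{1..<N}. \<rho> k)" by (rule integral_abs_bound)
  also have "\<dots> \<le> (\<integral>z. K * dT t t' + K * d x y \<partial>\<Pi>\<^sub>M k\<in>{1..<N}. \<rho> k)"
    using ints bound sp by (intro integral_mono) (auto simp del: One_nat_def)
  finally show ?thesis using prob_space by simp
qed

lemma inner_integral_lipschitz_point:
  assumes "t \<in> types" "x \<in> M" "y \<in> M"
  shows "\<bar>(\<integral>z. J t x z \<partial>\<Pi>\<^sub>M k\<in>{1..<N}. \<rho> k) - (\<integral>z. J t y z \<partial>\<Pi>\<^sub>M k\<in>{1..<N}. \<rho> k)\<bar> \<le> K * d x y"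
  using inner_integral_lipschitz[OF assms(1,1,2,3)] assms(1) types by (simp add: subset_iff)

text \<open>Fubini, with integrability from the Lipschitz bound and the finite diameter. The inner
  integral is a \<open>K\<close>-Lipschitz function of x, which is how the dependence on \<pi> is
  controlled.\<close>

lemma mixed_cost_eq:
  assumes t: "t \<in> types" and \<pi>: "\<pi> \<in> prob_measures mtopology"
  shows "mixed_cost N J t \<pi> \<rho> = (\<integral>x. (\<integral>z. J t x z \<partial>\<Pi>\<^sub>M k\<in>{1..<N}. \<rho> k) \<partial>\<pi>)"
proof -
  interpret p: prob_space \<pi> by (rule prob_measuresD(1)[OF \<pi>])
  interpret r: prob_space "\<Pi>\<^sub>M k\<in>{1..<N}. \<rho> k" by (rule prob_space_others)
  interpret pr: pair_prob_space \<pi> "\<Pi>\<^sub>M k\<in>{1..<N}. \<rho> k" ..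
  have sp: "space (\<Pi>\<^sub>M k\<in>{1..<N}. \<rho> k) = {1..<N} \<rightarrow>\<^sub>E M"
    and sts: "sets (\<Pi>\<^sub>M k\<in>{1..<N}. \<rho> k) = sets (\<Pi>\<^sub>M k\<in>{1..<N}. borel_of mtopology)"
    by (rule PiM_measurable_cong, rule \<rho>, assumption)+
  have spp: "space (\<pi> \<Otimes>\<^sub>M (\<Pi>\<^sub>M k\<in>{1..<N}. \<rho> k)) = M \<times> ({1..<N} \<rightarrow>\<^sub>E M)"
    using prob_measuresD(3)[OF \<pi>] sp by (simp add: space_pair_measure)
  obtain p0 where p0: "p0 \<in> M \<times> ({1..<N} \<rightarrow>\<^sub>E M)" using pr.not_empty unfolding spp by blast
  have "sets (\<pi> \<Otimes>\<^sub>M (\<Pi>\<^sub>M k\<in>{1..<N}. \<rho> k))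
      = sets (borel_of mtopology \<Otimes>\<^sub>M (\<Pi>\<^sub>M k\<in>{1..<N}. borel_of mtopology))"
    by (rule sets_pair_measure_cong[OF prob_measuresD(2)[OF \<pi>] sts])
  then have m: "(\<lambda>p. J t (fst p) (snd p)) \<in> borel_measurable (\<pi> \<Otimes>\<^sub>M (\<Pi>\<^sub>M k\<in>{1..<N}. \<rho> k))"
    using cost_measurable[OF t] by (simp cong: measurable_cong_sets)
  have "\<bar>J t (fst p) (snd p)\<bar> \<le> \<bar>J t (fst p0) (snd p0)\<bar> + K * B + K * B"
    if p: "p \<in> M \<times> ({1..<N} \<rightarrow>\<^sub>E M)" for p
  proof -
    have "wasserstein1 M d (empirical_measure mtopology {1..<N} (snd p)) (empirical_measure mtopology {1..<N} (snd p0)) \<le> B"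
      using p p0 players by (intro PM.bounded empirical_measure_in_prob_measures) auto
    note w = mult_left_mono[OF this K]
    have "d (fst p) (fst p0) \<le> B" using p p0 by (intro bm.bounded) auto
    note d = mult_left_mono[OF this K]
    have "K * dT t t = 0" using t types by auto
    moreover have "\<bar>J t (fst p) (snd p) - J t (fst p0) (snd p0)\<bar> \<le> K * dT t t + K * d (fst p) (fst p0)
        + K * wasserstein1 M d (empirical_measure mtopology {1..<N} (snd p)) (empirical_measure mtopology {1..<N} (snd p0))"
      using p p0 by (intro lipschitz t) auto
    ultimately show ?thesis using w d by linarith
  qed
  then have "integrable (\<pi> \<Otimes>\<^sub>M (\<Pi>\<^sub>M k\<in>{1..<N}. \<rho> k)) (\<lambda>p. J t (fst p) (snd p))"
    using spp m by (intro pr.integrable_const_bound[of _ "\<bar>J t (fst p0) (snd p0)\<bar> + K * B + K * B"] AE_I2) auto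
  from pr.integral_fst'[OF this] show ?thesis by (simp add: mixed_cost_def)
qed

text \<open>The cost sees \<pi> only through the integral of a function that is
  \<open>K\<close>-Lipschitz whatever N and \<rho> are; hence the modulus is uniform in
  both.\<close>

lemma mixed_cost_close:
  assumes t: "t \<in> types" and \<pi>: "\<pi> \<in> prob_measures mtopology" "\<pi>' \<in> prob_measures mtopology"
    and close: "\<And>f. (\<forall>x\<in>M. \<forall>y\<in>M. \<bar>f x - f y\<bar> \<le> K * d x y) \<Longrightarrow>
      \<bar>(\<integral>x. f x \<partial>\<pi>) - (\<integral>x. f x \<partial>\<pi>')\<bar> \<le> e"
  shows "\<bar>mixed_cost N J t \<pi> \<rho> - mixed_cost N J t \<pi>' \<rho>\<bar> \<le> e"
  unfolding mixed_cost_eq[OF t \<pi>(1)] mixed_cost_eq[OF t \<pi>(2)]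
  by (rule close) (use inner_integral_lipschitz_point[OF t] in blast)

lemma mixed_cost_type_lipschitz:
  assumes t: "t \<in> types" "t' \<in> types" and \<pi>: "\<pi> \<in> prob_measures mtopology"
  shows "\<bar>mixed_cost N J t \<pi> \<rho> - mixed_cost N J t' \<pi> \<rho>\<bar> \<le> K * dT t t'"
proof -
  interpret p: prob_space \<pi> by (rule prob_measuresD(1)[OF \<pi>])
  let ?f = "\<lambda>t x. \<integral>z. J t x z \<partial>\<Pi>\<^sub>M k\<in>{1..<N}. \<rho> k"
  have i: "integrable \<pi> (?f t)" if "t \<in> types" for t
    by (rule bm.lipschitz_bounded_measurable(2)[OF inner_integral_lipschitz_point[OF that] K \<pi>])
  have "\<bar>(\<integral>x. ?f t x \<partial>\<pi>) - (\<integral>x. ?f t' x \<partial>\<pi>)\<bar> = \<bar>\<integral>x. ?f t x - ?f t' x \<partial>\<pi>\<bar>"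
    using i t by simp
  also have "\<dots> \<le> (\<integral>x. \<bar>?f t x - ?f t' x\<bar> \<partial>\<pi>)" by (rule integral_abs_bound)
  also have "\<dots> \<le> (\<integral>x. K * dT t t' \<partial>\<pi>)"
  proof (rule integral_mono)
    fix x assume "x \<in> space \<pi>"
    then have x: "x \<in> M" using prob_measuresD(3)[OF \<pi>] by simp
    show "\<bar>?f t x - ?f t' x\<bar> \<le> K * dT t t'" using inner_integral_lipschitz[OF t x x] x by simp
  qed (use i t in auto)
  finally show ?thesis using t p.prob_space by (simp add: mixed_cost_eq \<pi>)
qed

end

text \<open>Reindexing pushes the product of the \<rho> k to the product of the \<rho> (\<sigma> k),
  and symmetry of \<open>J\<close> absorbs the permutation of the variables. It lets an optimal
  assignment act on the opponents at no cost.\<close>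

lemma mixed_cost_permute:
  assumes \<rho>: "\<And>k. k \<in> {1..<N} \<Longrightarrow> \<rho> k \<in> prob_measures mtopology"
    and t: "t \<in> types" and \<pi>: "\<pi> \<in> prob_measures mtopology" and \<sigma>: "\<sigma> permutes {1..<N}"
  shows "mixed_cost N J t \<pi> (\<lambda>k. \<rho> (\<sigma> k)) = mixed_cost N J t \<pi> \<rho>"
proof -
  let ?I = "{1..<N}" and ?g = "\<lambda>z. \<lambda>k\<in>{1..<N}. z (\<sigma> k)"
  have \<sigma>I: "\<sigma> k \<in> ?I" if "k \<in> ?I" for k using permutes_in_image[OF \<sigma>] that by simp
  have eqs: "mixed_cost N J t \<pi> \<rho> = (\<integral>x. (\<integral>z. J t x z \<partial>PiM ?I \<rho>) \<partial>\<pi>)"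
      "mixed_cost N J t \<pi> (\<lambda>k. \<rho> (\<sigma> k)) = (\<integral>x. (\<integral>z. J t x z \<partial>\<Pi>\<^sub>M k\<in>?I. \<rho> (\<sigma> k)) \<partial>\<pi>)"
    by (rule mixed_cost_eq[OF _ t \<pi>], rule \<rho>, assumption)
      (rule mixed_cost_eq[OF _ t \<pi>], rule \<rho>[OF \<sigma>I])
  show ?thesis unfolding eqs
  proof (rule Bochner_Integration.integral_cong[OF refl])
    fix x assume "x \<in> space \<pi>"
    then have x: "x \<in> M" using prob_measuresD(3)[OF \<pi>] by simp
    have "distr (PiM ?I \<rho>) (\<Pi>\<^sub>M k\<in>?I. \<rho> (\<sigma> k)) ?g = (\<Pi>\<^sub>M k\<in>?I. \<rho> (\<sigma> k))"
      using prob_measuresD(1)[OF \<rho>] permutes_inj_on[OF \<sigma>] \<sigma>I by (intro distr_PiM_reindex) auto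
    then have "(\<integral>z. J t x z \<partial>\<Pi>\<^sub>M k\<in>?I. \<rho> (\<sigma> k))
        = (\<integral>z. J t x z \<partial>distr (PiM ?I \<rho>) (\<Pi>\<^sub>M k\<in>?I. \<rho> (\<sigma> k)) ?g)"
      by simp
    also have "\<dots> = (\<integral>z. J t x (?g z) \<partial>PiM ?I \<rho>)"
    proof (rule integral_distr)
      show "?g \<in> measurable (PiM ?I \<rho>) (\<Pi>\<^sub>M k\<in>?I. \<rho> (\<sigma> k))"
        by (intro measurable_restrict measurable_component_singleton \<sigma>I)
      have "sets (\<Pi>\<^sub>M k\<in>?I. \<rho> (\<sigma> k)) = sets (\<Pi>\<^sub>M k\<in>?I. borel_of mtopology)"
        by (rule PiM_measurable_cong) (rule \<rho>[OF \<sigma>I])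
      then show "J t x \<in> borel_measurable (\<Pi>\<^sub>M k\<in>?I. \<rho> (\<sigma> k))"
        using inner_measurable[OF \<rho> t x] by (simp cong: measurable_cong_sets)
    qed
    also have "\<dots> = (\<integral>z. J t x z \<partial>PiM ?I \<rho>)"
    proof (rule Bochner_Integration.integral_cong[OF refl])
      fix z assume "z \<in> space (PiM ?I \<rho>)"
      moreover have "space (PiM ?I \<rho>) = ?I \<rightarrow>\<^sub>E M" by (rule PiM_measurable_cong) (rule \<rho>)
      ultimately have z: "z \<in> ?I \<rightarrow>\<^sub>E M" by simp
      \<comment> \<open>Outside \<open>{1..<N}\<close> both sides are \<open>undefined\<close>:
        \<sigma> fixes those indices and z is extensional.\<close>
      have "?g z = z \<circ> \<sigma>"
        using z permutes_not_in[OF \<sigma>] by (auto simp: fun_eq_iff restrict_def PiE_def extensional_def)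
      then show "J t x (?g z) = J t x z" using symmetric[OF t x z \<sigma>] by simp
    qed
    finally show "(\<integral>z. J t x z \<partial>\<Pi>\<^sub>M k\<in>?I. \<rho> (\<sigma> k)) = (\<integral>z. J t x z \<partial>PiM ?I \<rho>)" .
  qed
qed

lemma mixed_cost_others_lipschitz:
  assumes t: "t \<in> types" and \<pi>: "\<pi> \<in> prob_measures mtopology"
    and \<rho>: "\<And>k. k \<in> {1..<N} \<Longrightarrow> \<rho> k \<in> prob_measures mtopology"
    and \<rho>': "\<And>k. k \<in> {1..<N} \<Longrightarrow> \<rho>' k \<in> prob_measures mtopology"
  shows "\<bar>mixed_cost N J t \<pi> \<rho> - mixed_cost N J t \<pi> \<rho>'\<bar>
    \<le> K / (real N - 1) * (\<Sum>k\<in>{1..<N}. wasserstein1 M d (\<rho> k) (\<rho>' k))"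
proof -
  interpret p: prob_space \<pi> by (rule prob_measuresD(1)[OF \<pi>])
  let ?f = "\<lambda>\<rho> x. \<integral>z. J t x z \<partial>\<Pi>\<^sub>M k\<in>{1..<N}. \<rho> k"
    and ?D = "K / (real N - 1) * (\<Sum>k\<in>{1..<N}. wasserstein1 M d (\<rho> k) (\<rho>' k))"
  have i: "integrable \<pi> (?f \<rho>)" "integrable \<pi> (?f \<rho>')"
    by (rule bm.lipschitz_bounded_measurable(2)[OF inner_integral_lipschitz_point[OF \<rho> t] K \<pi>],
        assumption+)
      (rule bm.lipschitz_bounded_measurable(2)[OF inner_integral_lipschitz_point[OF \<rho>' t] K \<pi>],
        assumption+)
  have eqs: "mixed_cost N J t \<pi> \<rho> = (\<integral>x. ?f \<rho> x \<partial>\<pi>)" "mixed_cost N J t \<pi> \<rho>' = (\<integral>x. ?f \<rho>' x \<partial>\<pi>)"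
    by (rule mixed_cost_eq[OF _ t \<pi>], rule \<rho>, assumption)
      (rule mixed_cost_eq[OF _ t \<pi>], rule \<rho>')
  have le: "\<bar>?f \<rho> x - ?f \<rho>' x\<bar> \<le> ?D" if x: "x \<in> M" for x
  proof -
    \<comment> \<open>\<open>PiM_integral_lipschitz\<close> asks for a probability measure at every
      index, so the tuples are padded with \<pi> off \<open>{1..<N}\<close>; the product measures do
      not change.\<close>
    define ext where "ext \<rho> = (\<lambda>k. if k \<in> {1..<N} then \<rho> k else \<pi>)" for \<rho> :: "nat \<Rightarrow> 'x measure"
    have e: "PiM {1..<N} \<rho> = PiM {1..<N} (ext \<rho>)" for \<rho>
      by (rule PiM_cong) (auto simp: ext_def)
    have "\<bar>(\<integral>z. J t x z \<partial>PiM {1..<N} (ext \<rho>)) - (\<integral>z. J t x z \<partial>PiM {1..<N} (ext \<rho>'))\<bar>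
        \<le> K / (real N - 1) * (\<Sum>k\<in>{1..<N}. wasserstein1 M d (ext \<rho> k) (ext \<rho>' k))"
      by (rule PiM_integral_lipschitz[OF _ _ _ inner_measurable[OF \<rho> t x] inner_lipschitz[OF \<rho> t x]])
        (use K players \<rho> \<rho>' \<pi> in \<open>auto simp: ext_def\<close>)
    also have "(\<Sum>k\<in>{1..<N}. wasserstein1 M d (ext \<rho> k) (ext \<rho>' k)) = (\<Sum>k\<in>{1..<N}. wasserstein1 M d (\<rho> k) (\<rho>' k))"
      by (rule sum.cong) (auto simp: ext_def)
    finally show ?thesis unfolding e[symmetric] .
  qed
  have "\<bar>(\<integral>x. ?f \<rho> x \<partial>\<pi>) - (\<integral>x. ?f \<rho>' x \<partial>\<pi>)\<bar> = \<bar>\<integral>x. ?f \<rho> x - ?f \<rho>' x \<partial>\<pi>\<bar>"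
    using i by simp
  also have "\<dots> \<le> (\<integral>x. \<bar>?f \<rho> x - ?f \<rho>' x\<bar> \<partial>\<pi>)" by (rule integral_abs_bound)
  also have "\<dots> \<le> (\<integral>x. ?D \<partial>\<pi>)"
    using i le prob_measuresD(3)[OF \<pi>] by (intro integral_mono) auto
  also have "\<dots> = ?D" using p.prob_space by simp
  finally show ?thesis unfolding eqs .
qed

end

section \<open>The extended cost\<close>

lemma others_reindex:
  fixes i N :: nat
  assumes "i \<in> {1..N}"
  shows "bij_betw (\<lambda>k. if k < i then k else k + 1) {1..<N} ({1..N} - {i})"
proof (rule bij_betwI[where g = "\<lambda>k. if k < i then k else k - 1"])
qed (use assms in \<open>auto split: if_splits\<close>)

context mean_field_game
begin

abbreviation "profiles \<equiv> {1..<N} \<rightarrow>\<^sub>E prob_measures mtopology"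

abbreviation "w2 \<equiv> wasserstein1 (prob_measures mtopology) (wasserstein1 M d)"

abbreviation "empirical I \<rho> \<equiv> empirical_measure PM.mtopology I \<rho>"

abbreviation "ext_cost \<equiv> extended_cost M d dT K N types J"

text \<open>A real infimum is meaningful only with a lower bound. Moving any profile to the constant
  profile \<pi> costs at most \<open>K * B\<close>, and moving any type to \<open>t0\<close> at most
  \<open>K\<close> times the largest distance to it; the penalty terms are nonnegative.\<close>

lemma extended_cost_bdd_below:
  assumes \<pi>: "\<pi> \<in> prob_measures mtopology"
  shows "bdd_below ((\<lambda>(\<rho>, t). mixed_cost N J t \<pi> \<rho> + K * dT t \<theta> + K * w2 Q (empirical {1..<N} \<rho>)) ` (profiles \<times> types))"
proof -
  obtain t0 where t0: "t0 \<in> types" using types by blast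
  let ?\<rho>0 = "\<lambda>k\<in>{1..<N}. \<pi>" and ?C = "Max ((\<lambda>t. dT t t0) ` types)"
  have "mixed_cost N J t0 \<pi> ?\<rho>0 - K * ?C - K * B \<le> mixed_cost N J t \<pi> \<rho> + K * dT t \<theta> + K * w2 Q (empirical {1..<N} \<rho>)"
    if \<rho>: "\<rho> \<in> profiles" and t: "t \<in> types" for \<rho> t
  proof -
    have r: "\<rho> k \<in> prob_measures mtopology" "?\<rho>0 k \<in> prob_measures mtopology" if "k \<in> {1..<N}" for k
      using \<rho> \<pi> that by auto
    have "(\<Sum>k\<in>{1..<N}. wasserstein1 M d (\<rho> k) (?\<rho>0 k)) \<le> (\<Sum>k\<in>{1..<N}. B)"
      by (intro sum_mono PM.bounded r)
    then have "K / (real N - 1) * (\<Sum>k\<in>{1..<N}. wasserstein1 M d (\<rho> k) (?\<rho>0 k)) \<le> K / (real N - 1) * ((real N - 1) * B)"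
      using K players by (intro mult_left_mono) auto
    also have "\<dots> = K * B" using players(4) by simp
    finally have 1: "K / (real N - 1) * (\<Sum>k\<in>{1..<N}. wasserstein1 M d (\<rho> k) (?\<rho>0 k)) \<le> K * B" .
    have "dT t t0 \<le> ?C" using t types by (intro Max_ge) auto
    then have 2: "K * dT t t0 \<le> K * ?C" using K by (rule mult_left_mono)
    have "\<bar>mixed_cost N J t \<pi> \<rho> - mixed_cost N J t \<pi> ?\<rho>0\<bar> \<le> K / (real N - 1) * (\<Sum>k\<in>{1..<N}. wasserstein1 M d (\<rho> k) (?\<rho>0 k))"
      by (rule mixed_cost_others_lipschitz[OF t \<pi> r])
    moreover have "\<bar>mixed_cost N J t \<pi> ?\<rho>0 - mixed_cost N J t0 \<pi> ?\<rho>0\<bar> \<le> K * dT t t0"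
      by (rule mixed_cost_type_lipschitz[OF r(2) t t0 \<pi>])
    moreover have "K * dT t \<theta> \<ge> 0" "K * w2 Q (empirical {1..<N} \<rho>) \<ge> 0"
      using K PM.wasserstein1_nonneg by auto
    ultimately show ?thesis using 1 2 by linarith
  qed
  then show ?thesis by (intro bdd_belowI2) auto
qed

lemma extended_cost_le:
  assumes "\<pi> \<in> prob_measures mtopology" "\<rho> \<in> profiles" "t \<in> types"
  shows "ext_cost (\<theta>, \<pi>, Q) \<le> mixed_cost N J t \<pi> \<rho> + K * dT t \<theta> + K * w2 Q (empirical {1..<N} \<rho>)"
proof -
  have "(\<rho>, t) \<in> profiles \<times> types" using assms by simp
  from cINF_lower[OF extended_cost_bdd_below[OF assms(1)] this] show ?thesis
    by (simp add: extended_cost_def)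
qed

lemma extended_cost_ge:
  assumes "\<pi> \<in> prob_measures mtopology"
    and "\<And>\<rho> t. \<rho> \<in> profiles \<Longrightarrow> t \<in> types \<Longrightarrow>
      c \<le> mixed_cost N J t \<pi> \<rho> + K * dT t \<theta> + K * w2 Q (empirical {1..<N} \<rho>)"
  shows "c \<le> ext_cost (\<theta>, \<pi>, Q)"
proof -
  have "(\<lambda>k\<in>{1..<N}. \<pi>) \<in> profiles" using assms by auto
  then have "profiles \<times> types \<noteq> {}" using types by blast
  then show ?thesis
    unfolding extended_cost_def prod.case by (rule cINF_greatest) (use assms(2) in auto)
qed

text \<open>Every term of the infimum has this modulus in (\<theta>, \<pi>), hence so has the
  infimum. Nothing in it depends on N, and therefore it survives in the limit
  \<open>F\<close>.\<close>

lemma extended_cost_close: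
  assumes \<theta>: "\<theta> \<in> \<Theta>" "\<theta>' \<in> \<Theta>" and \<pi>: "\<pi> \<in> prob_measures mtopology" "\<pi>' \<in> prob_measures mtopology"
    and close: "\<And>f. (\<forall>x\<in>M. \<forall>y\<in>M. \<bar>f x - f y\<bar> \<le> K * d x y) \<Longrightarrow>
      \<bar>(\<integral>x. f x \<partial>\<pi>) - (\<integral>x. f x \<partial>\<pi>')\<bar> \<le> e"
  shows "ext_cost (\<theta>, \<pi>, Q) - K * dT \<theta> \<theta>' - e \<le> ext_cost (\<theta>', \<pi>', Q)"
proof (rule extended_cost_ge[OF \<pi>(2)])
  fix \<rho> t assume \<rho>: "\<rho> \<in> profiles" and t: "t \<in> types"
  have r: "\<rho> k \<in> prob_measures mtopology" if "k \<in> {1..<N}" for k using \<rho> that by auto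
  have "dT t \<theta> \<le> dT t \<theta>' + dT \<theta> \<theta>'"
    using type.triangle[of t \<theta>' \<theta>] type.commute[of \<theta> \<theta>'] \<theta> t types by auto
  from mult_left_mono[OF this K] have "K * dT t \<theta> \<le> K * dT t \<theta>' + K * dT \<theta> \<theta>'"
    by (simp add: distrib_left)
  moreover have "\<bar>mixed_cost N J t \<pi> \<rho> - mixed_cost N J t \<pi>' \<rho>\<bar> \<le> e"
    by (rule mixed_cost_close[OF r t \<pi> close])
  ultimately show "ext_cost (\<theta>, \<pi>, Q) - K * dT \<theta> \<theta>' - e \<le> mixed_cost N J t \<pi>' \<rho> + K * dT t \<theta>' + K * w2 Q (empirical {1..<N} \<rho>)"
    using extended_cost_le[OF \<pi>(1) \<rho> t, of \<theta> Q] by linarith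
qed

section \<open>Extended cost at an empirical measure versus mixed cost at its profile\<close>

context
  fixes p :: "nat \<Rightarrow> 'x measure" and i :: nat
  assumes p: "\<And>j. j \<in> {1..N} \<Longrightarrow> p j \<in> prob_measures mtopology" and i: "i \<in> {1..N}"
begin

lemma others_eq: "k \<in> {1..<N} \<Longrightarrow> others N i p k = p (if k < i then k else k + 1)"
  by (simp add: others_def)

lemma others_profile: "others N i p \<in> profiles"
  using p by (auto simp: others_def)

text \<open>The mass 1/N of player i is spread evenly over the others and everything else stays put.
  On the index set \<open>{1..N} \<times> {1..<N}\<close> a pair with first entry i matches
  \<open>p i\<close> with an opponent, and any other pair matches a strategy with itself. Thus N-1
  of the N(N-1) pairs cost at most \<open>B\<close>.\<close>

lemma w2_others_le: "w2 (empirical {1..N} p) (empirical {1..<N} (others N i p)) \<le> B / real N"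
proof -
  let ?\<phi> = "\<lambda>k. if k < i then k else k + 1" and ?o = "others N i p"
  let ?K = "{1..N} \<times> {1..<N}" and ?g = "\<lambda>q. if fst q = i then i else (if snd q < i then snd q else snd q + 1)"
  have o: "?o k \<in> prob_measures mtopology" if "k \<in> {1..<N}" for k
    using others_profile that by blast
  have gp: "p (?g q) \<in> prob_measures mtopology" if "q \<in> ?K" for q using that i by (intro p) auto
  have 1: "empirical ?K (\<lambda>q. p (?g q)) = empirical {1..N} p"
  proof (rule empirical_measure_fibres[where m = "N - 1"])
    fix j assume j: "j \<in> {1..N}"
    show "card {q \<in> ?K. ?g q = j} = N - 1"
    proof (cases "j = i")
      case True
      have "{q \<in> ?K. ?g q = j} = {i} \<times> {1..<N}" using True i by (auto split: if_splits)
      then show ?thesis by (simp add: card_cartesian_product)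
    next
      case False
      let ?k = "if j < i then j else j - 1"
      have "{q \<in> ?K. ?g q = j} = ({1..N} - {i}) \<times> {?k}" using False i j by (auto split: if_splits)
      then show ?thesis using i by (simp add: card_cartesian_product)
    qed
  qed (use N i p in \<open>auto split: if_splits\<close>)
  have 2: "empirical ?K (\<lambda>q. ?o (snd q)) = empirical {1..<N} ?o"
  proof (rule empirical_measure_fibres[where m = N])
    fix j assume j: "j \<in> {1..<N}"
    have "{q \<in> ?K. snd q = j} = {1..N} \<times> {j}" using j by auto
    then show "card {q \<in> ?K. snd q = j} = N" by (simp add: card_cartesian_product)
  qed (use N o in auto)
  have "w2 (empirical {1..N} p) (empirical {1..<N} ?o)
      \<le> (\<Sum>q\<in>?K. wasserstein1 M d (p (?g q)) (?o (snd q))) / real (card ?K)"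
    unfolding 1[symmetric] 2[symmetric]
    by (rule PM.wasserstein1_empirical_measure_le) (use N gp o in auto)
  also have "(\<Sum>q\<in>?K. wasserstein1 M d (p (?g q)) (?o (snd q))) \<le> (\<Sum>q\<in>?K. if fst q = i then B else 0)"
  proof (rule sum_mono)
    fix q assume q: "q \<in> ?K"
    then have q2: "snd q \<in> {1..<N}" by auto
    show "wasserstein1 M d (p (?g q)) (?o (snd q)) \<le> (if fst q = i then B else 0)"
      using PM.bounded[OF gp[OF q] o[OF q2]] o[OF q2] others_eq[OF q2] by auto
  qed
  also have "(\<Sum>q\<in>?K. if fst q = i then B else 0) = (\<Sum>k\<in>{1..N}. \<Sum>l\<in>{1..<N}. if k = i then B else 0)"
    by (subst sum.cartesian_product) (simp add: split_beta)
  also have "\<dots> = (\<Sum>k\<in>{1..N}. if k = i then (real N - 1) * B else 0)"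
    using players by (intro sum.cong) auto
  also have "\<dots> = (real N - 1) * B" using i by simp
  also have "(real N - 1) * B / real (card ?K) = B / real N"
    using players(4,5) N by (simp add: card_cartesian_product)
  finally show ?thesis by (simp add: divide_right_mono)
qed

text \<open>Weak duality on \<P>(X): the dual solution of the assignment problem yields a
  1-Lipschitz f whose integrals bound the transport cost from below. Replacing the average of f over
  all N players by the average over the other N-1 produces the error
  \<open>B / real N\<close>.\<close>

lemma w2_ge_assignment:
  assumes \<rho>: "\<rho> \<in> profiles"
  obtains \<sigma> where "\<sigma> permutes {1..<N}"
    "(\<Sum>k\<in>{1..<N}. wasserstein1 M d (others N i p k) (\<rho> (\<sigma> k))) / (real N - 1)
      \<le> w2 (empirical {1..N} p) (empirical {1..<N} \<rho>) + B / real N"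
proof -
  let ?I = "{1..<N}" and ?o = "others N i p" and ?W = "wasserstein1 M d"
  have o: "?o k \<in> prob_measures mtopology" if "k \<in> ?I" for k using others_profile that by blast
  have r: "\<rho> k \<in> prob_measures mtopology" if "k \<in> ?I" for k using \<rho> that by blast
  obtain \<sigma> u where \<sigma>: "\<sigma> permutes ?I"
    and u: "\<And>k l. k \<in> ?I \<Longrightarrow> l \<in> ?I \<Longrightarrow> ?W (?o k) (\<rho> (\<sigma> k)) + u (\<sigma> k) \<le> ?W (?o k) (\<rho> l) + u l"
    using optimal_assignment[OF players(1), of "\<lambda>k l. ?W (?o k) (\<rho> l)"] by blast
  \<comment> \<open>The largest 1-Lipschitz function bounded by \<open>u l\<close> at each
    \<open>\<rho> l\<close>. Optimality of \<sigma> says that at the k-th opponent it is at least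
    the assignment cost plus \<open>u (\<sigma> k)\<close>.\<close>
  define f where "f \<alpha> = Min ((\<lambda>l. ?W \<alpha> (\<rho> l) + u l) ` ?I)" for \<alpha>
  have f_le: "f \<alpha> \<le> ?W \<alpha> (\<rho> l) + u l" if "l \<in> ?I" for \<alpha> l
    unfolding f_def using that by (intro Min_le) auto
  have f_ge: "c \<le> f \<alpha>" if "\<And>l. l \<in> ?I \<Longrightarrow> c \<le> ?W \<alpha> (\<rho> l) + u l" for c \<alpha>
    unfolding f_def using that players by (intro Min.boundedI) auto
  have f1: "f \<alpha> - ?W \<alpha> \<beta> \<le> f \<beta>" if "\<alpha> \<in> prob_measures mtopology" "\<beta> \<in> prob_measures mtopology" for \<alpha> \<beta>
  proof (rule f_ge)
    fix l assume l: "l \<in> ?I"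
    show "f \<alpha> - ?W \<alpha> \<beta> \<le> ?W \<beta> (\<rho> l) + u l"
      using f_le[OF l, of \<alpha>] PM.triangle[OF that r[OF l]] by linarith
  qed
  have f_lip: "\<bar>f \<alpha> - f \<beta>\<bar> \<le> 1 * ?W \<alpha> \<beta>" if "\<alpha> \<in> prob_measures mtopology" "\<beta> \<in> prob_measures mtopology" for \<alpha> \<beta>
    using f1[OF that] f1[OF that(2,1)] PM.commute[of \<alpha> \<beta>] by linarith
  have fm: "f \<in> borel_measurable (borel_of PM.mtopology)"
    by (rule continuous_map_borel_measurable[OF PM.lipschitz_continuous_map[OF f_lip]])
  have ne: "couplings PM.mtopology (empirical {1..N} p) (empirical ?I \<rho>) \<noteq> {}"
    by (rule couplings_empirical_measure_nonempty) (use N p r in auto)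
  have "(\<integral>\<alpha>. f \<alpha> \<partial>empirical {1..N} p) = (\<Sum>j\<in>{1..N}. f (p j)) / card {1..N}"
    by (rule integral_empirical_measure[OF _ _ _ fm]) (use N p in auto)
  moreover have "(\<integral>\<alpha>. f \<alpha> \<partial>empirical ?I \<rho>) = (\<Sum>l\<in>?I. f (\<rho> l)) / card ?I"
    by (rule integral_empirical_measure[OF _ _ _ fm]) (use N r in auto)
  ultimately have W: "(\<Sum>j\<in>{1..N}. f (p j)) / real N - (\<Sum>l\<in>?I. f (\<rho> l)) / (real N - 1)
      \<le> w2 (empirical {1..N} p) (empirical ?I \<rho>)"
    using PM.lipschitz_integral_le_wasserstein1[OF ne f_lip] players(3,5) by simp
  define S where "S = (\<Sum>k\<in>?I. f (?o k))"
  have "(\<Sum>k\<in>?I. f (?o k)) = (\<Sum>k\<in>?I. f (p (if k < i then k else k + 1)))"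
    by (intro sum.cong) (simp_all add: others_eq)
  also have "\<dots> = (\<Sum>j\<in>{1..N} - {i}. f (p j))"
    by (rule sum.reindex_bij_betw[OF others_reindex[OF i]])
  finally have sum_p: "(\<Sum>j\<in>{1..N}. f (p j)) = f (p i) + S"
    using i by (simp add: S_def sum.remove[of _ i])
  have "S \<le> (\<Sum>k\<in>?I. f (p i) + B)" unfolding S_def
  proof (rule sum_mono)
    fix k assume "k \<in> ?I"
    from f_lip[OF o[OF this] p[OF i]] PM.bounded[OF o[OF this] p[OF i]] show "f (?o k) \<le> f (p i) + B" by linarith
  qed
  then have S: "S / (real N - 1) \<le> f (p i) + B" using players(3,4,5) by (simp add: field_simps)
  \<comment> \<open>The mean over the others is written as a mean of N values, namely the N-1 values
    of f and their mean once more. Replacing that extra value by \<open>f (p i)\<close> changes it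
    by at most \<open>B\<close>, which is then divided by N.\<close>
  have "S / (real N - 1) = (S + S / (real N - 1)) / real N"
    using players(4) by (simp add: field_simps)
  also have "\<dots> \<le> (S + (f (p i) + B)) / real N" using S by (intro divide_right_mono) auto
  also have "\<dots> = (\<Sum>j\<in>{1..N}. f (p j)) / real N + B / real N"
    unfolding sum_p by (simp add: add_divide_distrib)
  finally have S': "S / (real N - 1) \<le> (\<Sum>j\<in>{1..N}. f (p j)) / real N + B / real N" .
  have "(\<Sum>k\<in>?I. ?W (?o k) (\<rho> (\<sigma> k)) + u (\<sigma> k)) \<le> S" unfolding S_def
    by (intro sum_mono f_ge u)
  moreover have "(\<Sum>l\<in>?I. f (\<rho> l)) \<le> (\<Sum>l\<in>?I. u l)"
    using f_le r by (intro sum_mono) (metis PM.mdist_zero add.left_neutral)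
  moreover have "(\<Sum>k\<in>?I. u (\<sigma> k)) = (\<Sum>l\<in>?I. u l)"
    by (rule sum.permute[OF \<sigma>, symmetric, unfolded comp_def])
  ultimately have "(\<Sum>k\<in>?I. ?W (?o k) (\<rho> (\<sigma> k))) \<le> S - (\<Sum>l\<in>?I. f (\<rho> l))"
    by (simp add: sum.distrib)
  then have "(\<Sum>k\<in>?I. ?W (?o k) (\<rho> (\<sigma> k))) / (real N - 1) \<le> S / (real N - 1) - (\<Sum>l\<in>?I. f (\<rho> l)) / (real N - 1)"
    using players(4) by (simp add: divide_right_mono flip: diff_divide_distrib)
  with S' W have "(\<Sum>k\<in>?I. ?W (?o k) (\<rho> (\<sigma> k))) / (real N - 1)
      \<le> w2 (empirical {1..N} p) (empirical ?I \<rho>) + B / real N" by linarith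
  with \<sigma> show thesis by (rule that)
qed

text \<open>The equilibrium opponents themselves, together with the exact type, are an admissible
  competitor in the infimum.\<close>

lemma extended_cost_upper:
  assumes "t \<in> types" "\<pi> \<in> prob_measures mtopology"
  shows "ext_cost (t, \<pi>, empirical {1..N} p) \<le> mixed_cost N J t \<pi> (others N i p) + K * B / real N"
proof -
  have "dT t t = 0" using assms types by auto
  then show ?thesis
    using extended_cost_le[OF assms(2) others_profile assms(1), of t "empirical {1..N} p"]
      mult_left_mono[OF w2_others_le K] by simp
qed

text \<open>A competitor \<rho> is relabelled by its optimal assignment, which leaves its mixed cost
  unchanged; exchanging the opponents then costs no more than the penalty in \<rho> plus
  \<open>K * B / real N\<close>, and changing the type no more than the penalty in the type.\<close>

lemma extended_cost_lower:
  assumes t: "t \<in> types" and \<pi>: "\<pi> \<in> prob_measures mtopology"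
  shows "mixed_cost N J t \<pi> (others N i p) - K * B / real N \<le> ext_cost (t, \<pi>, empirical {1..N} p)"
proof (rule extended_cost_ge[OF \<pi>])
  fix \<rho> t' assume \<rho>: "\<rho> \<in> profiles" and t': "t' \<in> types"
  have o: "others N i p k \<in> prob_measures mtopology" if "k \<in> {1..<N}" for k using others_profile that by blast
  have r: "\<rho> k \<in> prob_measures mtopology" if "k \<in> {1..<N}" for k using \<rho> that by blast
  obtain \<sigma> where \<sigma>: "\<sigma> permutes {1..<N}"
    "(\<Sum>k\<in>{1..<N}. wasserstein1 M d (others N i p k) (\<rho> (\<sigma> k))) / (real N - 1)
      \<le> w2 (empirical {1..N} p) (empirical {1..<N} \<rho>) + B / real N"
    using w2_ge_assignment[OF \<rho>] by blast
  have rs: "\<rho> (\<sigma> k) \<in> prob_measures mtopology" if "k \<in> {1..<N}" for k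
    using permutes_in_image[OF \<sigma>(1)] that by (intro r) blast
  have perm: "mixed_cost N J t \<pi> (\<lambda>k. \<rho> (\<sigma> k)) = mixed_cost N J t \<pi> \<rho>"
    by (rule mixed_cost_permute[OF _ t \<pi> \<sigma>(1)]) (rule r)
  have "\<bar>mixed_cost N J t \<pi> (others N i p) - mixed_cost N J t \<pi> (\<lambda>k. \<rho> (\<sigma> k))\<bar>
      \<le> K * ((\<Sum>k\<in>{1..<N}. wasserstein1 M d (others N i p k) (\<rho> (\<sigma> k))) / (real N - 1))"
    using mixed_cost_others_lipschitz[OF t \<pi> o rs] by simp
  also have "\<dots> \<le> K * w2 (empirical {1..N} p) (empirical {1..<N} \<rho>) + K * B / real N"
    using mult_left_mono[OF \<sigma>(2) K] by (simp add: distrib_left)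
  finally have "mixed_cost N J t \<pi> (others N i p) \<le> mixed_cost N J t \<pi> \<rho>
      + K * w2 (empirical {1..N} p) (empirical {1..<N} \<rho>) + K * B / real N"
    using perm by linarith
  moreover have "\<bar>mixed_cost N J t \<pi> \<rho> - mixed_cost N J t' \<pi> \<rho>\<bar> \<le> K * dT t' t"
    using mixed_cost_type_lipschitz[OF r t t' \<pi>] type.commute[of t t'] by simp
  ultimately show "mixed_cost N J t \<pi> (others N i p) - K * B / real N \<le>
      mixed_cost N J t' \<pi> \<rho> + K * dT t' t + K * w2 (empirical {1..N} p) (empirical {1..<N} \<rho>)"
    by linarith
qed

end

end

section \<open>Limits of equilibria\<close>

text \<open>Applied to the two projections, it identifies the marginals of \<gamma> as limits of the
  empirical marginals.\<close>

lemma limitin_weak_star_distr: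
  assumes lim: "limitin (weak_star S) \<alpha>s \<alpha> F" and f: "continuous_map S T f"
  shows "limitin (weak_star T) (\<lambda>n. distr (\<alpha>s n) (borel_of T) f) (distr \<alpha> (borel_of T) f) F"
  unfolding limitin_weak_star
proof (intro conjI allI impI)
  note L = lim[unfolded limitin_weak_star]
  have m: "f \<in> measurable (borel_of S) (borel_of T)" by (rule continuous_map_measurable[OF f])
  show "distr \<alpha> (borel_of T) f \<in> prob_measures T"
    using L m by (auto intro: distr_in_prob_measures)
  show "\<forall>\<^sub>F n in F. distr (\<alpha>s n) (borel_of T) f \<in> prob_measures T"
    using L m by (auto elim!: eventually_mono intro: distr_in_prob_measures)
  fix g assume g: "continuous_map T euclideanreal g"
  have eq: "(\<integral>x. g x \<partial>distr \<beta> (borel_of T) f) = (\<integral>x. g (f x) \<partial>\<beta>)" if "\<beta> \<in> prob_measures S" for \<beta>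
    using m g prob_measuresD(2)[OF that]
    by (intro integral_distr continuous_map_borel_measurable) (auto cong: measurable_cong_sets)
  have "((\<lambda>n. \<integral>x. g (f x) \<partial>\<alpha>s n) \<longlongrightarrow> (\<integral>x. g (f x) \<partial>\<alpha>)) F"
    using L continuous_map_compose[OF f g] by (simp add: comp_def)
  then show "((\<lambda>n. \<integral>x. g x \<partial>distr (\<alpha>s n) (borel_of T) f) \<longlongrightarrow> (\<integral>x. g x \<partial>distr \<alpha> (borel_of T) f)) F"
    using L eq by (auto simp: eq elim!: Lim_transform_eventually eventually_mono)
qed

lemma (in compact_metric) limitin_weak_star_unique:
  assumes "limitin (weak_star mtopology) \<alpha>s \<alpha> F" "limitin (weak_star mtopology) \<alpha>s \<beta> F" "F \<noteq> bot"
  shows "\<alpha> = \<beta>"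
proof (rule prob_measures_eqI)
  show "\<alpha> \<in> prob_measures mtopology" "\<beta> \<in> prob_measures mtopology"
    using assms by (auto simp: limitin_weak_star)
  fix f :: "'a \<Rightarrow> real" and L
  assume "\<And>x y. x \<in> M \<Longrightarrow> y \<in> M \<Longrightarrow> \<bar>f x - f y\<bar> \<le> L * d x y"
  then have "continuous_map mtopology euclideanreal f" by (rule lipschitz_continuous_map)
  then show "(\<integral>x. f x \<partial>\<alpha>) = (\<integral>x. f x \<partial>\<beta>)"
    using assms unfolding limitin_weak_star by (meson tendsto_unique)
qed

theorem theorem4p2:
  fixes X :: "'x set" and dX :: "'x \<Rightarrow> 'x \<Rightarrow> real"
    and \<Theta> :: "'t set" and dT :: "'t \<Rightarrow> 't \<Rightarrow> real"
    and K :: real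
    and \<theta> :: "nat \<Rightarrow> nat \<Rightarrow> 't"
    and J :: "nat \<Rightarrow> 't \<Rightarrow> 'x \<Rightarrow> (nat \<Rightarrow> 'x) \<Rightarrow> real"
    and \<pi> :: "nat \<Rightarrow> nat \<Rightarrow> 'x measure"
    and r :: "nat \<Rightarrow> nat"
    and \<mu> :: "'t measure" and \<nu> :: "'x measure measure" and \<gamma> :: "('t \<times> 'x measure) measure"
    and F :: "'t \<times> 'x measure \<times> 'x measure measure \<Rightarrow> real"
  assumes "Metric_space X dX" and "compact_space (mtop X dX)"
    and "Metric_space \<Theta> dT" and "compact_space (mtop \<Theta> dT)"
    and "K \<ge> 0"
    and types: "\<And>N i. N \<ge> 2 \<Longrightarrow> i \<in> {1..N} \<Longrightarrow> \<theta> N i \<in> \<Theta>"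
    and J_symmetric: "\<And>N t x z \<sigma>. N \<ge> 2 \<Longrightarrow> t \<in> \<theta> N ` {1..N} \<Longrightarrow> x \<in> X \<Longrightarrow>
      z \<in> {1..<N} \<rightarrow>\<^sub>E X \<Longrightarrow> \<sigma> permutes {1..<N} \<Longrightarrow> J N t x (z \<circ> \<sigma>) = J N t x z"
    and J_lipschitz: "\<And>N t t' x y z w. N \<ge> 2 \<Longrightarrow> t \<in> \<theta> N ` {1..N} \<Longrightarrow> t' \<in> \<theta> N ` {1..N} \<Longrightarrow>
      x \<in> X \<Longrightarrow> y \<in> X \<Longrightarrow> z \<in> {1..<N} \<rightarrow>\<^sub>E X \<Longrightarrow> w \<in> {1..<N} \<rightarrow>\<^sub>E X \<Longrightarrow>
      \<bar>J N t x z - J N t' y w\<bar> \<le> K * dT t t' + K * dX x y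
        + K * wasserstein1 X dX (empirical_measure (mtop X dX) {1..<N} z)
                                (empirical_measure (mtop X dX) {1..<N} w)"
    and nash: "\<And>N. N \<ge> 2 \<Longrightarrow>
      nash_equilibrium N (\<lambda>i. probs X dX) (\<lambda>i. mixed_cost N (J N) (\<theta> N i)) (\<pi> N)"
    and subsequence: "strict_mono r" "\<And>n. r n \<ge> 2"
    and \<mu>_lim: "limitin (weak_star (mtop \<Theta> dT))
      (\<lambda>n. empirical_measure (mtop \<Theta> dT) {1..r n} (\<theta> (r n))) \<mu> sequentially"
    and \<nu>_lim: "limitin (weak_star (probs_top X dX))
      (\<lambda>n. empirical_measure (probs_top X dX) {1..r n} (\<pi> (r n))) \<nu> sequentially"
    and \<gamma>_lim: "limitin (weak_star (prod_topology (mtop \<Theta> dT) (probs_top X dX)))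
      (\<lambda>n. empirical_measure (prod_topology (mtop \<Theta> dT) (probs_top X dX)) {1..r n}
             (\<lambda>i. (\<theta> (r n) i, \<pi> (r n) i))) \<gamma> sequentially"
    and F_continuous: "continuous_map
      (prod_topology (mtop \<Theta> dT) (prod_topology (probs_top X dX) (weak_star (probs_top X dX))))
      euclideanreal F"
    and F_lim: "uniform_limit (\<Theta> \<times> probs X dX \<times> prob_measures (probs_top X dX))
      (\<lambda>n. extended_cost X dX dT K (r n) (\<theta> (r n) ` {1..r n}) (J (r n))) F sequentially"
  shows "cournot_nash_equilibrium (mtop \<Theta> dT) (probs_top X dX) F \<mu> \<gamma>"
proof -
  interpret X: compact_metric X dX using assms(1,2) by (simp add: compact_metric_def compact_metric_axioms_def)
  interpret T: compact_metric \<Theta> dT using assms(3,4) by (simp add: compact_metric_def compact_metric_axioms_def)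
  obtain B where B: "bounded_metric X dX B" using X.bounded_metric_ex by blast
  let ?P = "probs X dX" and ?TT = "mtop \<Theta> dT" and ?TY = "probs_top X dX"
  let ?TP = "prod_topology ?TT ?TY"
  have game: "mean_field_game X dX \<Theta> dT K B N (\<theta> N ` {1..N}) (J N)" if "N \<ge> 2" for N
    using that X.compact_metric_axioms T.Metric_space_axioms B \<open>K \<ge> 0\<close> types[OF that]
      J_symmetric[OF that] J_lipschitz[OF that]
    by (auto simp: mean_field_game_def mean_field_game_axioms_def)
  interpret PM: bounded_metric ?P "wasserstein1 X dX" B by (rule X.bounded_metric_wasserstein1[OF B])
  have \<pi>P: "\<pi> N i \<in> ?P" if "N \<ge> 2" "i \<in> {1..N}" for N i
    using nash[OF that(1)] that(2) by (auto simp: nash_equilibrium_def)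
  define en where "en n = empirical_measure ?TY {1..r n} (\<pi> (r n))" for n
  define \<gamma>n where "\<gamma>n n = empirical_measure ?TP {1..r n} (\<lambda>i. (\<theta> (r n) i, \<pi> (r n) i))" for n
  define EC where "EC n = extended_cost X dX dT K (r n) (\<theta> (r n) ` {1..r n}) (J (r n))" for n
  \<comment> \<open>The equilibrium condition is phrased with the second marginal of \<gamma>;
    \<open>en_lim\<close> below shows that the empirical strategy measures converge to it.\<close>
  define \<nu>' where "\<nu>' = distr \<gamma> (borel_of ?TY) snd"
  define G where "G q = F (fst q, snd q, \<nu>')" for q
  have idx: "finite {1..r n}" "{1..r n} \<noteq> {}" "card {1..r n} = r n" for n
    using subsequence(2)[of n] by auto
  have pts: "(\<theta> (r n) i, \<pi> (r n) i) \<in> topspace ?TP" if "i \<in> {1..r n}" for n i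
    using types[OF subsequence(2) that] \<pi>P[OF subsequence(2) that] by simp
  have fst_m: "fst \<in> measurable (borel_of ?TP) (borel_of ?TT)" and snd_m: "snd \<in> measurable (borel_of ?TP) (borel_of ?TY)"
    by (auto intro!: continuous_map_measurable continuous_map_fst continuous_map_snd)
  have \<gamma>P: "\<gamma> \<in> prob_measures ?TP" using \<gamma>_lim by (simp add: limitin_weak_star)
  interpret g: prob_space \<gamma> by (rule prob_measuresD(1)[OF \<gamma>P])
  have en_lim: "limitin (weak_star ?TY) en \<nu>' sequentially"
  proof -
    have "distr (\<gamma>n n) (borel_of ?TY) snd = en n" for n
      unfolding \<gamma>n_def en_def using distr_empirical_measure[OF idx(1,2) pts snd_m] by simp
    then show ?thesis
      using limitin_weak_star_distr[OF \<gamma>_lim[folded \<gamma>n_def] continuous_map_snd] by (simp add: \<nu>'_def)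
  qed
  have fst_eq: "distr \<gamma> (borel_of ?TT) fst = \<mu>"
  proof -
    have "distr (\<gamma>n n) (borel_of ?TT) fst = empirical_measure ?TT {1..r n} (\<theta> (r n))" for n
      unfolding \<gamma>n_def using distr_empirical_measure[OF idx(1,2) pts fst_m] by simp
    then show ?thesis
      using limitin_weak_star_distr[OF \<gamma>_lim[folded \<gamma>n_def] continuous_map_fst] \<mu>_lim
      by (intro T.limitin_weak_star_unique[where F = sequentially]) auto
  qed
  have en: "en n \<in> prob_measures ?TY" for n
    unfolding en_def by (rule empirical_measure_in_prob_measures[OF idx(1,2)]) (use \<pi>P[OF subsequence(2)] in auto)
  have \<nu>': "\<nu>' \<in> prob_measures ?TY" using en_lim by (simp add: limitin_weak_star)

  \<comment> \<open>The test class is that of the inner integrals of the mixed costs, so this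
    closeness controls every extended cost, and finite nets for it exist.\<close>
  define close where "close e p q \<longleftrightarrow> (\<forall>f. (\<forall>x\<in>X. \<forall>y\<in>X. \<bar>f x - f y\<bar> \<le> K * dX x y) \<longrightarrow>
      \<bar>(\<integral>x. f x \<partial>p) - (\<integral>x. f x \<partial>q)\<bar> \<le> e)" for e p q
  have close_sym: "close e q p" if "close e p q" for e p q
    using that unfolding close_def by (simp add: abs_minus_commute)
  have net: "\<exists>S. finite S \<and> S \<subseteq> ?P \<and> (\<forall>p\<in>?P. \<exists>s\<in>S. close e p s)" if e: "e > 0" for e
    using X.finite_net_lipschitz_integrals[OF \<open>K \<ge> 0\<close> e] unfolding close_def by metis
  \<comment> \<open>A pointwise limit of the estimates for the extended costs, whose constants are
    the same for all n.\<close>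
  have F_le: "F (t, p, Q) \<le> F (t', p', Q) + K * dT t t' + e"
    if t: "t \<in> \<Theta>" "t' \<in> \<Theta>" and p: "p \<in> ?P" "p' \<in> ?P" and Q: "Q \<in> prob_measures ?TY" and cl: "close e p p'"
    for t t' p p' Q e
  proof -
    have "EC n (t, p, Q) - K * dT t t' - e \<le> EC n (t', p', Q)" for n
      unfolding EC_def
      by (rule mean_field_game.extended_cost_close[OF game[OF subsequence(2)] t p]) (use cl in \<open>auto simp: close_def\<close>)
    moreover have "(\<lambda>n. EC n (t, p, Q) - K * dT t t' - e) \<longlonglongrightarrow> F (t, p, Q) - K * dT t t' - e"
      using tendsto_uniform_limitI[OF F_lim, of "(t, p, Q)"] t p Q by (intro tendsto_intros) (auto simp: EC_def)
    moreover have "(\<lambda>n. EC n (t', p', Q)) \<longlonglongrightarrow> F (t', p', Q)"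
      using tendsto_uniform_limitI[OF F_lim, of "(t', p', Q)"] t p Q by (auto simp: EC_def)
    ultimately have "F (t, p, Q) - K * dT t t' - e \<le> F (t', p', Q)"
      by (intro LIMSEQ_le) auto
    then show ?thesis by simp
  qed
  \<comment> \<open>Continuity of \<open>F\<close> gives convergence only at fixed (t, p).
    Uniformity comes from a finite net in both variables: passing to the net costs \<delta>/3 at
    each of \<open>en n\<close> and \<nu>', and convergence on the net a further \<delta>/3.\<close>
  have F_unif: "\<forall>\<^sub>F n in sequentially. \<forall>t\<in>\<Theta>. \<forall>p\<in>?P. \<bar>F (t, p, en n) - F (t, p, \<nu>')\<bar> \<le> \<delta>" if \<delta>: "\<delta> > 0" for \<delta>
  proof -
    obtain S where S: "finite S" "S \<subseteq> ?P" "\<And>p. p \<in> ?P \<Longrightarrow> \<exists>s\<in>S. close (\<delta> / 6) p s"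
      using net[of "\<delta> / 6"] \<delta> by auto
    define \<epsilon> where "\<epsilon> = \<delta> / (6 * (K + 1))"
    have \<epsilon>: "\<epsilon> > 0" "K * \<epsilon> \<le> \<delta> / 6" using \<delta> \<open>K \<ge> 0\<close> by (auto simp: \<epsilon>_def field_simps)
    obtain D where D: "finite D" "D \<subseteq> \<Theta>" "\<Theta> \<subseteq> (\<Union>x\<in>D. T.mball x \<epsilon>)"
      using assms(4) \<epsilon>(1) unfolding T.compact_space_eq_mcomplete_mtotally_bounded T.mtotally_bounded_def by blast
    have "\<forall>\<^sub>F n in sequentially. dist (F (t, s, en n)) (F (t, s, \<nu>')) < \<delta> / 3" if ts: "t \<in> D" "s \<in> S" for t s
    proof -
      have "continuous_map (weak_star ?TY) euclideanreal (F \<circ> (\<lambda>Q. (t, s, Q)))"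
        using ts D S by (intro continuous_map_compose[OF _ F_continuous] continuous_map_pairedI) auto
      from continuous_map_limit[OF this en_lim]
      have "((\<lambda>n. F (t, s, en n)) \<longlongrightarrow> F (t, s, \<nu>')) sequentially" by (simp add: comp_def)
      then show ?thesis using \<delta> by (intro tendstoD) auto
    qed
    then have "\<forall>\<^sub>F n in sequentially. \<forall>t\<in>D. \<forall>s\<in>S. dist (F (t, s, en n)) (F (t, s, \<nu>')) < \<delta> / 3"
      by (intro eventually_ball_finite D S ballI)
    then show ?thesis
    proof (rule eventually_mono, intro ballI)
      fix n t p assume n: "\<forall>t\<in>D. \<forall>s\<in>S. dist (F (t, s, en n)) (F (t, s, \<nu>')) < \<delta> / 3"
        and t: "t \<in> \<Theta>" and p: "p \<in> ?P"
      obtain s where s: "s \<in> S" "close (\<delta> / 6) p s" using S(3)[OF p] by blast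
      obtain t' where t': "t' \<in> D" "dT t' t < \<epsilon>" using D(3) t by auto
      have tt: "t' \<in> \<Theta>" and ss: "s \<in> ?P" using t' s D S by auto
      have "K * dT t t' \<le> K * \<epsilon>" using t' \<open>K \<ge> 0\<close> T.commute[of t t'] by (intro mult_left_mono) auto
      then have Kd: "K * dT t t' \<le> \<delta> / 6" "K * dT t' t \<le> \<delta> / 6" using \<epsilon>(2) T.commute[of t t'] by auto
      have "\<bar>F (t, p, Q) - F (t', s, Q)\<bar> \<le> \<delta> / 3" if Q: "Q \<in> prob_measures ?TY" for Q
        using F_le[OF t tt p ss Q s(2)] F_le[OF tt t ss p Q close_sym[OF s(2)]] Kd by linarith
      from this[OF en[of n]] this[OF \<nu>'] show "\<bar>F (t, p, en n) - F (t, p, \<nu>')\<bar> \<le> \<delta>"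
        using n[rule_format, OF t'(1) s(1)] unfolding dist_real_def by linarith
    qed
  qed
  \<comment> \<open>Fifths of \<delta>: for each of the two strategies compared, one for replacing
    the extended cost by \<open>F\<close> and one for replacing \<open>en n\<close> by \<nu>'; the
    fifth covers the two errors \<open>K * B / real (r n)\<close> from the upper and the lower
    bound.\<close>
  have approx: "\<forall>\<^sub>F n in sequentially. \<forall>i\<in>{1..r n}. \<forall>y\<in>?P. G (\<theta> (r n) i, \<pi> (r n) i) \<le> G (\<theta> (r n) i, y) + \<delta>"
    if \<delta>: "\<delta> > 0" for \<delta>
  proof -
    have "(\<lambda>n. 2 * (K * B) / real n) \<longlonglongrightarrow> 0" by (rule lim_const_over_n)
    from LIMSEQ_subseq_LIMSEQ[OF this subsequence(1)]
    have "\<forall>\<^sub>F n in sequentially. 2 * (K * B) / real (r n) < \<delta> / 5"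
      using \<delta> by (intro order_tendstoD(2)) (auto simp: comp_def)
    moreover have "\<forall>\<^sub>F n in sequentially. \<forall>t\<in>\<Theta>. \<forall>p\<in>?P. \<bar>F (t, p, en n) - F (t, p, \<nu>')\<bar> \<le> \<delta> / 5"
      using \<delta> by (intro F_unif) simp
    moreover have "\<forall>\<^sub>F n in sequentially. \<forall>x\<in>\<Theta> \<times> ?P \<times> prob_measures ?TY. dist (EC n x) (F x) < \<delta> / 5"
      unfolding EC_def using \<delta> by (intro uniform_limitD[OF F_lim]) simp
    ultimately show ?thesis
    proof eventually_elim
      case (elim n)
      have E: "\<bar>EC n (t, p, en n) - G (t, p)\<bar> \<le> 2 * (\<delta> / 5)" if "t \<in> \<Theta>" "p \<in> ?P" for t p
      proof -
        have "\<bar>EC n (t, p, en n) - F (t, p, en n)\<bar> < \<delta> / 5"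
          using elim(3) that en[of n] by (auto simp: dist_real_def)
        then show ?thesis using elim(2)[rule_format, OF that] unfolding G_def fst_conv snd_conv by linarith
      qed
      show ?case
      proof (intro ballI)
        fix i y assume i: "i \<in> {1..r n}" and y: "y \<in> ?P"
        interpret game: mean_field_game X dX \<Theta> dT K B "r n" "\<theta> (r n) ` {1..r n}" "J (r n)"
          by (rule game[OF subsequence(2)])
        let ?t = "\<theta> (r n) i" and ?o = "others (r n) i (\<pi> (r n))"
        have t: "?t \<in> \<theta> (r n) ` {1..r n}" "?t \<in> \<Theta>" using i types[OF subsequence(2) i] by auto
        have p: "\<pi> (r n) i \<in> ?P" by (rule \<pi>P[OF subsequence(2) i])
        have "EC n (?t, \<pi> (r n) i, en n) \<le> mixed_cost (r n) (J (r n)) ?t (\<pi> (r n) i) ?o + K * B / real (r n)"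
          unfolding EC_def en_def by (rule game.extended_cost_upper[OF \<pi>P[OF subsequence(2)] i t(1) p])
        moreover have "mixed_cost (r n) (J (r n)) ?t (\<pi> (r n) i) ?o \<le> mixed_cost (r n) (J (r n)) ?t y ?o"
          using nash[OF subsequence(2), of n] i y by (auto simp: nash_equilibrium_def)
        moreover have "mixed_cost (r n) (J (r n)) ?t y ?o - K * B / real (r n) \<le> EC n (?t, y, en n)"
          unfolding EC_def en_def by (rule game.extended_cost_lower[OF \<pi>P[OF subsequence(2)] i t(1) y])
        ultimately have "EC n (?t, \<pi> (r n) i, en n) - EC n (?t, y, en n) \<le> K * B / real (r n) + K * B / real (r n)"
          by argo
        also have "\<dots> = 2 * (K * B) / real (r n)" by simp
        finally have "EC n (?t, \<pi> (r n) i, en n) \<le> EC n (?t, y, en n) + 2 * (K * B) / real (r n)"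
          by simp
        then show "G (?t, \<pi> (r n) i) \<le> G (?t, y) + \<delta>"
          using E[OF t(2) p] E[OF t(2) y] elim(1) by linarith
      qed
    qed
  qed
  have G_cont: "continuous_map ?TP euclideanreal G"
  proof -
    have "continuous_map ?TP euclideanreal (F \<circ> (\<lambda>q. (fst q, snd q, \<nu>')))"
      using \<nu>' by (intro continuous_map_compose[OF _ F_continuous] continuous_map_pairedI continuous_map_fst continuous_map_snd) simp
    then show ?thesis by (simp add: G_def[abs_def] comp_def)
  qed
  have Gy_cont: "continuous_map ?TP euclideanreal (\<lambda>q. G (fst q, y))" if "y \<in> ?P" for y
  proof -
    have "continuous_map ?TP euclideanreal (F \<circ> (\<lambda>q. (fst q, y, \<nu>')))"
      using \<nu>' that by (intro continuous_map_compose[OF _ F_continuous] continuous_map_pairedI continuous_map_fst) simp_all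
    then show ?thesis by (simp add: G_def comp_def)
  qed
  have borel_\<gamma>: "f \<in> borel_measurable \<gamma>" if "continuous_map ?TP euclideanreal f" for f
    using continuous_map_borel_measurable[OF that] prob_measuresD(2)[OF \<gamma>P] by (simp cong: measurable_cong_sets)
  have AE_y: "AE q in \<gamma>. G q \<le> G (fst q, y)" if y: "y \<in> ?P" for y
  proof -
    \<comment> \<open>Cutting at 0 makes a vanishing integral force \<open>h\<close> to vanish
      almost everywhere; cutting at 1 makes \<open>h\<close> integrable without a bound on
      \<open>G\<close>.\<close>
    define h where "h q = min 1 (max 0 (G q - G (fst q, y)))" for q
    have hc: "continuous_map ?TP euclideanreal h"
      unfolding h_def[abs_def]
      by (intro continuous_map_real_min continuous_map_real_max continuous_map_diff G_cont Gy_cont[OF y]) auto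
    have h0: "h q \<ge> 0" and h1: "h q \<le> 1" for q by (auto simp: h_def)
    have int: "(\<integral>q. h q \<partial>\<gamma>n n) = (\<Sum>i\<in>{1..r n}. h (\<theta> (r n) i, \<pi> (r n) i)) / real (r n)" for n
      unfolding \<gamma>n_def
      using integral_empirical_measure[OF idx(1)[of n] idx(2)[of n] pts continuous_map_borel_measurable[OF hc]] idx(3)[of n] by simp
    have lim: "(\<lambda>n. \<integral>q. h q \<partial>\<gamma>n n) \<longlonglongrightarrow> (\<integral>q. h q \<partial>\<gamma>)"
      using \<gamma>_lim hc by (simp add: limitin_weak_star \<gamma>n_def)
    have "(\<integral>q. h q \<partial>\<gamma>) \<le> 0"
    proof (rule field_le_epsilon)
      fix \<delta> :: real assume \<delta>: "\<delta> > 0"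
      have "\<forall>\<^sub>F n in sequentially. (\<integral>q. h q \<partial>\<gamma>n n) \<le> \<delta>"
        using approx[OF \<delta>]
      proof eventually_elim
        case (elim n)
        have "(\<Sum>i\<in>{1..r n}. h (\<theta> (r n) i, \<pi> (r n) i)) \<le> (\<Sum>i\<in>{1..r n}. \<delta>)"
        proof (rule sum_mono)
          fix i assume "i \<in> {1..r n}"
          then have "G (\<theta> (r n) i, \<pi> (r n) i) \<le> G (\<theta> (r n) i, y) + \<delta>" using elim y by blast
          then show "h (\<theta> (r n) i, \<pi> (r n) i) \<le> \<delta>" using \<delta> by (auto simp: h_def)
        qed
        then show ?case using subsequence(2)[of n] by (simp add: int field_simps)
      qed
      then show "(\<integral>q. h q \<partial>\<gamma>) \<le> 0 + \<delta>" using tendsto_upperbound[OF lim] by simp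
    qed
    moreover have "(\<integral>q. h q \<partial>\<gamma>) \<ge> 0" using h0 by (intro integral_nonneg_AE) auto
    ultimately have z: "(\<integral>q. h q \<partial>\<gamma>) = 0" by simp
    have hi: "integrable \<gamma> h"
      by (rule g.integrable_const_bound[of _ 1]) (use h0 h1 borel_\<gamma>[OF hc] in auto)
    have "AE q in \<gamma>. h q = 0"
      using integral_nonneg_eq_0_iff_AE[OF hi] h0 z by auto
    then show ?thesis by eventually_elim (auto simp: h_def min_def max_def split: if_splits)
  qed
  \<comment> \<open>Nets at all scales 1/(m+1): their union is the countable family of
    competitors.\<close>
  have "\<forall>m::nat. \<exists>S. finite S \<and> S \<subseteq> ?P \<and> (\<forall>p\<in>?P. \<exists>s\<in>S. close (inverse (Suc m)) p s)"
    by (intro allI net) simp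
  then obtain S where S: "\<And>m. finite (S m)" "\<And>m. S m \<subseteq> ?P"
    "\<And>m p. p \<in> ?P \<Longrightarrow> \<exists>s\<in>S m. close (inverse (Suc m)) p s" by metis
  have cS: "countable (\<Union>m. S m)" by (intro countable_UN countableI_type countable_finite S)
  have sp: "space \<gamma> = \<Theta> \<times> ?P" using prob_measuresD(3)[OF \<gamma>P] by simp
  \<comment> \<open>The set of minimisers quantifies over all of \<P>(X). Testing countably many
    competitors makes measurability visible, and this matters because \<open>emeasure\<close> is 0
    on nonmeasurable sets.\<close>
  define A where "A = {q \<in> space \<gamma>. \<forall>s\<in>(\<Union>m. S m). G q \<le> G (fst q, s)}"
  have "A \<in> sets \<gamma>"
    unfolding A_def
  proof (rule sets.sets_Collect_countable_All'[OF _ cS])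
    fix s assume "s \<in> (\<Union>m. S m)"
    then have "s \<in> ?P" using S(2) by blast
    then show "{q \<in> space \<gamma>. G q \<le> G (fst q, s)} \<in> sets \<gamma>"
      using borel_\<gamma>[OF G_cont] borel_\<gamma>[OF Gy_cont] by (intro borel_measurable_le) auto
  qed
  moreover have "AE q in \<gamma>. q \<in> A"
  proof -
    have "AE q in \<gamma>. \<forall>s\<in>(\<Union>m. S m). G q \<le> G (fst q, s)"
      using AE_y S(2) by (subst AE_ball_countable[OF cS]) blast
    then show ?thesis using AE_space by eventually_elim (simp add: A_def)
  qed
  ultimately have A1: "emeasure \<gamma> A = 1" by (rule g.emeasure_eq_1_AE)
  \<comment> \<open>By \<open>F_le\<close> with equal types, \<open>G (t, s)\<close> exceeds
    \<open>G (t, y)\<close> by at most 1/(m+1) when s is the net point for y, so minimality against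
    the nets is minimality against all competitors.\<close>
  have "A = {(\<theta>, y) \<in> \<Theta> \<times> ?P. is_arg_min (\<lambda>y'. F (\<theta>, y', \<nu>')) (\<lambda>y'. y' \<in> ?P) y}"
  proof (intro set_eqI iffI)
    fix q assume q: "q \<in> A"
    obtain t p where tp: "q = (t, p)" "t \<in> \<Theta>" "p \<in> ?P" using q sp by (cases q) (auto simp: A_def)
    have "G (t, p) \<le> G (t, y)" if y: "y \<in> ?P" for y
    proof (rule field_le_epsilon)
      fix e :: real assume "e > 0"
      then obtain m where m: "inverse (Suc m) < e" using reals_Archimedean by blast
      obtain s where s: "s \<in> S m" "close (inverse (Suc m)) y s" using S(3)[OF y] by blast
      have "G (t, p) \<le> G (t, s)" using q s(1) tp by (auto simp: A_def)
      moreover have "G (t, s) \<le> G (t, y) + inverse (Suc m)"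
        using F_le[OF tp(2) tp(2) _ y \<nu>' close_sym[OF s(2)]] s(1) S(2) tp(2) by (auto simp: G_def)
      ultimately show "G (t, p) \<le> G (t, y) + e" using m by linarith
    qed
    then show "q \<in> {(\<theta>, y) \<in> \<Theta> \<times> ?P. is_arg_min (\<lambda>y'. F (\<theta>, y', \<nu>')) (\<lambda>y'. y' \<in> ?P) y}"
      using tp by (auto simp: is_arg_min_def G_def not_less)
  next
    fix q assume "q \<in> {(\<theta>, y) \<in> \<Theta> \<times> ?P. is_arg_min (\<lambda>y'. F (\<theta>, y', \<nu>')) (\<lambda>y'. y' \<in> ?P) y}"
    then show "q \<in> A" using S(2) by (auto simp: A_def sp is_arg_min_def G_def not_less subset_iff)
  qed
  then show ?thesis
    unfolding cournot_nash_equilibrium_def using \<gamma>P fst_eq A1 by (simp add: \<nu>'_def Let_def)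
qed

end
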